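(* Let $\mathcal F_1$ and $\mathcal F_2$ be saturated fusion systems on finite $p$-groups $S_1$ and $S_2$ respectively, and let $\omega_1\in A(S_1,S_1)_{(p)}$ and $\omega_2\in A(S_2,S_2)_{(p)}$ be their characteristic idempotents. Then the map $\pi\colon A(S_1,S_2)_{(p)}\to A(\mathcal F_1,\mathcal F_2)_{(p)}$ given by $\pi(X):=\omega_2\circ X\circ\omega_1$ is a homomorphism of left $A(\mathcal F_2,\mathcal F_2)_{(p)}$-modules and right $A(\mathcal F_1,\mathcal F_1)_{(p)}$-modules.
   Context: Here $p$ is a prime and $p$-groups are finite. A fusion system $\mathcal F$ on a $p$-group $S$ is a category whose objects are the subgroups of $S$, whose morphism sets $\mathcal F(P,Q)=\mathrm{Hom}_{\mathcal F}(P,Q)$ consist of injective group homomorphisms $P\to Q$ (composed as homomorphisms) and contain all homomorphisms $P\to Q$ induced by conjugation by elements of $S$, and such that for each $\varphi\in\mathcal F(P,Q)$ the isomorphism $\varphi\colon P\to\varphi P$ and its inverse are morphisms of $\mathcal F$. Write $\mathrm{Aut}_{\mathcal F}(P)=\mathcal F(P,P)$. Subgroups $P,Q$ are $\mathcal F$-conjugate if they are isomorphic in $\mathcal F$; $[P]_{\mathcal F}$ is the set of $\mathcal F$-conjugates of $P$. $P$ is fully $\mathcal F$-normalized (resp. fully $\mathcal F$-centralized) if $|N_SP|\ge|N_SQ|$ (resp. $|C_SP|\ge|C_SQ|$) for all $Q\in[P]_{\mathcal F}$. $\mathcal F$ is saturated if for all $P\le S$: (1) if $P$ is fully $\mathcal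 F$-normalized, then $P$ is fully $\mathcal F$-centralized and $\mathrm{Aut}_S(P)$ is a Sylow $p$-subgroup of $\mathrm{Aut}_{\mathcal F}(P)$; (2) every $\varphi\in\mathcal F(P,S)$ with $\varphi(P)$ fully $\mathcal F$-centralized extends to a morphism in $\mathcal F(N_\varphi,S)$, where $N_\varphi=\{x\in N_S(P)\mid \exists y\in S:\varphi\circ c_x=c_y\circ\varphi\}$. Bisets: for finite groups $G,H$, a $(G,H)$-biset is a finite set with commuting right $G$-action and left $H$-action, regarded as a left $(H\times G)$-set via $(h,g).x=hxg^{-1}$. $A(G,H)$ is the Grothendieck group of isomorphism classes of $(G,H)$-bisets under disjoint union. Composition $\circ\colon A(H,K)\times A(G,H)\to A(G,K)$ is induced by $Y\circ X=Y\times_HX$. For $U\le G$ and a homomorphism $\varphi\colon U\to H$, $\Delta(U,\varphi)=\{(\varphi(u),u)\mid u\in U\}\le H\times G$ and $[U,\varphi]_G^H=[(H\times G)/\Delta(U,\varphi)]$. The subscript $(p)$ denotes tensoring with $\mathbb Z_{(p)}$. Stability: $X\in A(S_1,S_2)_{(p)}$ is right $\mathcal F_1$-stable if $X\circ[P,\varphi]_P^{S_1}=X\circ[P,\mathrm{id}]_P^{S_1}$ for all $P\le S_1$, $\varphi\in\mathcal F_1(P,S_1)$; it is left $\mathcal F_2$-stable if $[\varphi P,\varphi^{-1}]_{S_2}^P\circ X=[P,\mathrm{id}]_{S_2}^P\circ X$ for all $P\le S_2$, $\varphi\in\mathcal F_2(P,S_2)$. $A(\mathcal F_1,\mathcal F_2)_{(p)}$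 is the $\mathbb Z_{(p)}$-submodule of $A(S_1,S_2)_{(p)}$ of elements that are right $\mathcal F_1$-stable and left $\mathcal F_2$-stable; the case $\mathcal F_1=\mathcal F_2=\mathcal F$ gives the double Burnside ring $A(\mathcal F,\mathcal F)_{(p)}$ with multiplication $\circ$ and identity the characteristic idempotent of $\mathcal F$. The module structures are given by composition $\circ$. Characteristic idempotent: $X\in A(S,S)_{(p)}$ is $\mathcal F$-generated if it is a $\mathbb Z_{(p)}$-linear combination of elements $[P,\varphi]_S^S$ with $P\le S$, $\varphi\in\mathcal F(P,S)$. It is $\mathcal F$-characteristic if it is $\mathcal F$-generated, left and right $\mathcal F$-stable, and $\varepsilon(X)$ is invertible in $\mathbb Z_{(p)}$, where $\varepsilon$ is the $\mathbb Z_{(p)}$-linear extension of $X\mapsto|X|/|S|$ to the span of left-free bisets. For each saturated $\mathcal F$ there is exactly one idempotent (with respect to $\circ$) in $A(S,S)_{(p)}$ that is $\mathcal F$-characteristic; it is the characteristic idempotent of $\mathcal F$. *)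

theory Defs
  imports
    "HOL-Algebra.Group_Action"
    "HOL-Algebra.Left_Coset"
    "HOL-Algebra.Free_Abelian_Groups"
    "HOL-Algebra.Ring"
    "HOL-Computational_Algebra.Primes"
begin

section \<open>Fusion systems\<close>

definition p_group :: "nat \<Rightarrow> ('a, 'm) monoid_scheme \<Rightarrow> bool"
  where "p_group p S \<longleftrightarrow> group S \<and> finite (carrier S) \<and> (\<exists>n. order S = p ^ n)"

definition sylow_subgroup :: "nat \<Rightarrow> ('a, 'm) monoid_scheme \<Rightarrow> 'a set \<Rightarrow> bool"
  where "sylow_subgroup p G Q \<longleftrightarrow> subgroup Q G \<and> card Q = p ^ multiplicity p (order G)"

text \<open>The map \<open>P \<rightarrow> S\<close>, \<open>u \<mapsto> s u s\<^sup>-\<^sup>1\<close>. Maps between subgroups are functions that are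
  extensional on their domain, so that equal maps are equal functions.\<close>

definition conj_map :: "('a, 'm) monoid_scheme \<Rightarrow> 'a set \<Rightarrow> 'a \<Rightarrow> 'a \<Rightarrow> 'a"
  where "conj_map S P s = (\<lambda>u\<in>P. s \<otimes>\<^bsub>S\<^esub> u \<otimes>\<^bsub>S\<^esub> inv\<^bsub>S\<^esub> s)"

definition centralizer :: "('a, 'm) monoid_scheme \<Rightarrow> 'a set \<Rightarrow> 'a set"
  where "centralizer S P = {s \<in> carrier S. \<forall>u\<in>P. s \<otimes>\<^bsub>S\<^esub> u = u \<otimes>\<^bsub>S\<^esub> s}"

text \<open>\<open>F P Q\<close> is the set of morphisms from \<open>P\<close> to \<open>Q\<close>; it is only meaningful when \<open>P\<close> and \<open>Q\<close>
  are subgroups of \<open>S\<close>.\<close>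

locale fusion_system =
  fixes p :: nat
    and S :: "('a, 'm) monoid_scheme"
    and F :: "'a set \<Rightarrow> 'a set \<Rightarrow> ('a \<Rightarrow> 'a) set"
  assumes p_group: "p_group p S"
    and injective_hom:
      "\<lbrakk>subgroup P S; subgroup Q S; \<phi> \<in> F P Q\<rbrakk> \<Longrightarrow>
        \<phi> \<in> hom (S\<lparr>carrier := P\<rparr>) (S\<lparr>carrier := Q\<rparr>) \<and> inj_on \<phi> P \<and> \<phi> \<in> extensional P"
    and composition:
      "\<lbrakk>subgroup P S; subgroup Q S; subgroup R S; \<phi> \<in> F P Q; \<psi> \<in> F Q R\<rbrakk> \<Longrightarrow>
        compose P \<psi> \<phi> \<in> F P R"
    and identity: "subgroup P S \<Longrightarrow> (\<lambda>u\<in>P. u) \<in> F P P"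
    and conjugation:
      "\<lbrakk>subgroup P S; subgroup Q S; s \<in> carrier S; conj_map S P s ` P \<subseteq> Q\<rbrakk> \<Longrightarrow>
        conj_map S P s \<in> F P Q"
    and corestriction:
      "\<lbrakk>subgroup P S; subgroup Q S; \<phi> \<in> F P Q\<rbrakk> \<Longrightarrow>
        \<phi> \<in> F P (\<phi> ` P) \<and> (\<lambda>v\<in>\<phi> ` P. inv_into P \<phi> v) \<in> F (\<phi> ` P) P"

definition F_conjugates ::
    "('a, 'm) monoid_scheme \<Rightarrow> ('a set \<Rightarrow> 'a set \<Rightarrow> ('a \<Rightarrow> 'a) set) \<Rightarrow> 'a set \<Rightarrow> 'a set set"
  where "F_conjugates S F P = {Q. subgroup Q S \<and>
    (\<exists>\<phi>\<in>F P Q. \<exists>\<psi>\<in>F Q P. compose P \<psi> \<phi> = (\<lambda>u\<in>P. u) \<and> compose Q \<phi> \<psi> = (\<lambda>u\<in>Q. u))}"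

definition fully_normalized ::
    "('a, 'm) monoid_scheme \<Rightarrow> ('a set \<Rightarrow> 'a set \<Rightarrow> ('a \<Rightarrow> 'a) set) \<Rightarrow> 'a set \<Rightarrow> bool"
  where "fully_normalized S F P \<longleftrightarrow>
    (\<forall>Q\<in>F_conjugates S F P. card (normalizer S Q) \<le> card (normalizer S P))"

definition fully_centralized ::
    "('a, 'm) monoid_scheme \<Rightarrow> ('a set \<Rightarrow> 'a set \<Rightarrow> ('a \<Rightarrow> 'a) set) \<Rightarrow> 'a set \<Rightarrow> bool"
  where "fully_centralized S F P \<longleftrightarrow>
    (\<forall>Q\<in>F_conjugates S F P. card (centralizer S Q) \<le> card (centralizer S P))"

definition Aut_F :: "('a set \<Rightarrow> 'a set \<Rightarrow> ('a \<Rightarrow> 'a) set) \<Rightarrow> 'a set \<Rightarrow> ('a \<Rightarrow> 'a) monoid"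
  where "Aut_F F P = (BijGroup P)\<lparr>carrier := F P P\<rparr>"

definition Aut_S :: "('a, 'm) monoid_scheme \<Rightarrow> 'a set \<Rightarrow> ('a \<Rightarrow> 'a) set"
  where "Aut_S S P = conj_map S P ` normalizer S P"

definition N_phi :: "('a, 'm) monoid_scheme \<Rightarrow> 'a set \<Rightarrow> ('a \<Rightarrow> 'a) \<Rightarrow> 'a set"
  where "N_phi S P \<phi> = {x \<in> normalizer S P. \<exists>y\<in>carrier S.
    compose P \<phi> (conj_map S P x) = compose P (conj_map S (\<phi> ` P) y) \<phi>}"

locale saturated_fusion_system = fusion_system p S F
  for p :: nat
    and S :: "('a, 'm) monoid_scheme"
    and F :: "'a set \<Rightarrow> 'a set \<Rightarrow> ('a \<Rightarrow> 'a) set" +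
  assumes sylow_axiom:
      "\<lbrakk>subgroup P S; fully_normalized S F P\<rbrakk> \<Longrightarrow>
        fully_centralized S F P \<and> sylow_subgroup p (Aut_F F P) (Aut_S S P)"
    and extension_axiom:
      "\<lbrakk>subgroup P S; \<phi> \<in> F P (carrier S); fully_centralized S F (\<phi> ` P)\<rbrakk> \<Longrightarrow>
        \<exists>\<psi>\<in>F (N_phi S P \<phi>) (carrier S). \<forall>u\<in>P. \<psi> u = \<phi> u"


section \<open>Bisets\<close>

text \<open>A \<open>(G,H)\<close>-biset has a right \<open>G\<close>-action and a left \<open>H\<close>-action; the type parameters are
  in the order \<open>G\<close>, \<open>H\<close>, points.\<close>

record ('g, 'h, 'x) biset =
  points :: "'x set"
  lact :: "'h \<Rightarrow> 'x \<Rightarrow> 'x"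
  ract :: "'x \<Rightarrow> 'g \<Rightarrow> 'x"

definition is_biset ::
    "('g, 'm) monoid_scheme \<Rightarrow> ('h, 'n) monoid_scheme \<Rightarrow> ('g, 'h, 'x) biset \<Rightarrow> bool"
  where "is_biset G H X \<longleftrightarrow>
    finite (points X) \<and>
    (\<forall>x\<in>points X.
      (\<forall>h\<in>carrier H. lact X h x \<in> points X) \<and>
      (\<forall>g\<in>carrier G. ract X x g \<in> points X) \<and>
      lact X (\<one>\<^bsub>H\<^esub>) x = x \<and> ract X x \<one>\<^bsub>G\<^esub> = x \<and>
      (\<forall>h\<in>carrier H. \<forall>h'\<in>carrier H. lact X (h \<otimes>\<^bsub>H\<^esub> h') x = lact X h (lact X h' x)) \<and>
      (\<forall>g\<in>carrier G. \<forall>g'\<in>carrier G. ract X x (g \<otimes>\<^bsub>G\<^esub> g') = ract X (ract X x g) g') \<and>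
      (\<forall>h\<in>carrier H. \<forall>g\<in>carrier G. ract X (lact X h x) g = lact X h (ract X x g)))"

definition biset_iso ::
    "('g, 'm) monoid_scheme \<Rightarrow> ('h, 'n) monoid_scheme \<Rightarrow>
      ('g, 'h, 'x) biset \<Rightarrow> ('g, 'h, 'y) biset \<Rightarrow> bool"
  where "biset_iso G H X Y \<longleftrightarrow> (\<exists>f. bij_betw f (points X) (points Y) \<and>
    (\<forall>x\<in>points X.
      (\<forall>h\<in>carrier H. f (lact X h x) = lact Y h (f x)) \<and>
      (\<forall>g\<in>carrier G. f (ract X x g) = ract Y (f x) g)))"

text \<open>Every finite biset is isomorphic to one whose points are natural numbers, so the bisets on
  points of type \<^typ>\<open>nat\<close> represent all isomorphism classes, also those of bisets with points of
  another type.\<close>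

type_synonym ('g, 'h) biset_class = "('g, 'h, nat) biset set"

definition iso_class ::
    "('g, 'm) monoid_scheme \<Rightarrow> ('h, 'n) monoid_scheme \<Rightarrow>
      ('g, 'h, 'x) biset \<Rightarrow> ('g, 'h) biset_class"
  where "iso_class G H X = {Z. is_biset G H Z \<and> biset_iso G H X Z}"

definition empty_biset :: "('g, 'h, nat) biset"
  where "empty_biset = \<lparr>points = {}, lact = (\<lambda>h x. x), ract = (\<lambda>x g. x)\<rparr>"

definition disjoint_union ::
    "('g, 'h, 'x) biset \<Rightarrow> ('g, 'h, 'y) biset \<Rightarrow> ('g, 'h, 'x + 'y) biset"
  where "disjoint_union X Y =
    \<lparr>points = points X <+> points Y,
     lact = (\<lambda>h. map_sum (lact X h) (lact Y h)),
     ract = (\<lambda>z g. map_sum (\<lambda>x. ract X x g) (\<lambda>y. ract Y y g) z)\<rparr>"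

text \<open>\<open>Y \<times>\<^sub>H X\<close>: the quotient of \<open>Y \<times> X\<close> in which \<open>(y h, x)\<close> and \<open>(y, h x)\<close> are identified.\<close>

definition balance_rel ::
    "('h, 'n) monoid_scheme \<Rightarrow> ('h, 'k, 'y) biset \<Rightarrow> ('g, 'h, 'x) biset \<Rightarrow>
      (('y \<times> 'x) \<times> ('y \<times> 'x)) set"
  where "balance_rel H Y X =
    {((ract Y y h, x), (y, lact X h x)) | y x h.
      y \<in> points Y \<and> x \<in> points X \<and> h \<in> carrier H}"

definition biset_product ::
    "('h, 'n) monoid_scheme \<Rightarrow> ('h, 'k, 'y) biset \<Rightarrow> ('g, 'h, 'x) biset \<Rightarrow>
      ('g, 'k, ('y \<times> 'x) set) biset"
  where "biset_product H Y X =
    \<lparr>points = (points Y \<times> points X) // balance_rel H Y X,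
     lact = (\<lambda>k C. (\<lambda>(y, x). (lact Y k y, x)) ` C),
     ract = (\<lambda>C g. (\<lambda>(y, x). (y, ract X x g)) ` C)\<rparr>"

text \<open>\<open>(H \<times> G)/D\<close> as a \<open>(G,H)\<close>-biset, following the convention \<open>(h, g).x = h x g\<^sup>-\<^sup>1\<close>.\<close>

definition coset_biset ::
    "('g, 'm) monoid_scheme \<Rightarrow> ('h, 'n) monoid_scheme \<Rightarrow> ('h \<times> 'g) set \<Rightarrow>
      ('g, 'h, ('h \<times> 'g) set) biset"
  where "coset_biset G H D =
    \<lparr>points = lcosets\<^bsub>H \<times>\<times> G\<^esub> D,
     lact = (\<lambda>h C. (h, \<one>\<^bsub>G\<^esub>) <#\<^bsub>H \<times>\<times> G\<^esub> C),
     ract = (\<lambda>C g. (\<one>\<^bsub>H\<^esub>, inv\<^bsub>G\<^esub> g) <#\<^bsub>H \<times>\<times> G\<^esub> C)\<rparr>"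

definition twisted_diagonal :: "'g set \<Rightarrow> ('g \<Rightarrow> 'h) \<Rightarrow> ('h \<times> 'g) set"
  where "twisted_diagonal U \<phi> = {(\<phi> u, u) | u. u \<in> U}"


section \<open>Grothendieck groups and tensor products\<close>

text \<open>Abelian groups are written multiplicatively, as in \<open>HOL-Algebra\<close>. Functions on quotients
  are defined as the union of the values at all representatives, which is that value when it does
  not depend on the representative.\<close>

definition groth_rel :: "('c, 'm) monoid_scheme \<Rightarrow> (('c \<times> 'c) \<times> ('c \<times> 'c)) set"
  where "groth_rel M =
    {((a, b), (c, d)) | a b c d. a \<in> carrier M \<and> b \<in> carrier M \<and> c \<in> carrier M \<and> d \<in> carrier M \<and>
      (\<exists>e\<in>carrier M. a \<otimes>\<^bsub>M\<^esub> d \<otimes>\<^bsub>M\<^esub> e = c \<otimes>\<^bsub>M\<^esub> b \<otimes>\<^bsub>M\<^esub> e)}"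

definition groth_group :: "('c, 'm) monoid_scheme \<Rightarrow> ('c \<times> 'c) set monoid"
  where "groth_group M =
    \<lparr>carrier = (carrier M \<times> carrier M) // groth_rel M,
     monoid.mult = (\<lambda>A B. \<Union>(a, b)\<in>A. \<Union>(c, d)\<in>B. groth_rel M `` {(a \<otimes>\<^bsub>M\<^esub> c, b \<otimes>\<^bsub>M\<^esub> d)}),
     one = groth_rel M `` {(\<one>\<^bsub>M\<^esub>, \<one>\<^bsub>M\<^esub>)}\<rparr>"

text \<open>The tensor product over \<open>\<int>\<close>: the free abelian group on pairs modulo bilinearity.\<close>

definition tensor_relations ::
    "('a, 'm) monoid_scheme \<Rightarrow> ('b, 'n) monoid_scheme \<Rightarrow> (('a \<times> 'b) \<Rightarrow>\<^sub>0 int) set"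
  where "tensor_relations A B =
    {frag_of (a \<otimes>\<^bsub>A\<^esub> a', b) - frag_of (a, b) - frag_of (a', b) | a a' b.
      a \<in> carrier A \<and> a' \<in> carrier A \<and> b \<in> carrier B} \<union>
    {frag_of (a, b \<otimes>\<^bsub>B\<^esub> b') - frag_of (a, b) - frag_of (a, b') | a b b'.
      a \<in> carrier A \<and> b \<in> carrier B \<and> b' \<in> carrier B}"

definition tensor_kernel ::
    "('a, 'm) monoid_scheme \<Rightarrow> ('b, 'n) monoid_scheme \<Rightarrow> (('a \<times> 'b) \<Rightarrow>\<^sub>0 int) set"
  where "tensor_kernel A B =
    generate (free_Abelian_group (carrier A \<times> carrier B)) (tensor_relations A B)"

definition tensor_group ::
    "('a, 'm) monoid_scheme \<Rightarrow> ('b, 'n) monoid_scheme \<Rightarrow> (('a \<times> 'b) \<Rightarrow>\<^sub>0 int) set monoid"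
  where "tensor_group A B =
    free_Abelian_group (carrier A \<times> carrier B) Mod tensor_kernel A B"

definition tensor_class ::
    "('a, 'm) monoid_scheme \<Rightarrow> ('b, 'n) monoid_scheme \<Rightarrow>
      (('a \<times> 'b) \<Rightarrow>\<^sub>0 int) \<Rightarrow> (('a \<times> 'b) \<Rightarrow>\<^sub>0 int) set"
  where "tensor_class A B f =
    tensor_kernel A B #>\<^bsub>free_Abelian_group (carrier A \<times> carrier B)\<^esub> f"

definition Z_loc :: "nat \<Rightarrow> rat set"
  where "Z_loc p = {of_int a / of_int b | a b. \<not> int p dvd b}"

definition Z_loc_group :: "nat \<Rightarrow> rat monoid"
  where "Z_loc_group p = \<lparr>carrier = Z_loc p, monoid.mult = (+), one = 0\<rparr>"


section \<open>Double Burnside modules\<close>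

definition biset_monoid ::
    "('g, 'm) monoid_scheme \<Rightarrow> ('h, 'n) monoid_scheme \<Rightarrow> ('g, 'h) biset_class monoid"
  where "biset_monoid G H =
    \<lparr>carrier = {iso_class G H X | X :: ('g, 'h, nat) biset. is_biset G H X},
     monoid.mult = (\<lambda>c d. \<Union>X\<in>c. \<Union>Y\<in>d. iso_class G H (disjoint_union X Y)),
     one = iso_class G H empty_biset\<rparr>"

type_synonym ('g, 'h) burnside = "(('g, 'h) biset_class \<times> ('g, 'h) biset_class) set"

definition burnside_group ::
    "('g, 'm) monoid_scheme \<Rightarrow> ('h, 'n) monoid_scheme \<Rightarrow> ('g, 'h) burnside monoid"
  where "burnside_group G H = groth_group (biset_monoid G H)"

definition burnside_class ::
    "('g, 'm) monoid_scheme \<Rightarrow> ('h, 'n) monoid_scheme \<Rightarrow> ('g, 'h, 'x) biset \<Rightarrow> ('g, 'h) burnside"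
  where "burnside_class G H X =
    groth_rel (biset_monoid G H) `` {(iso_class G H X, \<one>\<^bsub>biset_monoid G H\<^esub>)}"

definition comp_class ::
    "('g, 'm) monoid_scheme \<Rightarrow> ('h, 'n) monoid_scheme \<Rightarrow> ('k, 'l) monoid_scheme \<Rightarrow>
      ('h, 'k) biset_class \<Rightarrow> ('g, 'h) biset_class \<Rightarrow> ('g, 'k) biset_class"
  where "comp_class G H K c d = (\<Union>Y\<in>c. \<Union>X\<in>d. iso_class G K (biset_product H Y X))"

text \<open>The biadditive extension \<open>(c - c') \<circ> (d - d') = (c \<circ> d + c' \<circ> d') - (c \<circ> d' + c' \<circ> d)\<close>.\<close>

definition comp_burnside ::
    "('g, 'm) monoid_scheme \<Rightarrow> ('h, 'n) monoid_scheme \<Rightarrow> ('k, 'l) monoid_scheme \<Rightarrow>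
      ('h, 'k) burnside \<Rightarrow> ('g, 'h) burnside \<Rightarrow> ('g, 'k) burnside"
  where "comp_burnside G H K Y X =
    (\<Union>(c, c')\<in>Y. \<Union>(d, d')\<in>X. groth_rel (biset_monoid G K) ``
      {(comp_class G H K c d \<otimes>\<^bsub>biset_monoid G K\<^esub> comp_class G H K c' d',
        comp_class G H K c d' \<otimes>\<^bsub>biset_monoid G K\<^esub> comp_class G H K c' d)})"

type_synonym ('g, 'h) burnside_loc = "((('g, 'h) burnside \<times> rat) \<Rightarrow>\<^sub>0 int) set"

definition burnside_loc ::
    "nat \<Rightarrow> ('g, 'm) monoid_scheme \<Rightarrow> ('h, 'n) monoid_scheme \<Rightarrow> ('g, 'h) burnside_loc monoid"
  where "burnside_loc p G H = tensor_group (burnside_group G H) (Z_loc_group p)"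

abbreviation burnside_loc_class ::
    "nat \<Rightarrow> ('g, 'm) monoid_scheme \<Rightarrow> ('h, 'n) monoid_scheme \<Rightarrow>
      ((('g, 'h) burnside \<times> rat) \<Rightarrow>\<^sub>0 int) \<Rightarrow> ('g, 'h) burnside_loc"
  where "burnside_loc_class p G H \<equiv> tensor_class (burnside_group G H) (Z_loc_group p)"

text \<open>Composition \<open>A(H,K)\<^sub>(\<^sub>p\<^sub>) \<times> A(G,H)\<^sub>(\<^sub>p\<^sub>) \<rightarrow> A(G,K)\<^sub>(\<^sub>p\<^sub>)\<close>, the \<open>\<int>\<^sub>(\<^sub>p\<^sub>)\<close>-bilinear extension:
  \<open>(a \<otimes> r) \<circ> (b \<otimes> s) = (a \<circ> b) \<otimes> r s\<close>.\<close>

definition biset_comp ::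
    "nat \<Rightarrow> ('g, 'm) monoid_scheme \<Rightarrow> ('h, 'n) monoid_scheme \<Rightarrow> ('k, 'l) monoid_scheme \<Rightarrow>
      ('h, 'k) burnside_loc \<Rightarrow> ('g, 'h) burnside_loc \<Rightarrow> ('g, 'k) burnside_loc"
  where "biset_comp p G H K Y X = (\<Union>f\<in>Y. \<Union>g\<in>X. burnside_loc_class p G K
    (frag_extend (\<lambda>(a, r). frag_extend (\<lambda>(b, s). frag_of (comp_burnside G H K a b, r * s)) g) f))"

text \<open>The element \<open>r [U, \<phi>]\<close> of \<open>A(G,H)\<^sub>(\<^sub>p\<^sub>)\<close>, for \<open>r\<close> in \<open>\<int>\<^sub>(\<^sub>p\<^sub>)\<close>.\<close>

definition scaled_basic ::
    "nat \<Rightarrow> ('g, 'm) monoid_scheme \<Rightarrow> ('h, 'n) monoid_scheme \<Rightarrow> rat \<Rightarrow> 'g set \<Rightarrow> ('g \<Rightarrow> 'h) \<Rightarrow>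
      ('g, 'h) burnside_loc"
  where "scaled_basic p G H r U \<phi> =
    burnside_loc_class p G H
      (frag_of (burnside_class G H (coset_biset G H (twisted_diagonal U \<phi>)), r))"

abbreviation basic ::
    "nat \<Rightarrow> ('g, 'm) monoid_scheme \<Rightarrow> ('h, 'n) monoid_scheme \<Rightarrow> 'g set \<Rightarrow> ('g \<Rightarrow> 'h) \<Rightarrow>
      ('g, 'h) burnside_loc"
  where "basic p G H U \<phi> \<equiv> scaled_basic p G H 1 U \<phi>"


section \<open>Stable elements and characteristic idempotents\<close>

definition right_stable ::
    "nat \<Rightarrow> ('a, 'm) monoid_scheme \<Rightarrow> ('a set \<Rightarrow> 'a set \<Rightarrow> ('a \<Rightarrow> 'a) set) \<Rightarrow>
      ('b, 'n) monoid_scheme \<Rightarrow> ('a, 'b) burnside_loc \<Rightarrow> bool"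
  where "right_stable p S\<^sub>1 F\<^sub>1 S\<^sub>2 X \<longleftrightarrow>
    (\<forall>P. subgroup P S\<^sub>1 \<longrightarrow> (\<forall>\<phi>\<in>F\<^sub>1 P (carrier S\<^sub>1).
      biset_comp p (S\<^sub>1\<lparr>carrier := P\<rparr>) S\<^sub>1 S\<^sub>2 X (basic p (S\<^sub>1\<lparr>carrier := P\<rparr>) S\<^sub>1 P \<phi>) =
      biset_comp p (S\<^sub>1\<lparr>carrier := P\<rparr>) S\<^sub>1 S\<^sub>2 X (basic p (S\<^sub>1\<lparr>carrier := P\<rparr>) S\<^sub>1 P id)))"

definition left_stable ::
    "nat \<Rightarrow> ('a, 'm) monoid_scheme \<Rightarrow> ('b, 'n) monoid_scheme \<Rightarrow>
      ('b set \<Rightarrow> 'b set \<Rightarrow> ('b \<Rightarrow> 'b) set) \<Rightarrow> ('a, 'b) burnside_loc \<Rightarrow> bool"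
  where "left_stable p S\<^sub>1 S\<^sub>2 F\<^sub>2 X \<longleftrightarrow>
    (\<forall>P. subgroup P S\<^sub>2 \<longrightarrow> (\<forall>\<phi>\<in>F\<^sub>2 P (carrier S\<^sub>2).
      biset_comp p S\<^sub>1 S\<^sub>2 (S\<^sub>2\<lparr>carrier := P\<rparr>)
        (basic p S\<^sub>2 (S\<^sub>2\<lparr>carrier := P\<rparr>) (\<phi> ` P) (inv_into P \<phi>)) X =
      biset_comp p S\<^sub>1 S\<^sub>2 (S\<^sub>2\<lparr>carrier := P\<rparr>) (basic p S\<^sub>2 (S\<^sub>2\<lparr>carrier := P\<rparr>) P id) X))"

definition stable_module ::
    "nat \<Rightarrow> ('a, 'm) monoid_scheme \<Rightarrow> ('a set \<Rightarrow> 'a set \<Rightarrow> ('a \<Rightarrow> 'a) set) \<Rightarrow>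
      ('b, 'n) monoid_scheme \<Rightarrow> ('b set \<Rightarrow> 'b set \<Rightarrow> ('b \<Rightarrow> 'b) set) \<Rightarrow>
      ('a, 'b) burnside_loc monoid"
  where "stable_module p S\<^sub>1 F\<^sub>1 S\<^sub>2 F\<^sub>2 = (burnside_loc p S\<^sub>1 S\<^sub>2)
    \<lparr>carrier := {X \<in> carrier (burnside_loc p S\<^sub>1 S\<^sub>2).
      right_stable p S\<^sub>1 F\<^sub>1 S\<^sub>2 X \<and> left_stable p S\<^sub>1 S\<^sub>2 F\<^sub>2 X}\<rparr>"

text \<open>The \<open>\<int>\<^sub>(\<^sub>p\<^sub>)\<close>-linear extension of \<open>X \<mapsto> |X|/|S|\<close>. It is defined on all of
  \<open>A(S,S)\<^sub>(\<^sub>p\<^sub>)\<close> with rational values; on the span of the left-free bisets, where it is used, its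
  values lie in \<open>\<int>\<^sub>(\<^sub>p\<^sub>)\<close>. The values do not depend on the chosen representatives.\<close>

definition class_card :: "('g, 'h) biset_class \<Rightarrow> nat"
  where "class_card c = card (points (SOME X. X \<in> c))"

definition burnside_aug :: "('a, 'm) monoid_scheme \<Rightarrow> ('a, 'a) burnside \<Rightarrow> rat"
  where "burnside_aug S a =
    (let (c, d) = (SOME z. z \<in> a)
      in (of_nat (class_card c) - of_nat (class_card d)) / of_nat (order S))"

definition augmentation :: "('a, 'm) monoid_scheme \<Rightarrow> ('a, 'a) burnside_loc \<Rightarrow> rat"
  where "augmentation S X =
    (let f = (SOME f. f \<in> X) in
      \<Sum>(a, r)\<in>Poly_Mapping.keys f. of_int (Poly_Mapping.lookup f (a, r)) * (r * burnside_aug S a))"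

text \<open>The subgroup generated by the \<open>r [P, \<phi>]\<close> with \<open>r\<close> in \<open>\<int>\<^sub>(\<^sub>p\<^sub>)\<close> consists of the
  \<open>\<int>\<^sub>(\<^sub>p\<^sub>)\<close>-linear combinations of the \<open>[P, \<phi>]\<close>.\<close>

definition F_generated ::
    "nat \<Rightarrow> ('a, 'm) monoid_scheme \<Rightarrow> ('a set \<Rightarrow> 'a set \<Rightarrow> ('a \<Rightarrow> 'a) set) \<Rightarrow>
      ('a, 'a) burnside_loc \<Rightarrow> bool"
  where "F_generated p S F X \<longleftrightarrow> X \<in> generate (burnside_loc p S S)
    {scaled_basic p S S r P \<phi> | r P \<phi>. r \<in> Z_loc p \<and> subgroup P S \<and> \<phi> \<in> F P (carrier S)}"

definition F_characteristic ::
    "nat \<Rightarrow> ('a, 'm) monoid_scheme \<Rightarrow> ('a set \<Rightarrow> 'a set \<Rightarrow> ('a \<Rightarrow> 'a) set) \<Rightarrow>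
      ('a, 'a) burnside_loc \<Rightarrow> bool"
  where "F_characteristic p S F X \<longleftrightarrow>
    F_generated p S F X \<and> left_stable p S S F X \<and> right_stable p S F S X \<and>
    augmentation S X \<in> Z_loc p \<and> (\<exists>s\<in>Z_loc p. augmentation S X * s = 1)"

text \<open>There is exactly one such element when \<open>F\<close> is saturated.\<close>

definition characteristic_idempotent ::
    "nat \<Rightarrow> ('a, 'm) monoid_scheme \<Rightarrow> ('a set \<Rightarrow> 'a set \<Rightarrow> ('a \<Rightarrow> 'a) set) \<Rightarrow>
      ('a, 'a) burnside_loc \<Rightarrow> bool"
  where "characteristic_idempotent p S F \<omega> \<longleftrightarrow>
    \<omega> \<in> carrier (burnside_loc p S S) \<and> biset_comp p S S S \<omega> \<omega> = \<omega> \<and> F_characteristic p S F \<omega>"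

text \<open>The double Burnside ring \<open>A(F,F)\<^sub>(\<^sub>p\<^sub>)\<close>, with \<open>\<omega>\<close> the characteristic idempotent of \<open>F\<close>.\<close>

definition double_burnside_ring ::
    "nat \<Rightarrow> ('a, 'm) monoid_scheme \<Rightarrow> ('a set \<Rightarrow> 'a set \<Rightarrow> ('a \<Rightarrow> 'a) set) \<Rightarrow>
      ('a, 'a) burnside_loc \<Rightarrow> ('a, 'a) burnside_loc ring"
  where "double_burnside_ring p S F \<omega> =
    \<lparr>carrier = carrier (stable_module p S F S F),
     monoid.mult = biset_comp p S S S,
     one = \<omega>,
     zero = \<one>\<^bsub>stable_module p S F S F\<^esub>,
     add = (\<lambda>X Y. X \<otimes>\<^bsub>stable_module p S F S F\<^esub> Y)\<rparr>"


section \<open>Modules over non-commutative rings\<close>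

text \<open>The underlying abelian group \<open>M\<close> is written multiplicatively. The identity of the ring is
  not required to act as the identity: \<open>\<omega> \<circ> X = X\<close> fails for general \<open>X\<close> in \<open>A(S\<^sub>1,S\<^sub>2)\<^sub>(\<^sub>p\<^sub>)\<close>.\<close>

definition left_module ::
    "('r, 'k) ring_scheme \<Rightarrow> ('x, 'l) monoid_scheme \<Rightarrow> ('r \<Rightarrow> 'x \<Rightarrow> 'x) \<Rightarrow> bool"
  where "left_module R M act \<longleftrightarrow> ring R \<and> comm_group M \<and>
    (\<forall>r\<in>carrier R. \<forall>x\<in>carrier M. act r x \<in> carrier M) \<and>
    (\<forall>r\<in>carrier R. \<forall>x\<in>carrier M. \<forall>y\<in>carrier M. act r (x \<otimes>\<^bsub>M\<^esub> y) = act r x \<otimes>\<^bsub>M\<^esub> act r y) \<and>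
    (\<forall>r\<in>carrier R. \<forall>s\<in>carrier R. \<forall>x\<in>carrier M.
      act (r \<oplus>\<^bsub>R\<^esub> s) x = act r x \<otimes>\<^bsub>M\<^esub> act s x \<and>
      act (r \<otimes>\<^bsub>R\<^esub> s) x = act r (act s x))"

definition right_module ::
    "('r, 'k) ring_scheme \<Rightarrow> ('x, 'l) monoid_scheme \<Rightarrow> ('x \<Rightarrow> 'r \<Rightarrow> 'x) \<Rightarrow> bool"
  where "right_module R M act \<longleftrightarrow> ring R \<and> comm_group M \<and>
    (\<forall>r\<in>carrier R. \<forall>x\<in>carrier M. act x r \<in> carrier M) \<and>
    (\<forall>r\<in>carrier R. \<forall>x\<in>carrier M. \<forall>y\<in>carrier M. act (x \<otimes>\<^bsub>M\<^esub> y) r = act x r \<otimes>\<^bsub>M\<^esub> act y r) \<and>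
    (\<forall>r\<in>carrier R. \<forall>s\<in>carrier R. \<forall>x\<in>carrier M.
      act x (r \<oplus>\<^bsub>R\<^esub> s) = act x r \<otimes>\<^bsub>M\<^esub> act x s \<and>
      act x (r \<otimes>\<^bsub>R\<^esub> s) = act (act x r) s)"

definition left_module_hom ::
    "('r, 'k) ring_scheme \<Rightarrow> ('x, 'l) monoid_scheme \<Rightarrow> ('r \<Rightarrow> 'x \<Rightarrow> 'x) \<Rightarrow>
      ('y, 'm) monoid_scheme \<Rightarrow> ('r \<Rightarrow> 'y \<Rightarrow> 'y) \<Rightarrow> ('x \<Rightarrow> 'y) \<Rightarrow> bool"
  where "left_module_hom R M actM N actN f \<longleftrightarrow>
    left_module R M actM \<and> left_module R N actN \<and> f \<in> hom M N \<and>
    (\<forall>r\<in>carrier R. \<forall>x\<in>carrier M. f (actM r x) = actN r (f x))"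

definition right_module_hom ::
    "('r, 'k) ring_scheme \<Rightarrow> ('x, 'l) monoid_scheme \<Rightarrow> ('x \<Rightarrow> 'r \<Rightarrow> 'x) \<Rightarrow>
      ('y, 'm) monoid_scheme \<Rightarrow> ('y \<Rightarrow> 'r \<Rightarrow> 'y) \<Rightarrow> ('x \<Rightarrow> 'y) \<Rightarrow> bool"
  where "right_module_hom R M actM N actN f \<longleftrightarrow>
    right_module R M actM \<and> right_module R N actN \<and> f \<in> hom M N \<and>
    (\<forall>r\<in>carrier R. \<forall>x\<in>carrier M. f (actM x r) = actN (f x) r)"

end

theory Submission
  imports Defs
begin

text \<open>
Composition of localized bisets is biadditive and associative. The theorem therefore comes down
to one fact: the characteristic idempotent \<open>\<omega>\<close> of \<open>F\<close> satisfies \<open>\<omega> \<circ> X = X\<close> for every left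
\<open>F\<close>-stable \<open>X\<close> and \<open>X \<circ> \<omega> = X\<close> for every right \<open>F\<close>-stable \<open>X\<close>. Left stability of a composite
\<open>Y \<circ> X\<close> only involves \<open>Y\<close>, and right stability only \<open>X\<close>, so the stable elements are closed under the
actions; by the fact, \<open>\<omega>\<close> is the identity of the double Burnside ring, and for stable \<open>r\<close>
both \<open>\<omega>\<^sub>2 \<circ> r\<close> and \<open>r \<circ> \<omega>\<^sub>2\<close> equal \<open>r\<close>, whence \<open>\<pi> (r \<circ> X) = r \<circ> \<pi> X\<close>. The right-hand side is dual.

The fact itself (\<open>characteristic_idempotent_left_unit\<close>) is proved as follows. Write \<open>\<omega>\<close> as a sum of
elements \<open>r [P, \<phi>]\<close> with \<open>\<phi>\<close> in \<open>F\<close>. Each \<open>[P, \<phi>]\<close> restricts the left action along the inclusion of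
\<open>P\<close> and then induces along \<open>\<phi>\<close>; on a left stable \<open>X\<close> the restriction may be taken along
\<open>\<phi>\<close> instead, so \<open>[P, \<phi>]\<close> acts as \<open>[\<phi> P, id]\<close>. Hence there is a combination \<open>e\<close> of elements
\<open>[Q, id]\<close> with the augmentation of \<open>\<omega>\<close> and \<open>\<omega> \<circ> X = e \<circ> X\<close> for all left stable \<open>X\<close>. As \<open>\<omega> \<circ> X\<close> is left
stable again, \<open>e \<circ> (e \<circ> X) = \<omega> \<circ> (\<omega> \<circ> X) = \<omega> \<circ> X = e \<circ> X\<close>, and \<open>\<omega> \<circ> X = e \<circ> X = X\<close> follows because
\<open>e\<close> is invertible.

Invertibility of \<open>e\<close> (\<open>subgroup_span_invertible\<close>) is the statement that the Burnside ring of a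
\<open>p\<close>-group, localized at \<open>p\<close>, is a local ring. The biset \<open>[Q, id]\<close> is \<open>S/Q \<times> S\<close>, and composition
corresponds to the product of left \<open>S\<close>-sets. In \<open>S/P \<times> S/Q\<close> every point stabilizer is conjugate
to a subgroup of \<open>P\<close>, and the number of orbits isomorphic to \<open>S/P\<close> is congruent to \<open>|S/Q|\<close>
modulo \<open>p\<close>, since every other orbit has size divisible by \<open>p |S/P|\<close> (\<open>orbit_decomposition\<close>).
So \<open>[P, id] \<circ> e\<close> is \<open>u [P, id]\<close> plus terms for proper subgroups of \<open>P\<close>, where \<open>u\<close> is congruent to the
augmentation of \<open>e\<close> and thus a unit. By induction on the order of \<open>P\<close> each \<open>[P, id]\<close> is a multiple
of \<open>e\<close>; for \<open>P = S\<close> this gives an inverse.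
\<close>

section \<open>Biadditive maps on Grothendieck groups\<close>

text \<open>Only the behaviour on the carriers is constrained, so that the notion applies to the commutative
monoids of isomorphism classes as well as to the groups built from them.\<close>

definition biadditive ::
    "('a, 'k) monoid_scheme \<Rightarrow> ('b, 'l) monoid_scheme \<Rightarrow> ('c, 'm) monoid_scheme \<Rightarrow>
      ('a \<Rightarrow> 'b \<Rightarrow> 'c) \<Rightarrow> bool"
  where "biadditive L M N c \<longleftrightarrow>
    (\<forall>a\<in>carrier L. \<forall>b\<in>carrier M. c a b \<in> carrier N) \<and>
    (\<forall>a\<in>carrier L. \<forall>a'\<in>carrier L. \<forall>b\<in>carrier M. c (a \<otimes>\<^bsub>L\<^esub> a') b = c a b \<otimes>\<^bsub>N\<^esub> c a' b) \<and>
    (\<forall>a\<in>carrier L. \<forall>b\<in>carrier M. \<forall>b'\<in>carrier M. c a (b \<otimes>\<^bsub>M\<^esub> b') = c a b \<otimes>\<^bsub>N\<^esub> c a b')"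

lemma biadditive_closed: "biadditive L M N c \<Longrightarrow> a \<in> carrier L \<Longrightarrow> b \<in> carrier M \<Longrightarrow> c a b \<in> carrier N"
  and biadditive_left: "biadditive L M N c \<Longrightarrow> a \<in> carrier L \<Longrightarrow> a' \<in> carrier L \<Longrightarrow> b \<in> carrier M \<Longrightarrow>
    c (a \<otimes>\<^bsub>L\<^esub> a') b = c a b \<otimes>\<^bsub>N\<^esub> c a' b"
  and biadditive_right: "biadditive L M N c \<Longrightarrow> a \<in> carrier L \<Longrightarrow> b \<in> carrier M \<Longrightarrow> b' \<in> carrier M \<Longrightarrow>
    c a (b \<otimes>\<^bsub>M\<^esub> b') = c a b \<otimes>\<^bsub>N\<^esub> c a b'"
  by (auto simp: biadditive_def)

text \<open>Functions on quotients are given as unions over all representatives. This evaluates such a union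
once the summands are known not to depend on the representative.\<close>

lemma UN_constant_value: "x \<in> A \<Longrightarrow> (\<And>y. y \<in> A \<Longrightarrow> f y = c) \<Longrightarrow> (\<Union>y\<in>A. f y) = c"
  by blast

lemma UN_pairs_constant_value:
  assumes "(a, b) \<in> A" "(c, d) \<in> B"
    and "\<And>a b c d. (a, b) \<in> A \<Longrightarrow> (c, d) \<in> B \<Longrightarrow> f a b c d = v"
  shows "(\<Union>(a, b)\<in>A. \<Union>(c, d)\<in>B. f a b c d) = v"
proof (rule UN_constant_value[OF assms(1)])
  fix x assume "x \<in> A"
  then show "(case x of (a, b) \<Rightarrow> \<Union>(c, d)\<in>B. f a b c d) = v"
    using assms(3) by (cases x) (simp, rule UN_constant_value[OF assms(2)], auto)
qed

text \<open>Transitivity is where the stabilizing summand \<open>e\<close> of the relation is needed: the middle pair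
cannot be cancelled in the monoid and is absorbed into \<open>e\<close>.\<close>

lemma (in comm_monoid) equiv_groth_rel: "equiv (carrier G \<times> carrier G) (groth_rel G)"
proof (rule equivI)
  show "groth_rel G \<subseteq> (carrier G \<times> carrier G) \<times> carrier G \<times> carrier G"
    by (auto simp: groth_rel_def)
  show "refl_on (carrier G \<times> carrier G) (groth_rel G)"
    by (auto simp: refl_on_def groth_rel_def)
  show "sym (groth_rel G)"
    by (auto simp: sym_def groth_rel_def) metis
  show "trans (groth_rel G)"
  proof (rule transI, clarsimp simp: groth_rel_def)
    fix a b c d e f g h
    assume car: "a \<in> carrier G" "b \<in> carrier G" "c \<in> carrier G" "d \<in> carrier G"
      "f \<in> carrier G" "g \<in> carrier G" "e \<in> carrier G" "h \<in> carrier G"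
      and 1: "a \<otimes> d \<otimes> e = c \<otimes> b \<otimes> e" and 2: "c \<otimes> g \<otimes> h = f \<otimes> d \<otimes> h"
    have "a \<otimes> g \<otimes> (d \<otimes> e \<otimes> h) = (a \<otimes> d \<otimes> e) \<otimes> (g \<otimes> h)"
      using car by (simp add: m_ac)
    also have "\<dots> = (c \<otimes> g \<otimes> h) \<otimes> (b \<otimes> e)"
      unfolding 1 using car by (simp add: m_ac)
    also have "\<dots> = f \<otimes> b \<otimes> (d \<otimes> e \<otimes> h)"
      unfolding 2 using car by (simp add: m_ac)
    finally show "\<exists>e\<in>carrier G. a \<otimes> g \<otimes> e = f \<otimes> b \<otimes> e"
      using car by (intro bexI[of _ "d \<otimes> e \<otimes> h"]) auto
  qed
qed

abbreviation groth_class :: "('c, 'm) monoid_scheme \<Rightarrow> 'c \<times> 'c \<Rightarrow> ('c \<times> 'c) set"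
  where "groth_class M z \<equiv> groth_rel M `` {z}"

lemma carrier_groth_group:
  "carrier (groth_group M) = groth_class M ` (carrier M \<times> carrier M)"
  by (auto simp: groth_group_def quotient_def)

lemma one_groth_group: "\<one>\<^bsub>groth_group M\<^esub> = groth_class M (\<one>\<^bsub>M\<^esub>, \<one>\<^bsub>M\<^esub>)"
  by (simp add: groth_group_def)

lemma groth_groupE:
  assumes "A \<in> carrier (groth_group M)"
  obtains a b where "a \<in> carrier M" "b \<in> carrier M" "A = groth_class M (a, b)"
  using assms by (auto simp: carrier_groth_group)

context comm_monoid
begin

lemma groth_class_self: "a \<in> carrier G \<Longrightarrow> b \<in> carrier G \<Longrightarrow> (a, b) \<in> groth_class G (a, b)"
  by (auto simp: groth_rel_def)

lemma groth_class_eqI: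
  assumes "a \<in> carrier G" "b \<in> carrier G" "c \<in> carrier G" "d \<in> carrier G" "e \<in> carrier G"
    "a \<otimes> d \<otimes> e = c \<otimes> b \<otimes> e"
  shows "groth_class G (a, b) = groth_class G (c, d)"
  by (rule equiv_class_eq[OF equiv_groth_rel]) (use assms in \<open>auto simp: groth_rel_def\<close>)

lemma groth_mult:
  assumes "a \<in> carrier G" "b \<in> carrier G" "c \<in> carrier G" "d \<in> carrier G"
  shows "groth_class G (a, b) \<otimes>\<^bsub>groth_group G\<^esub> groth_class G (c, d)
    = groth_class G (a \<otimes> c, b \<otimes> d)"
proof -
  have *: "groth_class G (a' \<otimes> c', b' \<otimes> d') = groth_class G (a \<otimes> c, b \<otimes> d)"
    if "(a', b') \<in> groth_class G (a, b)" "(c', d') \<in> groth_class G (c, d)" for a' b' c' d'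
  proof -
    from that obtain e f where car: "a' \<in> carrier G" "b' \<in> carrier G" "c' \<in> carrier G"
      "d' \<in> carrier G" "e \<in> carrier G" "f \<in> carrier G"
      and e: "a \<otimes> b' \<otimes> e = a' \<otimes> b \<otimes> e" and f: "c \<otimes> d' \<otimes> f = c' \<otimes> d \<otimes> f"
      by (auto simp: groth_rel_def)
    have "(a' \<otimes> c') \<otimes> (b \<otimes> d) \<otimes> (e \<otimes> f) = (a' \<otimes> b \<otimes> e) \<otimes> (c' \<otimes> d \<otimes> f)"
      using car assms by (simp add: m_ac)
    also have "\<dots> = (a \<otimes> c) \<otimes> (b' \<otimes> d') \<otimes> (e \<otimes> f)"
      unfolding e[symmetric] f[symmetric] using car assms by (simp add: m_ac)
    finally show ?thesis
      using car assms by (intro groth_class_eqI[of _ _ _ _ "e \<otimes> f"]) auto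
  qed
  have "(\<Union>(a', b')\<in>groth_class G (a, b). \<Union>(c', d')\<in>groth_class G (c, d).
      groth_class G (a' \<otimes> c', b' \<otimes> d')) = groth_class G (a \<otimes> c, b \<otimes> d)"
    by (rule UN_pairs_constant_value[OF groth_class_self groth_class_self * ]) (use assms in auto)
  then show ?thesis
    by (simp add: groth_group_def)
qed

lemma groth_comm_group: "comm_group (groth_group G)"
proof (rule comm_groupI)
  fix x assume "x \<in> carrier (groth_group G)"
  then obtain a b where x: "a \<in> carrier G" "b \<in> carrier G" "x = groth_class G (a, b)"
    by (rule groth_groupE)
  show "\<one>\<^bsub>groth_group G\<^esub> \<otimes>\<^bsub>groth_group G\<^esub> x = x"
    using x by (simp add: one_groth_group groth_mult)
  have "groth_class G (b \<otimes> a, a \<otimes> b) = groth_class G (\<one>, \<one>)"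
    using x by (intro groth_class_eqI[of _ _ _ _ \<one>]) (auto simp: m_ac)
  then show "\<exists>y\<in>carrier (groth_group G). y \<otimes>\<^bsub>groth_group G\<^esub> x = \<one>\<^bsub>groth_group G\<^esub>"
    using x by (intro bexI[of _ "groth_class G (b, a)"])
      (auto simp: one_groth_group groth_mult carrier_groth_group)
next
  fix x y assume "x \<in> carrier (groth_group G)" "y \<in> carrier (groth_group G)"
  then show "x \<otimes>\<^bsub>groth_group G\<^esub> y \<in> carrier (groth_group G)"
    "x \<otimes>\<^bsub>groth_group G\<^esub> y = y \<otimes>\<^bsub>groth_group G\<^esub> x"
    by (auto elim!: groth_groupE simp: groth_mult) (auto simp: carrier_groth_group m_comm)
next
  fix x y z assume "x \<in> carrier (groth_group G)" "y \<in> carrier (groth_group G)"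
    "z \<in> carrier (groth_group G)"
  then show "x \<otimes>\<^bsub>groth_group G\<^esub> y \<otimes>\<^bsub>groth_group G\<^esub> z = x \<otimes>\<^bsub>groth_group G\<^esub> (y \<otimes>\<^bsub>groth_group G\<^esub> z)"
    by (auto elim!: groth_groupE simp: groth_mult m_assoc)
qed (auto simp: carrier_groth_group one_groth_group)

end

text \<open>Biadditive extension of \<open>c\<close>: the value at \<open>(a - a', b - b')\<close> is
\<open>(c a b + c a' b') - (c a b' + c a' b)\<close>.\<close>

definition groth_extend ::
    "('c, 'm) monoid_scheme \<Rightarrow> ('a \<Rightarrow> 'b \<Rightarrow> 'c) \<Rightarrow> ('a \<times> 'a) set \<Rightarrow> ('b \<times> 'b) set \<Rightarrow> ('c \<times> 'c) set"
  where "groth_extend N c Y X = (\<Union>(a, a')\<in>Y. \<Union>(b, b')\<in>X.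
    groth_class N (c a b \<otimes>\<^bsub>N\<^esub> c a' b', c a b' \<otimes>\<^bsub>N\<^esub> c a' b))"

text \<open>The value does not depend on the representatives. Replacing \<open>(a, a')\<close> by an equivalent pair and
then \<open>(b, b')\<close> by an equivalent pair are treated separately; in each case the stabilizing
summand is the image of the one of the given equivalence.\<close>

lemma groth_extend_classes:
  assumes "comm_monoid L" "comm_monoid M" "comm_monoid N" and bi: "biadditive L M N c"
    and car: "a \<in> carrier L" "a' \<in> carrier L" "b \<in> carrier M" "b' \<in> carrier M"
  shows "groth_extend N c (groth_class L (a, a')) (groth_class M (b, b'))
    = groth_class N (c a b \<otimes>\<^bsub>N\<^esub> c a' b', c a b' \<otimes>\<^bsub>N\<^esub> c a' b)"
proof -
  interpret L: comm_monoid L by fact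
  interpret M: comm_monoid M by fact
  interpret N: comm_monoid N by fact
  note cl = biadditive_closed[OF bi]
  let ?v = "\<lambda>a a' b b'. groth_class N (c a b \<otimes>\<^bsub>N\<^esub> c a' b', c a b' \<otimes>\<^bsub>N\<^esub> c a' b)"
  have 1: "?v a a' b b' = ?v x x' b b'"
    if x: "((x, x'), (a, a')) \<in> groth_rel L" and b: "b \<in> carrier M" "b' \<in> carrier M"
    for a a' x x' b b'
  proof -
    from x obtain e where e: "x \<in> carrier L" "x' \<in> carrier L" "e \<in> carrier L"
      "a \<in> carrier L" "a' \<in> carrier L" "x \<otimes>\<^bsub>L\<^esub> a' \<otimes>\<^bsub>L\<^esub> e = a \<otimes>\<^bsub>L\<^esub> x' \<otimes>\<^bsub>L\<^esub> e"
      by (auto simp: groth_rel_def)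
    have *: "c x y \<otimes>\<^bsub>N\<^esub> c a' y \<otimes>\<^bsub>N\<^esub> c e y = c a y \<otimes>\<^bsub>N\<^esub> c x' y \<otimes>\<^bsub>N\<^esub> c e y"
      if "y \<in> carrier M" for y
      using arg_cong[OF e(6), of "\<lambda>z. c z y"] e(1-5) that
      by (simp add: biadditive_left[OF bi])
    have "(c a b \<otimes>\<^bsub>N\<^esub> c a' b') \<otimes>\<^bsub>N\<^esub> (c x b' \<otimes>\<^bsub>N\<^esub> c x' b) \<otimes>\<^bsub>N\<^esub> (c e b \<otimes>\<^bsub>N\<^esub> c e b')
      = (c a b \<otimes>\<^bsub>N\<^esub> c x' b \<otimes>\<^bsub>N\<^esub> c e b) \<otimes>\<^bsub>N\<^esub> (c x b' \<otimes>\<^bsub>N\<^esub> c a' b' \<otimes>\<^bsub>N\<^esub> c e b')"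
      using e b by (simp add: N.m_ac cl)
    also have "\<dots> = (c x b \<otimes>\<^bsub>N\<^esub> c x' b') \<otimes>\<^bsub>N\<^esub> (c a b' \<otimes>\<^bsub>N\<^esub> c a' b) \<otimes>\<^bsub>N\<^esub> (c e b \<otimes>\<^bsub>N\<^esub> c e b')"
      unfolding *[OF b(2)] unfolding *[OF b(1), symmetric] using e b by (simp add: N.m_ac cl)
    finally show ?thesis
      using e b cl by (intro N.groth_class_eqI[of _ _ _ _ "c e b \<otimes>\<^bsub>N\<^esub> c e b'"]) auto
  qed
  have 2: "?v a a' b b' = ?v a a' x x'"
    if x: "((x, x'), (b, b')) \<in> groth_rel M" and b: "a \<in> carrier L" "a' \<in> carrier L"
    for a a' x x' b b'
  proof -
    from x obtain e where e: "x \<in> carrier M" "x' \<in> carrier M" "e \<in> carrier M"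
      "b \<in> carrier M" "b' \<in> carrier M" "x \<otimes>\<^bsub>M\<^esub> b' \<otimes>\<^bsub>M\<^esub> e = b \<otimes>\<^bsub>M\<^esub> x' \<otimes>\<^bsub>M\<^esub> e"
      by (auto simp: groth_rel_def)
    have *: "c y x \<otimes>\<^bsub>N\<^esub> c y b' \<otimes>\<^bsub>N\<^esub> c y e = c y b \<otimes>\<^bsub>N\<^esub> c y x' \<otimes>\<^bsub>N\<^esub> c y e"
      if "y \<in> carrier L" for y
      using arg_cong[OF e(6), of "\<lambda>z. c y z"] e(1-5) that
      by (simp add: biadditive_right[OF bi])
    have "(c a b \<otimes>\<^bsub>N\<^esub> c a' b') \<otimes>\<^bsub>N\<^esub> (c a x' \<otimes>\<^bsub>N\<^esub> c a' x) \<otimes>\<^bsub>N\<^esub> (c a e \<otimes>\<^bsub>N\<^esub> c a' e)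
      = (c a b \<otimes>\<^bsub>N\<^esub> c a x' \<otimes>\<^bsub>N\<^esub> c a e) \<otimes>\<^bsub>N\<^esub> (c a' x \<otimes>\<^bsub>N\<^esub> c a' b' \<otimes>\<^bsub>N\<^esub> c a' e)"
      using e b by (simp add: N.m_ac cl)
    also have "\<dots> = (c a x \<otimes>\<^bsub>N\<^esub> c a' x') \<otimes>\<^bsub>N\<^esub> (c a b' \<otimes>\<^bsub>N\<^esub> c a' b) \<otimes>\<^bsub>N\<^esub> (c a e \<otimes>\<^bsub>N\<^esub> c a' e)"
      unfolding *[OF b(2)] unfolding *[OF b(1), symmetric] using e b by (simp add: N.m_ac cl)
    finally show ?thesis
      using e b cl by (intro N.groth_class_eqI[of _ _ _ _ "c a e \<otimes>\<^bsub>N\<^esub> c a' e"]) auto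
  qed
  have 3: "?v x x' y y' = ?v a a' b b'"
    if xy: "((a, a'), (x, x')) \<in> groth_rel L" "((b, b'), (y, y')) \<in> groth_rel M" for x x' y y'
  proof -
    have "y \<in> carrier M" "y' \<in> carrier M"
      using xy by (auto simp: groth_rel_def)
    then have "?v x x' y y' = ?v a a' y y'"
      by (rule 1[OF xy(1)])
    also have "\<dots> = ?v a a' b b'"
      by (rule 2[OF xy(2) car(1,2)])
    finally show ?thesis .
  qed
  show ?thesis
    unfolding groth_extend_def
    by (rule UN_pairs_constant_value[OF L.groth_class_self[OF car(1,2)] M.groth_class_self[OF car(3,4)]])
      (simp add: 3)
qed

lemma groth_extend_biadditive:
  assumes "comm_monoid L" "comm_monoid M" "comm_monoid N" and bi: "biadditive L M N c"
  shows "biadditive (groth_group L) (groth_group M) (groth_group N) (groth_extend N c)"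
proof -
  interpret L: comm_monoid L by fact
  interpret M: comm_monoid M by fact
  interpret N: comm_monoid N by fact
  note cl = biadditive_closed[OF bi]
  note cls = groth_extend_classes[OF assms]
  show ?thesis
    unfolding biadditive_def
  proof (intro conjI ballI)
    fix A B assume "A \<in> carrier (groth_group L)" "B \<in> carrier (groth_group M)"
    then show "groth_extend N c A B \<in> carrier (groth_group N)"
      by (auto elim!: groth_groupE simp: cls) (auto simp: carrier_groth_group cl)
  next
    fix A A' B assume "A \<in> carrier (groth_group L)" "A' \<in> carrier (groth_group L)"
      "B \<in> carrier (groth_group M)"
    then show "groth_extend N c (A \<otimes>\<^bsub>groth_group L\<^esub> A') B
        = groth_extend N c A B \<otimes>\<^bsub>groth_group N\<^esub> groth_extend N c A' B"
      by (auto elim!: groth_groupE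
          simp: cls L.groth_mult M.groth_mult N.groth_mult cl biadditive_left[OF bi] N.m_ac)
  next
    fix A B B' assume "A \<in> carrier (groth_group L)" "B \<in> carrier (groth_group M)"
      "B' \<in> carrier (groth_group M)"
    then show "groth_extend N c A (B \<otimes>\<^bsub>groth_group M\<^esub> B')
        = groth_extend N c A B \<otimes>\<^bsub>groth_group N\<^esub> groth_extend N c A B'"
      by (auto elim!: groth_groupE
          simp: cls L.groth_mult M.groth_mult N.groth_mult cl biadditive_right[OF bi] N.m_ac)
  qed
qed

section \<open>Bilinear maps on tensor products\<close>

lemmas frag_carrier_induct = free_Abelian_group_induct[consumes 1, case_names zero diff gen]

lemma tensor_relations_closed:
  assumes "comm_group A" "comm_group B"
  shows "tensor_relations A B \<subseteq> carrier (free_Abelian_group (carrier A \<times> carrier B))"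
proof -
  interpret A: comm_group A by fact
  interpret B: comm_group B by fact
  show ?thesis
    unfolding tensor_relations_def
    by (auto simp: keys_frag_of dest!: subsetD[OF keys_diff])
qed

lemma tensor_kernel_subgroup:
  assumes "comm_group A" "comm_group B"
  shows "subgroup (tensor_kernel A B) (free_Abelian_group (carrier A \<times> carrier B))"
  unfolding tensor_kernel_def
  by (intro group.generate_is_subgroup tensor_relations_closed assms) simp

lemma tensor_kernel_normal:
  assumes "comm_group A" "comm_group B"
  shows "tensor_kernel A B \<lhd> free_Abelian_group (carrier A \<times> carrier B)"
  by (intro comm_group.subgroup_imp_normal abelian_free_Abelian_group tensor_kernel_subgroup assms)

lemma tensor_comm_group:
  assumes "comm_group A" "comm_group B"
  shows "comm_group (tensor_group A B)"
  unfolding tensor_group_def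
  by (intro comm_group.abelian_FactGroup abelian_free_Abelian_group tensor_kernel_subgroup assms)

lemma carrier_tensor_group:
  "carrier (tensor_group A B) = tensor_class A B ` {f. Poly_Mapping.keys f \<subseteq> carrier A \<times> carrier B}"
  by (auto simp: tensor_group_def carrier_FactGroup tensor_class_def free_Abelian_group_def)

lemma tensor_class_add:
  assumes "comm_group A" "comm_group B"
    "Poly_Mapping.keys f \<subseteq> carrier A \<times> carrier B" "Poly_Mapping.keys g \<subseteq> carrier A \<times> carrier B"
  shows "tensor_class A B (f + g) = tensor_class A B f \<otimes>\<^bsub>tensor_group A B\<^esub> tensor_class A B g"
  using normal.rcos_sum[OF tensor_kernel_normal[OF assms(1,2)], of f g] assms(3,4)
  by (simp add: tensor_group_def tensor_class_def FactGroup_def)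

lemma tensor_class_eqI:
  assumes "comm_group A" "comm_group B"
    "Poly_Mapping.keys g \<subseteq> carrier A \<times> carrier B" "f - g \<in> tensor_kernel A B"
  shows "tensor_class A B f = tensor_class A B g"
proof -
  have "f \<in> tensor_class A B g"
    using assms(4) unfolding tensor_class_def r_coset_def by force
  then show ?thesis
    unfolding tensor_class_def
    using group.repr_independence[OF group_free_Abelian_group _ _ tensor_kernel_subgroup[OF assms(1,2)]]
      assms(3) by simp
qed

lemma tensor_class_members:
  assumes "comm_group A" "comm_group B"
    "Poly_Mapping.keys g \<subseteq> carrier A \<times> carrier B" "f \<in> tensor_class A B g"
  shows "Poly_Mapping.keys f \<subseteq> carrier A \<times> carrier B" "f - g \<in> tensor_kernel A B"
proof -
  from assms(4) obtain k where k: "k \<in> tensor_kernel A B" "f = k + g"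
    by (auto simp: tensor_class_def r_coset_def)
  then have "Poly_Mapping.keys k \<subseteq> carrier A \<times> carrier B"
    using subsetD[OF subgroup.subset[OF tensor_kernel_subgroup[OF assms(1,2)]], of k] by simp
  then show "Poly_Mapping.keys f \<subseteq> carrier A \<times> carrier B"
    using assms(3) k Poly_Mapping.keys_add[of k g] by auto
  show "f - g \<in> tensor_kernel A B"
    using k by simp
qed

lemma tensor_class_self:
  assumes "comm_group A" "comm_group B" "Poly_Mapping.keys g \<subseteq> carrier A \<times> carrier B"
  shows "g \<in> tensor_class A B g"
  unfolding tensor_class_def
  by (rule group.rcos_self[OF group_free_Abelian_group _ tensor_kernel_subgroup[OF assms(1,2)]])
    (use assms in simp)

abbreviation pure_tensor ::
    "('a, 'm) monoid_scheme \<Rightarrow> ('b, 'n) monoid_scheme \<Rightarrow> 'a \<Rightarrow> 'b \<Rightarrow> (('a \<times> 'b) \<Rightarrow>\<^sub>0 int) set"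
  where "pure_tensor A B a b \<equiv> tensor_class A B (frag_of (a, b))"

lemma pure_tensor_closed:
  "a \<in> carrier A \<Longrightarrow> b \<in> carrier B \<Longrightarrow> pure_tensor A B a b \<in> carrier (tensor_group A B)"
  by (auto simp: carrier_tensor_group keys_frag_of)

lemma pure_tensor_left:
  assumes "comm_group A" "comm_group B" "a \<in> carrier A" "a' \<in> carrier A" "b \<in> carrier B"
  shows "pure_tensor A B (a \<otimes>\<^bsub>A\<^esub> a') b
    = pure_tensor A B a b \<otimes>\<^bsub>tensor_group A B\<^esub> pure_tensor A B a' b"
proof -
  interpret A: comm_group A by fact
  interpret B: comm_group B by fact
  have keys: "Poly_Mapping.keys (frag_of (a, b) + frag_of (a', b)) \<subseteq> carrier A \<times> carrier B"
    using assms by (auto simp: keys_frag_of dest!: subsetD[OF Poly_Mapping.keys_add])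
  have "frag_of (a \<otimes>\<^bsub>A\<^esub> a', b) - (frag_of (a, b) + frag_of (a', b)) \<in> tensor_kernel A B"
    unfolding tensor_kernel_def
    by (rule generate.incl) (use assms in \<open>auto simp: tensor_relations_def algebra_simps\<close>)
  then have "pure_tensor A B (a \<otimes>\<^bsub>A\<^esub> a') b = tensor_class A B (frag_of (a, b) + frag_of (a', b))"
    by (intro tensor_class_eqI assms(1,2) keys)
  then show ?thesis
    using assms by (simp add: tensor_class_add keys_frag_of)
qed

lemma pure_tensor_right:
  assumes "comm_group A" "comm_group B" "a \<in> carrier A" "b \<in> carrier B" "b' \<in> carrier B"
  shows "pure_tensor A B a (b \<otimes>\<^bsub>B\<^esub> b')
    = pure_tensor A B a b \<otimes>\<^bsub>tensor_group A B\<^esub> pure_tensor A B a b'"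
proof -
  interpret A: comm_group A by fact
  interpret B: comm_group B by fact
  have keys: "Poly_Mapping.keys (frag_of (a, b) + frag_of (a, b')) \<subseteq> carrier A \<times> carrier B"
    using assms by (auto simp: keys_frag_of dest!: subsetD[OF Poly_Mapping.keys_add])
  have "frag_of (a, b \<otimes>\<^bsub>B\<^esub> b') - (frag_of (a, b) + frag_of (a, b')) \<in> tensor_kernel A B"
    unfolding tensor_kernel_def
    by (rule generate.incl) (use assms in \<open>auto simp: tensor_relations_def algebra_simps\<close>)
  then have "pure_tensor A B a (b \<otimes>\<^bsub>B\<^esub> b') = tensor_class A B (frag_of (a, b) + frag_of (a, b'))"
    by (intro tensor_class_eqI assms(1,2) keys)
  then show ?thesis
    using assms by (simp add: tensor_class_add keys_frag_of)
qed

lemma tensor_class_diff: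
  assumes "comm_group A" "comm_group B"
    "Poly_Mapping.keys f \<subseteq> carrier A \<times> carrier B" "Poly_Mapping.keys g \<subseteq> carrier A \<times> carrier B"
  shows "tensor_class A B (f - g)
    = tensor_class A B f \<otimes>\<^bsub>tensor_group A B\<^esub> inv\<^bsub>tensor_group A B\<^esub> tensor_class A B g"
proof -
  interpret T: comm_group "tensor_group A B" by (rule tensor_comm_group) fact+
  have keys: "Poly_Mapping.keys (f - g) \<subseteq> carrier A \<times> carrier B"
    using keys_diff[of f g] assms by blast
  have car: "tensor_class A B h \<in> carrier (tensor_group A B)"
    if "Poly_Mapping.keys h \<subseteq> carrier A \<times> carrier B" for h
    using that by (auto simp: carrier_tensor_group)
  have "tensor_class A B f = tensor_class A B (f - g) \<otimes>\<^bsub>tensor_group A B\<^esub> tensor_class A B g"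
    using tensor_class_add[OF assms(1,2) keys assms(4)] by simp
  then show ?thesis
    using car[OF keys] car[OF assms(4)] by (simp add: T.m_assoc)
qed

lemma tensor_class_zero: "comm_group A \<Longrightarrow> comm_group B \<Longrightarrow> tensor_class A B 0 = \<one>\<^bsub>tensor_group A B\<^esub>"
  by (simp add: tensor_group_def tensor_class_def FactGroup_def r_coset_def)

text \<open>The rule allows differences as well as the generators, because the pure tensors only generate
the tensor product as a group.\<close>

lemma tensor_group_induct [consumes 3, case_names one pure diff]:
  assumes "comm_group A" "comm_group B" "x \<in> carrier (tensor_group A B)"
    and "P \<one>\<^bsub>tensor_group A B\<^esub>"
    and pure: "\<And>a b. a \<in> carrier A \<Longrightarrow> b \<in> carrier B \<Longrightarrow> P (pure_tensor A B a b)"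
    and minus: "\<And>x y. x \<in> carrier (tensor_group A B) \<Longrightarrow> y \<in> carrier (tensor_group A B) \<Longrightarrow>
      P x \<Longrightarrow> P y \<Longrightarrow> P (x \<otimes>\<^bsub>tensor_group A B\<^esub> inv\<^bsub>tensor_group A B\<^esub> y)"
  shows "P x"
proof -
  from assms(3) obtain f where f: "x = tensor_class A B f"
    "Poly_Mapping.keys f \<subseteq> carrier A \<times> carrier B"
    by (auto simp: carrier_tensor_group)
  have "P (tensor_class A B f)"
    using f(2)
  proof (induction rule: frag_carrier_induct)
    case zero
    then show ?case using assms by (simp add: tensor_class_zero)
  next
    case (diff g h)
    then show ?case using assms by (auto simp: tensor_class_diff carrier_tensor_group intro!: minus)
  next
    case (gen a)
    then show ?case using pure by (cases a) auto
  qed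
  with f show ?thesis by simp
qed

text \<open>The map \<open>(a \<otimes> r, b \<otimes> s) \<mapsto> m a b \<otimes> n r s\<close> on representatives in the free abelian groups.\<close>

definition tensor_extend ::
    "('c, 'm) monoid_scheme \<Rightarrow> ('z, 'n) monoid_scheme \<Rightarrow> ('a \<Rightarrow> 'b \<Rightarrow> 'c) \<Rightarrow> ('x \<Rightarrow> 'y \<Rightarrow> 'z) \<Rightarrow>
     (('a \<times> 'x) \<Rightarrow>\<^sub>0 int) set \<Rightarrow> (('b \<times> 'y) \<Rightarrow>\<^sub>0 int) set \<Rightarrow> (('c \<times> 'z) \<Rightarrow>\<^sub>0 int) set"
  where "tensor_extend C Z m n Y X = (\<Union>f\<in>Y. \<Union>g\<in>X. tensor_class C Z
    (frag_extend (\<lambda>(a, r). frag_extend (\<lambda>(b, s). frag_of (m a b, n r s)) g) f))"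

text \<open>The bilinear map on the free abelian groups sends a relation in one argument, paired with any
element in the other, into the relations of the target: it is enough to check this on a
generator in the other argument, where it is the biadditivity of \<open>m\<close> and \<open>n\<close>.\<close>

lemma tensor_extend:
  assumes grp: "comm_group A" "comm_group B" "comm_group C" "comm_group X" "comm_group Y" "comm_group Z"
    and m: "biadditive A B C m" and n: "biadditive X Y Z n"
  shows "biadditive (tensor_group A X) (tensor_group B Y) (tensor_group C Z) (tensor_extend C Z m n)"
    and "\<And>a b r s. a \<in> carrier A \<Longrightarrow> b \<in> carrier B \<Longrightarrow> r \<in> carrier X \<Longrightarrow> s \<in> carrier Y \<Longrightarrow>
      tensor_extend C Z m n (pure_tensor A X a r) (pure_tensor B Y b s) =
      pure_tensor C Z (m a b) (n r s)"
proof -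
  define ext where "ext f g = frag_extend (\<lambda>(a, r). frag_extend (\<lambda>(b, s). frag_of (m a b, n r s)) g) f"
    for f g
  have of: "ext (frag_of (a, r)) (frag_of (b, s)) = frag_of (m a b, n r s)" for a b r s
    by (simp add: ext_def)
  have ext_add: "ext (f + f') g = ext f g + ext f' g" "ext (f - f') g = ext f g - ext f' g"
      "ext 0 g = 0" for f f' g
    by (simp_all add: ext_def frag_extend_add frag_extend_diff)
  have ext_zero': "ext f 0 = 0" for f
    unfolding ext_def by (rule frag_extend_eq_0) auto
  have ext_diff': "ext f (g - g') = ext f g - ext f g'" for f g g'
    using subset_UNIV[of "Poly_Mapping.keys f"]
  proof (induction f rule: frag_carrier_induct)
    case (diff f f')
    then show ?case by (simp add: ext_add)
  next
    case (gen a)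
    then show ?case by (simp add: ext_def frag_extend_diff split_def)
  qed (simp add: ext_add)
  have ext_add': "ext f (g + g') = ext f g + ext f g'" for f g g'
    using ext_diff'[of f "g + g'" g'] by (simp add: algebra_simps)
  have ext_keys: "Poly_Mapping.keys (ext f g) \<subseteq> carrier C \<times> carrier Z"
    if f: "Poly_Mapping.keys f \<subseteq> carrier A \<times> carrier X" and g: "Poly_Mapping.keys g \<subseteq> carrier B \<times> carrier Y"
    for f g
    using f
  proof (induction f rule: frag_carrier_induct)
    case (diff f f')
    then show ?case using keys_diff[of "ext f g" "ext f' g"] by (auto simp: ext_add)
  next
    case (gen a)
    then obtain u r where a: "a = (u, r)" "u \<in> carrier A" "r \<in> carrier X" by auto
    from g show ?case
    proof (induction g rule: frag_carrier_induct)
      case zero then show ?case by (simp add: ext_zero')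
    next
      case (diff g g')
      then show ?case using keys_diff[of "ext (frag_of a) g" "ext (frag_of a) g'"] by (auto simp: ext_diff')
    next
      case (gen b)
      then show ?case using a biadditive_closed[OF m] biadditive_closed[OF n]
        by (cases b) (simp add: of keys_frag_of)
    qed
  qed (simp add: ext_add)
  interpret K: subgroup "tensor_kernel C Z" "free_Abelian_group (carrier C \<times> carrier Z)"
    by (rule tensor_kernel_subgroup) fact+
  have K0: "0 \<in> tensor_kernel C Z"
    using K.one_closed by simp
  have Kadd: "f + g \<in> tensor_kernel C Z" if "f \<in> tensor_kernel C Z" "g \<in> tensor_kernel C Z" for f g
    using K.m_closed[OF that] by simp
  have Kminus: "- f \<in> tensor_kernel C Z" if "f \<in> tensor_kernel C Z" for f
    using K.m_inv_closed[OF that] subsetD[OF K.subset that] by simp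
  have Kdiff: "f - g \<in> tensor_kernel C Z" if "f \<in> tensor_kernel C Z" "g \<in> tensor_kernel C Z" for f g
    using Kadd[OF that(1) Kminus[OF that(2)]] by simp
  have rel: "f \<in> tensor_relations C Z \<Longrightarrow> f \<in> tensor_kernel C Z" for f
    unfolding tensor_kernel_def by (rule generate.incl)
  note cl = biadditive_closed[OF m] biadditive_closed[OF n]
  have ker_left: "ext f g \<in> tensor_kernel C Z"
    if f: "f \<in> tensor_kernel A X" and g: "Poly_Mapping.keys g \<subseteq> carrier B \<times> carrier Y" for f g
  proof -
    have r: "ext f g \<in> tensor_kernel C Z" if "f \<in> tensor_relations A X" for f
      using g
    proof (induction g rule: frag_carrier_induct)
      case (gen b)
      then show ?case using \<open>f \<in> tensor_relations A X\<close>
        by (cases b, intro rel, unfold tensor_relations_def)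
          (fastforce simp: ext_add of biadditive_left[OF m] biadditive_left[OF n] cl)
    qed (auto simp: ext_zero' ext_diff' K0 Kdiff)
    from f show ?thesis
      unfolding tensor_kernel_def[of A]
    proof (induction rule: generate.induct)
      case (inv h)
      have "inv\<^bsub>free_Abelian_group (carrier A \<times> carrier X)\<^esub> h = 0 - h"
        using tensor_relations_closed[OF grp(1,4)] inv by auto
      then show ?case using r[OF inv] by (simp add: ext_add Kdiff K0 del: diff_0)
    qed (auto simp: ext_add K0 r Kadd)
  qed
  have ker_right: "ext f g \<in> tensor_kernel C Z"
    if g: "g \<in> tensor_kernel B Y" and f: "Poly_Mapping.keys f \<subseteq> carrier A \<times> carrier X" for f g
  proof -
    have r: "ext f g \<in> tensor_kernel C Z" if "g \<in> tensor_relations B Y" for g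
      using f
    proof (induction f rule: frag_carrier_induct)
      case (gen b)
      then show ?case using \<open>g \<in> tensor_relations B Y\<close>
        by (cases b, intro rel, unfold tensor_relations_def)
          (fastforce simp: ext_add' ext_diff' of biadditive_right[OF m] biadditive_right[OF n] cl)
    qed (auto simp: ext_add K0 Kdiff)
    from g show ?thesis
      unfolding tensor_kernel_def[of B]
    proof (induction rule: generate.induct)
      case (inv h)
      have "inv\<^bsub>free_Abelian_group (carrier B \<times> carrier Y)\<^esub> h = 0 - h"
        using tensor_relations_closed[OF grp(2,5)] inv by auto
      then show ?case using r[OF inv] by (simp add: ext_diff' ext_zero' Kdiff K0 del: diff_0)
    qed (auto simp: ext_add' ext_zero' K0 r Kadd)
  qed
  have val: "tensor_extend C Z m n (tensor_class A X f) (tensor_class B Y g) = tensor_class C Z (ext f g)"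
    if f: "Poly_Mapping.keys f \<subseteq> carrier A \<times> carrier X" and g: "Poly_Mapping.keys g \<subseteq> carrier B \<times> carrier Y"
    for f g
  proof -
    have "tensor_class C Z (ext f' g') = tensor_class C Z (ext f g)"
      if f': "f' \<in> tensor_class A X f" and g': "g' \<in> tensor_class B Y g" for f' g'
    proof -
      note 1 = tensor_class_members[OF grp(1,4) f f'] and 2 = tensor_class_members[OF grp(2,5) g g']
      have "ext f' g' - ext f g = ext (f' - f) g' + ext f (g' - g)"
        by (simp add: ext_add ext_diff')
      also have "\<dots> \<in> tensor_kernel C Z"
        by (intro Kadd ker_left ker_right 1 2 f)
      finally show ?thesis
        by (intro tensor_class_eqI grp ext_keys f g)
    qed
    then show ?thesis
      unfolding tensor_extend_def ext_def[symmetric]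
      by (intro UN_constant_value[OF tensor_class_self[OF grp(1,4) f]]
          UN_constant_value[OF tensor_class_self[OF grp(2,5) g]]) assumption+
  qed
  show "tensor_extend C Z m n (pure_tensor A X a r) (pure_tensor B Y b s) =
      pure_tensor C Z (m a b) (n r s)"
    if "a \<in> carrier A" "b \<in> carrier B" "r \<in> carrier X" "s \<in> carrier Y" for a b r s
    using that by (simp add: val keys_frag_of of)
  show "biadditive (tensor_group A X) (tensor_group B Y) (tensor_group C Z) (tensor_extend C Z m n)"
    unfolding biadditive_def
  proof (intro conjI ballI)
    fix x y assume "x \<in> carrier (tensor_group A X)" "y \<in> carrier (tensor_group B Y)"
    then show "tensor_extend C Z m n x y \<in> carrier (tensor_group C Z)"
      by (auto simp: carrier_tensor_group val ext_keys)
  next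
    fix x x' y assume "x \<in> carrier (tensor_group A X)" "x' \<in> carrier (tensor_group A X)"
      "y \<in> carrier (tensor_group B Y)"
    then obtain f f' g where fg: "Poly_Mapping.keys f \<subseteq> carrier A \<times> carrier X"
        "Poly_Mapping.keys f' \<subseteq> carrier A \<times> carrier X" "Poly_Mapping.keys g \<subseteq> carrier B \<times> carrier Y"
        "x = tensor_class A X f" "x' = tensor_class A X f'" "y = tensor_class B Y g"
      by (auto simp: carrier_tensor_group)
    moreover have "Poly_Mapping.keys (f + f') \<subseteq> carrier A \<times> carrier X"
      using fg Poly_Mapping.keys_add[of f f'] by blast
    ultimately show "tensor_extend C Z m n (x \<otimes>\<^bsub>tensor_group A X\<^esub> x') y =
        tensor_extend C Z m n x y \<otimes>\<^bsub>tensor_group C Z\<^esub> tensor_extend C Z m n x' y"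
      by (simp add: val tensor_class_add[symmetric] grp ext_keys ext_add)
  next
    fix x y y' assume "x \<in> carrier (tensor_group A X)" "y \<in> carrier (tensor_group B Y)"
      "y' \<in> carrier (tensor_group B Y)"
    then obtain f g g' where fg: "Poly_Mapping.keys f \<subseteq> carrier A \<times> carrier X"
        "Poly_Mapping.keys g \<subseteq> carrier B \<times> carrier Y" "Poly_Mapping.keys g' \<subseteq> carrier B \<times> carrier Y"
        "x = tensor_class A X f" "y = tensor_class B Y g" "y' = tensor_class B Y g'"
      by (auto simp: carrier_tensor_group)
    moreover have "Poly_Mapping.keys (g + g') \<subseteq> carrier B \<times> carrier Y"
      using fg Poly_Mapping.keys_add[of g g'] by blast
    ultimately show "tensor_extend C Z m n x (y \<otimes>\<^bsub>tensor_group B Y\<^esub> y') =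
        tensor_extend C Z m n x y \<otimes>\<^bsub>tensor_group C Z\<^esub> tensor_extend C Z m n x y'"
      by (simp add: val tensor_class_add[symmetric] grp ext_keys ext_add')
  qed
qed

section \<open>Isomorphisms of bisets\<close>

lemma bisetD:
  assumes "is_biset G H X"
  shows "finite (points X)"
    and "\<And>x h. x \<in> points X \<Longrightarrow> h \<in> carrier H \<Longrightarrow> lact X h x \<in> points X"
    and "\<And>x g. x \<in> points X \<Longrightarrow> g \<in> carrier G \<Longrightarrow> ract X x g \<in> points X"
    and "\<And>x. x \<in> points X \<Longrightarrow> lact X \<one>\<^bsub>H\<^esub> x = x"
    and "\<And>x. x \<in> points X \<Longrightarrow> ract X x \<one>\<^bsub>G\<^esub> = x"
    and "\<And>x h h'. x \<in> points X \<Longrightarrow> h \<in> carrier H \<Longrightarrow> h' \<in> carrier H \<Longrightarrow>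
      lact X (h \<otimes>\<^bsub>H\<^esub> h') x = lact X h (lact X h' x)"
    and "\<And>x g g'. x \<in> points X \<Longrightarrow> g \<in> carrier G \<Longrightarrow> g' \<in> carrier G \<Longrightarrow>
      ract X x (g \<otimes>\<^bsub>G\<^esub> g') = ract X (ract X x g) g'"
    and "\<And>x h g. x \<in> points X \<Longrightarrow> h \<in> carrier H \<Longrightarrow> g \<in> carrier G \<Longrightarrow>
      ract X (lact X h x) g = lact X h (ract X x g)"
  using assms by (auto simp: is_biset_def)

lemma biset_lact_inv:
  assumes "is_biset G H X" "group H" "x \<in> points X" "h \<in> carrier H"
  shows "lact X (inv\<^bsub>H\<^esub> h) (lact X h x) = x" "lact X h (lact X (inv\<^bsub>H\<^esub> h) x) = x"
  using assms by (simp_all add: bisetD(4,6)[OF assms(1), symmetric] group.l_inv group.r_inv bisetD(4)[OF assms(1)])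

lemma biset_ract_inv:
  assumes "is_biset G H X" "group G" "x \<in> points X" "g \<in> carrier G"
  shows "ract X (ract X x g) (inv\<^bsub>G\<^esub> g) = x" "ract X (ract X x (inv\<^bsub>G\<^esub> g)) g = x"
  using assms by (simp_all add: bisetD(7)[OF assms(1), symmetric] group.l_inv group.r_inv bisetD(5)[OF assms(1)])

text \<open>Isomorphisms of bisets are produced from a common cover: two surjections from a set \<open>A\<close> that
identify the same pairs of elements and along which the actions can be lifted. With product
bisets, whose points are equivalence classes, this avoids choosing representatives.\<close>

lemma biset_isoI:
  assumes "s ` A = points X" "t ` A = points Y"
    and eq: "\<And>a b. a \<in> A \<Longrightarrow> b \<in> A \<Longrightarrow> s a = s b \<longleftrightarrow> t a = t b"
    and l: "\<And>a h. a \<in> A \<Longrightarrow> h \<in> carrier H \<Longrightarrow> \<exists>b\<in>A. lact X h (s a) = s b \<and> lact Y h (t a) = t b"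
    and r: "\<And>a g. a \<in> A \<Longrightarrow> g \<in> carrier G \<Longrightarrow> \<exists>b\<in>A. ract X (s a) g = s b \<and> ract Y (t a) g = t b"
  shows "biset_iso G H X Y"
proof -
  define f where "f x = t (SOME a. a \<in> A \<and> s a = x)" for x
  have f: "f (s a) = t a" if "a \<in> A" for a
  proof -
    have "(SOME b. b \<in> A \<and> s b = s a) \<in> A \<and> s (SOME b. b \<in> A \<and> s b = s a) = s a"
      by (rule someI[of _ a]) (use that in simp)
    then show ?thesis
      using eq that unfolding f_def by blast
  qed
  have "bij_betw f (points X) (points Y)"
    unfolding assms(1,2)[symmetric] bij_betw_def
    using f eq by (auto simp: inj_on_def image_image)
  moreover have "f (lact X h x) = lact Y h (f x)" if "x \<in> points X" "h \<in> carrier H" for x h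
    using that f l unfolding assms(1)[symmetric] by (metis imageE)
  moreover have "f (ract X x g) = ract Y (f x) g" if "x \<in> points X" "g \<in> carrier G" for x g
    using that f r unfolding assms(1)[symmetric] by (metis imageE)
  ultimately show ?thesis
    unfolding biset_iso_def by blast
qed

lemma biset_iso_sym:
  assumes X: "is_biset G H X" and "biset_iso G H X Y"
  shows "biset_iso G H Y X"
proof -
  from assms(2) obtain f where f: "bij_betw f (points X) (points Y)"
    "\<And>x h. x \<in> points X \<Longrightarrow> h \<in> carrier H \<Longrightarrow> f (lact X h x) = lact Y h (f x)"
    "\<And>x g. x \<in> points X \<Longrightarrow> g \<in> carrier G \<Longrightarrow> f (ract X x g) = ract Y (f x) g"
    unfolding biset_iso_def by blast
  have "f x = f y \<longleftrightarrow> x = y" if "x \<in> points X" "y \<in> points X" for x y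
    using f(1) that by (auto simp: bij_betw_def inj_on_def)
  moreover have "f ` points X = points Y"
    using f(1) by (simp add: bij_betw_def)
  ultimately show ?thesis
    by (intro biset_isoI[of f "points X" _ "\<lambda>x. x"]) (auto simp: f bisetD(2,3)[OF X])
qed

lemma biset_iso_trans:
  assumes X: "is_biset G H X" and "biset_iso G H X Y" "biset_iso G H Y Z"
  shows "biset_iso G H X Z"
proof -
  from assms(2) obtain f where f: "bij_betw f (points X) (points Y)"
    "\<And>x h. x \<in> points X \<Longrightarrow> h \<in> carrier H \<Longrightarrow> f (lact X h x) = lact Y h (f x)"
    "\<And>x g. x \<in> points X \<Longrightarrow> g \<in> carrier G \<Longrightarrow> f (ract X x g) = ract Y (f x) g"
    unfolding biset_iso_def by blast
  from assms(3) obtain f' where f': "bij_betw f' (points Y) (points Z)"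
    "\<And>x h. x \<in> points Y \<Longrightarrow> h \<in> carrier H \<Longrightarrow> f' (lact Y h x) = lact Z h (f' x)"
    "\<And>x g. x \<in> points Y \<Longrightarrow> g \<in> carrier G \<Longrightarrow> f' (ract Y x g) = ract Z (f' x) g"
    unfolding biset_iso_def by blast
  have "f x \<in> points Y" if "x \<in> points X" for x
    using f(1) that by (auto simp: bij_betw_def)
  then show ?thesis
    unfolding biset_iso_def using bij_betw_trans[OF f(1) f'(1)] f f'
    by (intro exI[of _ "f' \<circ> f"]) auto
qed

lemma biset_iso_card: "biset_iso G H X Y \<Longrightarrow> card (points X) = card (points Y)"
  unfolding biset_iso_def using bij_betw_same_card by blast

text \<open>This is what makes \<open>iso_class\<close> nonempty, also for bisets whose points have another type.\<close>

lemma exists_nat_biset: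
  assumes X: "is_biset G H X"
  obtains Z :: "('g, 'h, nat) biset" where "is_biset G H Z" "biset_iso G H X Z"
proof -
  obtain f :: "_ \<Rightarrow> nat" where f: "inj_on f (points X)"
    using finite_imp_inj_to_nat_seg[OF bisetD(1)[OF X]] by blast
  define v where "v = inv_into (points X) f"
  have v: "v (f x) = x" if "x \<in> points X" for x
    using f that by (simp add: v_def)
  define Z :: "('g, 'h, nat) biset" where
    "Z = \<lparr>points = f ` points X, lact = (\<lambda>h n. f (lact X h (v n))), ract = (\<lambda>n g. f (ract X (v n) g))\<rparr>"
  have "is_biset G H Z"
    using bisetD[OF X] by (auto simp: is_biset_def Z_def v)
  moreover have "biset_iso G H X Z"
    unfolding biset_iso_def using f by (intro exI[of _ f]) (auto simp: Z_def v bij_betw_def)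
  ultimately show thesis by (rule that)
qed

section \<open>The monoid of isomorphism classes\<close>

lemma iso_class_eq_iff:
  assumes X: "is_biset G H X" and Y: "is_biset G H Y"
  shows "iso_class G H X = iso_class G H Y \<longleftrightarrow> biset_iso G H X Y"
proof
  assume "iso_class G H X = iso_class G H Y"
  moreover obtain Z :: "('a, 'c, nat) biset" where "is_biset G H Z" "biset_iso G H X Z"
    using exists_nat_biset[OF X] .
  ultimately have "biset_iso G H X Z" "biset_iso G H Y Z"
    by (auto simp: iso_class_def)
  then show "biset_iso G H X Y"
    using biset_iso_trans[OF X _ biset_iso_sym[OF Y]] by blast
next
  assume "biset_iso G H X Y"
  then show "iso_class G H X = iso_class G H Y"
    unfolding iso_class_def
    using biset_iso_trans[OF X] biset_iso_trans[OF Y biset_iso_sym[OF X]] by blast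
qed

lemma iso_class_closed:
  assumes X: "is_biset G H X"
  shows "iso_class G H X \<in> carrier (biset_monoid G H)"
proof -
  obtain Z :: "('a, 'c, nat) biset" where "is_biset G H Z" "biset_iso G H X Z"
    using exists_nat_biset[OF X] .
  then have "iso_class G H X = iso_class G H Z"
    using iso_class_eq_iff[OF X] by blast
  then show ?thesis
    using \<open>is_biset G H Z\<close> by (auto simp: biset_monoid_def)
qed

lemma biset_monoidE:
  assumes "c \<in> carrier (biset_monoid G H)"
  obtains X :: "('g, 'h, nat) biset" where "is_biset G H X" "c = iso_class G H X"
  using assms by (auto simp: biset_monoid_def)

lemma disjoint_union_biset:
  assumes "is_biset G H X" "is_biset G H Y"
  shows "is_biset G H (disjoint_union X Y)"
  using bisetD[OF assms(1)] bisetD[OF assms(2)] by (auto simp: is_biset_def disjoint_union_def)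

lemma disjoint_union_iso:
  assumes "biset_iso G H X X'" "biset_iso G H Y Y'"
  shows "biset_iso G H (disjoint_union X Y) (disjoint_union X' Y')"
proof -
  from assms(1) obtain f where f: "bij_betw f (points X) (points X')"
    "\<And>x h. x \<in> points X \<Longrightarrow> h \<in> carrier H \<Longrightarrow> f (lact X h x) = lact X' h (f x)"
    "\<And>x g. x \<in> points X \<Longrightarrow> g \<in> carrier G \<Longrightarrow> f (ract X x g) = ract X' (f x) g"
    unfolding biset_iso_def by blast
  from assms(2) obtain f' where f': "bij_betw f' (points Y) (points Y')"
    "\<And>x h. x \<in> points Y \<Longrightarrow> h \<in> carrier H \<Longrightarrow> f' (lact Y h x) = lact Y' h (f' x)"
    "\<And>x g. x \<in> points Y \<Longrightarrow> g \<in> carrier G \<Longrightarrow> f' (ract Y x g) = ract Y' (f' x) g"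
    unfolding biset_iso_def by blast
  have "bij_betw (map_sum f f') (points X <+> points Y) (points X' <+> points Y')"
  proof (rule bij_betw_imageI)
    show "inj_on (map_sum f f') (points X <+> points Y)"
      using bij_betw_imp_inj_on[OF f(1)] bij_betw_imp_inj_on[OF f'(1)]
      by (auto intro!: inj_onI elim!: PlusE dest: inj_onD)
    show "map_sum f f' ` (points X <+> points Y) = points X' <+> points Y'"
      unfolding bij_betw_imp_surj_on[OF f(1), symmetric] bij_betw_imp_surj_on[OF f'(1), symmetric]
      by (simp add: Plus_def image_Un image_image)
  qed
  then show ?thesis
    unfolding biset_iso_def using f f'
    by (intro exI[of _ "map_sum f f'"]) (auto simp: disjoint_union_def)
qed

lemma iso_class_mult:
  assumes X: "is_biset G H X" and Y: "is_biset G H Y"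
  shows "iso_class G H X \<otimes>\<^bsub>biset_monoid G H\<^esub> iso_class G H Y = iso_class G H (disjoint_union X Y)"
proof -
  obtain X' :: "('a, 'c, nat) biset" where X': "is_biset G H X'" "biset_iso G H X X'"
    using exists_nat_biset[OF X] .
  obtain Y' :: "('a, 'c, nat) biset" where Y': "is_biset G H Y'" "biset_iso G H Y Y'"
    using exists_nat_biset[OF Y] .
  have "iso_class G H (disjoint_union Z W) = iso_class G H (disjoint_union X Y)"
    if "Z \<in> iso_class G H X" "W \<in> iso_class G H Y" for Z W
  proof -
    from that have "is_biset G H Z" "is_biset G H W" "biset_iso G H X Z" "biset_iso G H Y W"
      by (auto simp: iso_class_def)
    then show ?thesis
      using iso_class_eq_iff disjoint_union_biset disjoint_union_iso X Y by metis
  qed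
  then have "(\<Union>Z\<in>iso_class G H X. \<Union>W\<in>iso_class G H Y. iso_class G H (disjoint_union Z W))
      = iso_class G H (disjoint_union X Y)"
    using X' Y'
    by (intro UN_constant_value[of X' "iso_class G H X"] UN_constant_value[of Y' "iso_class G H Y"])
      (simp_all add: iso_class_def)
  then show ?thesis
    by (simp add: biset_monoid_def)
qed

lemma empty_biset: "is_biset G H empty_biset"
  by (simp add: is_biset_def empty_biset_def)

lemma biset_comm_monoid:
  fixes G :: "('g, 'm) monoid_scheme" and H :: "('h, 'n) monoid_scheme"
  shows "comm_monoid (biset_monoid G H)"
proof (rule comm_monoidI)
  fix c d :: "('g, 'h) biset_class" assume "c \<in> carrier (biset_monoid G H)" "d \<in> carrier (biset_monoid G H)"
  then obtain X Y :: "('g, 'h, nat) biset" where X: "is_biset G H X" "c = iso_class G H X"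
      and Y: "is_biset G H Y" "d = iso_class G H Y"
    by (auto elim!: biset_monoidE)
  show "c \<otimes>\<^bsub>biset_monoid G H\<^esub> d \<in> carrier (biset_monoid G H)"
    unfolding X Y using X Y by (auto simp: iso_class_mult intro!: iso_class_closed disjoint_union_biset)
  have "biset_iso G H (disjoint_union X Y) (disjoint_union Y X)"
    unfolding biset_iso_def
    by (intro exI[of _ "case_sum Inr Inl"])
      (auto simp: disjoint_union_def bij_betw_def inj_on_def image_iff Plus_def image_Un image_image)
  then show "c \<otimes>\<^bsub>biset_monoid G H\<^esub> d = d \<otimes>\<^bsub>biset_monoid G H\<^esub> c"
    using X Y by (simp add: iso_class_mult iso_class_eq_iff disjoint_union_biset)
next
  show "\<one>\<^bsub>biset_monoid G H\<^esub> \<in> carrier (biset_monoid G H)"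
    using empty_biset by (auto simp: biset_monoid_def)
next
  fix c :: "('g, 'h) biset_class" assume "c \<in> carrier (biset_monoid G H)"
  then obtain X :: "('g, 'h, nat) biset" where X: "is_biset G H X" "c = iso_class G H X"
    by (auto elim!: biset_monoidE)
  have "biset_iso G H X (disjoint_union empty_biset X)"
    unfolding biset_iso_def
    by (intro exI[of _ Inr]) (auto simp: disjoint_union_def empty_biset_def bij_betw_def)
  then have "iso_class G H (disjoint_union empty_biset X) = iso_class G H X"
    using X by (simp add: iso_class_eq_iff disjoint_union_biset empty_biset biset_iso_sym)
  then show "\<one>\<^bsub>biset_monoid G H\<^esub> \<otimes>\<^bsub>biset_monoid G H\<^esub> c = c"
    using X iso_class_mult[OF empty_biset X(1)] by (simp add: biset_monoid_def)
next
  fix c d e :: "('g, 'h) biset_class"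
  assume "c \<in> carrier (biset_monoid G H)" "d \<in> carrier (biset_monoid G H)" "e \<in> carrier (biset_monoid G H)"
  then obtain X Y Z :: "('g, 'h, nat) biset" where X: "is_biset G H X" "c = iso_class G H X"
      and Y: "is_biset G H Y" "d = iso_class G H Y" and Z: "is_biset G H Z" "e = iso_class G H Z"
    by (auto elim!: biset_monoidE)
  have "biset_iso G H (disjoint_union (disjoint_union X Y) Z) (disjoint_union X (disjoint_union Y Z))"
    unfolding biset_iso_def
    by (intro exI[of _ "case_sum (case_sum Inl (Inr \<circ> Inl)) (Inr \<circ> Inr)"])
      (auto simp: disjoint_union_def bij_betw_def inj_on_def Plus_def image_Un image_image)
  then show "c \<otimes>\<^bsub>biset_monoid G H\<^esub> d \<otimes>\<^bsub>biset_monoid G H\<^esub> e =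
      c \<otimes>\<^bsub>biset_monoid G H\<^esub> (d \<otimes>\<^bsub>biset_monoid G H\<^esub> e)"
    using X Y Z by (simp add: iso_class_mult iso_class_eq_iff disjoint_union_biset)
qed

section \<open>Products of bisets\<close>

text \<open>The point \<open>[y, x]\<close> of the product biset. It is kept folded, so that equations between points are
only rewritten by the criterion \<open>balance_class_eq\<close>.\<close>

definition balance_class ::
    "('h, 'n) monoid_scheme \<Rightarrow> ('h, 'k, 'y) biset \<Rightarrow> ('g, 'h, 'x) biset \<Rightarrow> 'y \<Rightarrow> 'x \<Rightarrow> ('y \<times> 'x) set"
  where "balance_class H Y X y x = balance_rel H Y X `` {(y, x)}"

lemma balance_rel_iff:
  "((y, x), (y', x')) \<in> balance_rel H Y X \<longleftrightarrow>
    (\<exists>h\<in>carrier H. y' \<in> points Y \<and> x \<in> points X \<and> y = ract Y y' h \<and> x' = lact X h x)"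
  by (auto simp: balance_rel_def)

lemma balance_equiv:
  assumes X: "is_biset G H X" and Y: "is_biset H K Y" and "group H"
  shows "equiv (points Y \<times> points X) (balance_rel H Y X)"
proof (rule equivI)
  interpret group H by fact
  show "balance_rel H Y X \<subseteq> (points Y \<times> points X) \<times> points Y \<times> points X"
    using bisetD[OF X] bisetD[OF Y] by (auto simp: balance_rel_def)
  show "refl_on (points Y \<times> points X) (balance_rel H Y X)"
    using bisetD(4)[OF X] bisetD(5)[OF Y] by (auto simp: refl_on_def balance_rel_iff intro!: bexI[of _ "\<one>\<^bsub>H\<^esub>"])
  show "sym (balance_rel H Y X)"
    using bisetD[OF X] bisetD[OF Y] biset_lact_inv[OF X] biset_ract_inv[OF Y] \<open>group H\<close>
    by (auto simp: sym_def balance_rel_iff) (metis inv_closed)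
  show "trans (balance_rel H Y X)"
  proof (rule transI, clarsimp simp: balance_rel_iff)
    fix y x h h' assume *: "h \<in> carrier H" "h' \<in> carrier H" "y \<in> points Y" "x \<in> points X"
    show "\<exists>h''\<in>carrier H. ract Y (ract Y y h') h = ract Y y h'' \<and> lact X h' (lact X h x) = lact X h'' x"
      using * bisetD(6)[OF X] bisetD(7)[OF Y] by (intro bexI[of _ "h' \<otimes>\<^bsub>H\<^esub> h"]) auto
  qed
qed

context
  fixes G :: "('g, 'm) monoid_scheme" and H :: "('h, 'n) monoid_scheme" and K :: "('k, 'l) monoid_scheme"
    and X :: "('g, 'h, 'x) biset" and Y :: "('h, 'k, 'y) biset"
  assumes X: "is_biset G H X" and Y: "is_biset H K Y"
    and G: "group G" and H: "group H" and K: "group K"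
begin

lemma balance_class_eq:
  assumes "y \<in> points Y" "x \<in> points X" "y' \<in> points Y" "x' \<in> points X"
  shows "balance_class H Y X y x = balance_class H Y X y' x' \<longleftrightarrow>
    (\<exists>h\<in>carrier H. y = ract Y y' h \<and> x' = lact X h x)"
  using eq_equiv_class_iff[OF balance_equiv[OF X Y H], of "(y, x)" "(y', x')"] assms
  by (simp add: balance_rel_iff balance_class_def)

lemma balance_class_shift:
  assumes "y \<in> points Y" "x \<in> points X" "h \<in> carrier H"
  shows "balance_class H Y X (ract Y y h) x = balance_class H Y X y (lact X h x)"
  using assms bisetD(3)[OF Y] bisetD(2)[OF X] by (subst balance_class_eq) auto

lemma points_biset_product:
  "points (biset_product H Y X) = (\<lambda>(y, x). balance_class H Y X y x) ` (points Y \<times> points X)"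
  by (auto simp: biset_product_def quotient_def balance_class_def)

lemma lact_biset_product:
  assumes "y \<in> points Y" "x \<in> points X" "k \<in> carrier K"
  shows "lact (biset_product H Y X) k (balance_class H Y X y x) = balance_class H Y X (lact Y k y) x"
proof -
  have "(\<lambda>(y, x). (lact Y k y, x)) ` balance_class H Y X y x = balance_class H Y X (lact Y k y) x"
    (is "?f ` ?A = ?B")
  proof
    show "?f ` ?A \<subseteq> ?B"
      using assms bisetD[OF Y] by (auto simp: balance_rel_iff balance_class_def)
    show "?B \<subseteq> ?f ` ?A"
    proof (clarsimp simp: balance_rel_iff balance_class_def)
      fix y' h assume *: "y' \<in> points Y" "h \<in> carrier H" "lact Y k y = ract Y y' h" "x \<in> points X"
      have k: "inv\<^bsub>K\<^esub> k \<in> carrier K"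
        using K assms(3) by simp
      have "y = lact Y (inv\<^bsub>K\<^esub> k) (ract Y y' h)"
        using biset_lact_inv(1)[OF Y K assms(1,3)] *(3) by simp
      then have "y = ract Y (lact Y (inv\<^bsub>K\<^esub> k) y') h"
        using bisetD(8)[OF Y *(1) k *(2)] by simp
      then have "((y, x), (lact Y (inv\<^bsub>K\<^esub> k) y', lact X h x)) \<in> balance_rel H Y X"
        using * bisetD(2)[OF Y *(1) k] by (auto simp: balance_rel_iff)
      then show "(y', lact X h x) \<in> ?f ` (balance_rel H Y X `` {(y, x)})"
        using biset_lact_inv(2)[OF Y K *(1) assms(3)] by force
    qed
  qed
  then show ?thesis
    by (simp add: biset_product_def)
qed

lemma ract_biset_product:
  assumes "y \<in> points Y" "x \<in> points X" "g \<in> carrier G"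
  shows "ract (biset_product H Y X) (balance_class H Y X y x) g = balance_class H Y X y (ract X x g)"
proof -
  have "(\<lambda>(y, x). (y, ract X x g)) ` balance_class H Y X y x = balance_class H Y X y (ract X x g)"
    (is "?f ` ?A = ?B")
  proof
    show "?f ` ?A \<subseteq> ?B"
      using assms bisetD[OF X] by (auto simp: balance_rel_iff balance_class_def) metis
    show "?B \<subseteq> ?f ` ?A"
    proof (clarsimp simp: balance_rel_iff balance_class_def)
      fix y' h assume *: "y' \<in> points Y" "h \<in> carrier H" "y = ract Y y' h"
      have "((ract Y y' h, x), (y', lact X h x)) \<in> balance_rel H Y X"
        using * assms by (auto simp: balance_rel_iff)
      then show "(y', lact X h (ract X x g)) \<in> ?f ` (balance_rel H Y X `` {(ract Y y' h, x)})"
        using bisetD(8)[OF X assms(2) *(2) assms(3)] by force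
    qed
  qed
  then show ?thesis
    by (simp add: biset_product_def)
qed

lemma biset_product_biset: "is_biset G K (biset_product H Y X)"
proof -
  interpret G: group G by (rule G)
  interpret K: group K by (rule K)
  have pc: "balance_class H Y X y x \<in> points (biset_product H Y X)"
    if "y \<in> points Y" "x \<in> points X" for y x
    using that by (auto simp: points_biset_product)
  show ?thesis
    unfolding is_biset_def
  proof (intro conjI ballI)
    show "finite (points (biset_product H Y X))"
      using bisetD(1)[OF X] bisetD(1)[OF Y] by (simp add: points_biset_product)
  qed (auto simp: points_biset_product[unfolded image_def] bisetD[OF X] bisetD[OF Y]
        lact_biset_product ract_biset_product, (metis bisetD(2)[OF Y] bisetD(3)[OF X])+)
qed

end

lemma biset_product_iso:
  assumes X: "is_biset G H X" "is_biset G H X'" and Y: "is_biset H K Y" "is_biset H K Y'"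
    and grp: "group G" "group H" "group K"
    and iso: "biset_iso G H X X'" "biset_iso H K Y Y'"
  shows "biset_iso G K (biset_product H Y X) (biset_product H Y' X')"
proof -
  from iso(1) obtain f where f: "bij_betw f (points X) (points X')"
    "\<And>x h. x \<in> points X \<Longrightarrow> h \<in> carrier H \<Longrightarrow> f (lact X h x) = lact X' h (f x)"
    "\<And>x g. x \<in> points X \<Longrightarrow> g \<in> carrier G \<Longrightarrow> f (ract X x g) = ract X' (f x) g"
    unfolding biset_iso_def by blast
  from iso(2) obtain f' where f': "bij_betw f' (points Y) (points Y')"
    "\<And>x h. x \<in> points Y \<Longrightarrow> h \<in> carrier K \<Longrightarrow> f' (lact Y h x) = lact Y' h (f' x)"
    "\<And>x g. x \<in> points Y \<Longrightarrow> g \<in> carrier H \<Longrightarrow> f' (ract Y x g) = ract Y' (f' x) g"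
    unfolding biset_iso_def by blast
  have pt: "x \<in> points X \<Longrightarrow> f x \<in> points X'" "y \<in> points Y \<Longrightarrow> f' y \<in> points Y'" for x y
    using f(1) f'(1) by (auto simp: bij_betw_def)
  have inj: "x \<in> points X \<Longrightarrow> x' \<in> points X \<Longrightarrow> f x = f x' \<longleftrightarrow> x = x'"
    "y \<in> points Y \<Longrightarrow> y' \<in> points Y \<Longrightarrow> f' y = f' y' \<longleftrightarrow> y = y'" for x x' y y'
    using f(1) f'(1) by (auto simp: bij_betw_def inj_on_def)
  note 1 = X(1) Y(1) grp and 2 = X(2) Y(2) grp
  show ?thesis
  proof (rule biset_isoI[of "\<lambda>(y, x). balance_class H Y X y x" "points Y \<times> points X" _
      "\<lambda>(y, x). balance_class H Y' X' (f' y) (f x)"])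
    show "(\<lambda>(y, x). balance_class H Y X y x) ` (points Y \<times> points X) = points (biset_product H Y X)"
      by (simp add: points_biset_product[OF 1])
    have "points Y' \<times> points X' = map_prod f' f ` (points Y \<times> points X)"
      using f(1) f'(1) by (simp add: map_prod_surj_on bij_betw_def)
    then show "(\<lambda>(y, x). balance_class H Y' X' (f' y) (f x)) ` (points Y \<times> points X) =
        points (biset_product H Y' X')"
      by (simp add: points_biset_product[OF 2] image_image case_prod_unfold)
  next
    fix a b assume "a \<in> points Y \<times> points X" "b \<in> points Y \<times> points X"
    then obtain y x y' x' where "a = (y, x)" "b = (y', x')" "y \<in> points Y" "x \<in> points X"
        "y' \<in> points Y" "x' \<in> points X"
      by auto
    then show "((case a of (y, x) \<Rightarrow> balance_class H Y X y x) = (case b of (y, x) \<Rightarrow> balance_class H Y X y x)) =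
       ((case a of (y, x) \<Rightarrow> balance_class H Y' X' (f' y) (f x)) =
        (case b of (y, x) \<Rightarrow> balance_class H Y' X' (f' y) (f x)))"
      by (simp add: balance_class_eq[OF 1] balance_class_eq[OF 2] pt f(2)[symmetric] f'(3)[symmetric]
          inj bisetD(2)[OF X(1)] bisetD(3)[OF Y(1)])
  next
    fix a h assume "a \<in> points Y \<times> points X" "h \<in> carrier K"
    then show "\<exists>b\<in>points Y \<times> points X.
        lact (biset_product H Y X) h (case a of (y, x) \<Rightarrow> balance_class H Y X y x) =
        (case b of (y, x) \<Rightarrow> balance_class H Y X y x) \<and>
        lact (biset_product H Y' X') h (case a of (y, x) \<Rightarrow> balance_class H Y' X' (f' y) (f x)) =
        (case b of (y, x) \<Rightarrow> balance_class H Y' X' (f' y) (f x))"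
      by (intro bexI[of _ "(lact Y h (fst a), snd a)"])
        (auto simp: lact_biset_product[OF 1] lact_biset_product[OF 2] pt f' bisetD(2)[OF Y(1)])
  next
    fix a g assume "a \<in> points Y \<times> points X" "g \<in> carrier G"
    then show "\<exists>b\<in>points Y \<times> points X.
        ract (biset_product H Y X) (case a of (y, x) \<Rightarrow> balance_class H Y X y x) g =
        (case b of (y, x) \<Rightarrow> balance_class H Y X y x) \<and>
        ract (biset_product H Y' X') (case a of (y, x) \<Rightarrow> balance_class H Y' X' (f' y) (f x)) g =
        (case b of (y, x) \<Rightarrow> balance_class H Y' X' (f' y) (f x))"
      by (intro bexI[of _ "(fst a, ract X (snd a) g)"])
        (auto simp: ract_biset_product[OF 1] ract_biset_product[OF 2] pt f bisetD(3)[OF X(1)])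
  qed
qed

lemma comp_class_iso_class:
  fixes G :: "('g, 'm) monoid_scheme" and H :: "('h, 'n) monoid_scheme" and K :: "('k, 'l) monoid_scheme"
  assumes X: "is_biset G H X" and Y: "is_biset H K Y" and grp: "group G" "group H" "group K"
  shows "comp_class G H K (iso_class H K Y) (iso_class G H X) = iso_class G K (biset_product H Y X)"
proof -
  obtain X' :: "('g, 'h, nat) biset" where X': "is_biset G H X'" "biset_iso G H X X'"
    using exists_nat_biset[OF X] .
  obtain Y' :: "('h, 'k, nat) biset" where Y': "is_biset H K Y'" "biset_iso H K Y Y'"
    using exists_nat_biset[OF Y] .
  have eq: "iso_class G K (biset_product H W Z) = iso_class G K (biset_product H Y X)"
    if "W \<in> iso_class H K Y" "Z \<in> iso_class G H X" for Z W
  proof -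
    from that have "is_biset G H Z" "is_biset H K W" "biset_iso G H X Z" "biset_iso H K Y W"
      by (auto simp: iso_class_def)
    then show ?thesis
      using biset_product_iso[OF X _ Y _ grp] biset_product_biset[OF _ _ grp] X Y
      by (metis iso_class_eq_iff)
  qed
  have XY: "X' \<in> iso_class G H X" "Y' \<in> iso_class H K Y"
    using X' Y' by (auto simp: iso_class_def)
  show ?thesis
    unfolding comp_class_def
    by (intro UN_constant_value[OF XY(2)] UN_constant_value[OF XY(1)] eq)
qed

lemma biset_product_union_left:
  assumes X: "is_biset G H X" and Y: "is_biset H K Y" "is_biset H K Y'"
    and grp: "group G" "group H" "group K"
  shows "biset_iso G K (biset_product H (disjoint_union Y Y') X)
    (disjoint_union (biset_product H Y X) (biset_product H Y' X))"
proof -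
  let ?U = "disjoint_union Y Y'"
  note Z = disjoint_union_biset[OF Y]
  note 1 = X Y(1) grp and 2 = X Y(2) grp and 3 = X Z grp
  have U: "points ?U = points Y <+> points Y'" "\<And>h. lact ?U h = map_sum (lact Y h) (lact Y' h)"
    "\<And>z h. ract ?U z h = map_sum (\<lambda>y. ract Y y h) (\<lambda>y. ract Y' y h) z"
    by (simp_all add: disjoint_union_def)
  define t where "t = (\<lambda>(u, x). map_sum (\<lambda>y. balance_class H Y X y x) (\<lambda>y. balance_class H Y' X y x) u)"
  show ?thesis
  proof (rule biset_isoI[of "\<lambda>(y, x). balance_class H ?U X y x" "points ?U \<times> points X" _ t])
    show "(\<lambda>(y, x). balance_class H ?U X y x) ` (points ?U \<times> points X) = points (biset_product H ?U X)"
      by (simp add: points_biset_product[OF 3])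
    have "points ?U \<times> points X = apfst Inl ` (points Y \<times> points X) \<union> apfst Inr ` (points Y' \<times> points X)"
      by (auto simp: U image_iff)
    then show "t ` (points ?U \<times> points X) =
        points (disjoint_union (biset_product H Y X) (biset_product H Y' X))"
      by (simp add: disjoint_union_def points_biset_product[OF 1] points_biset_product[OF 2]
          Plus_def image_Un image_image case_prod_unfold t_def)
  next
    fix a b assume "a \<in> points ?U \<times> points X" "b \<in> points ?U \<times> points X"
    then obtain y x y' x' where "a = (y, x)" "b = (y', x')" "(y, x) \<in> points ?U \<times> points X"
        "(y', x') \<in> points ?U \<times> points X"
      by auto
    then show "((case a of (y, x) \<Rightarrow> balance_class H ?U X y x) = (case b of (y, x) \<Rightarrow> balance_class H ?U X y x)) =
       (t a = t b)"
      by (cases y; cases y')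
        (simp_all add: balance_class_eq[OF 1] balance_class_eq[OF 2] balance_class_eq[OF 3] U t_def Plus_def image_iff)
  next
    fix a h assume "a \<in> points ?U \<times> points X" "h \<in> carrier K"
    then show "\<exists>b\<in>points ?U \<times> points X.
        lact (biset_product H ?U X) h (case a of (y, x) \<Rightarrow> balance_class H ?U X y x) =
        (case b of (y, x) \<Rightarrow> balance_class H ?U X y x) \<and>
        lact (disjoint_union (biset_product H Y X) (biset_product H Y' X)) h (t a) = t b"
      by (intro bexI[of _ "(lact ?U h (fst a), snd a)"]; cases a; cases "fst a")
        (auto simp: lact_biset_product[OF 1] lact_biset_product[OF 2] lact_biset_product[OF 3] U t_def
         bisetD(2)[OF Y(1)] bisetD(2)[OF Y(2)] disjoint_union_def[of "biset_product H Y X"])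
  next
    fix a g assume "a \<in> points ?U \<times> points X" "g \<in> carrier G"
    then show "\<exists>b\<in>points ?U \<times> points X.
        ract (biset_product H ?U X) (case a of (y, x) \<Rightarrow> balance_class H ?U X y x) g =
        (case b of (y, x) \<Rightarrow> balance_class H ?U X y x) \<and>
        ract (disjoint_union (biset_product H Y X) (biset_product H Y' X)) (t a) g = t b"
      by (intro bexI[of _ "(fst a, ract X (snd a) g)"]; cases a; cases "fst a")
        (auto simp: ract_biset_product[OF 1] ract_biset_product[OF 2] ract_biset_product[OF 3] U t_def
         bisetD(3)[OF X] disjoint_union_def[of "biset_product H Y X"])
  qed
qed

lemma biset_product_union_right:
  assumes X: "is_biset G H X" "is_biset G H X'" and Y: "is_biset H K Y"
    and grp: "group G" "group H" "group K"
  shows "biset_iso G K (biset_product H Y (disjoint_union X X'))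
    (disjoint_union (biset_product H Y X) (biset_product H Y X'))"
proof -
  let ?U = "disjoint_union X X'"
  note Z = disjoint_union_biset[OF X]
  note 1 = X(1) Y grp and 2 = X(2) Y grp and 3 = Z Y grp
  have U: "points ?U = points X <+> points X'" "\<And>h. lact ?U h = map_sum (lact X h) (lact X' h)"
    "\<And>z h. ract ?U z h = map_sum (\<lambda>y. ract X y h) (\<lambda>y. ract X' y h) z"
    by (simp_all add: disjoint_union_def)
  define t where "t = (\<lambda>(y, u). map_sum (\<lambda>x. balance_class H Y X y x) (\<lambda>x. balance_class H Y X' y x) u)"
  show ?thesis
  proof (rule biset_isoI[of "\<lambda>(y, x). balance_class H Y ?U y x" "points Y \<times> points ?U" _ t])
    show "(\<lambda>(y, x). balance_class H Y ?U y x) ` (points Y \<times> points ?U) = points (biset_product H Y ?U)"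
      by (simp add: points_biset_product[OF 3])
    have "points Y \<times> points ?U = apsnd Inl ` (points Y \<times> points X) \<union> apsnd Inr ` (points Y \<times> points X')"
      by (auto simp: U image_iff)
    then show "t ` (points Y \<times> points ?U) =
        points (disjoint_union (biset_product H Y X) (biset_product H Y X'))"
      by (simp add: disjoint_union_def points_biset_product[OF 1] points_biset_product[OF 2]
          Plus_def image_Un image_image case_prod_unfold t_def)
  next
    fix a b assume "a \<in> points Y \<times> points ?U" "b \<in> points Y \<times> points ?U"
    then obtain y x y' x' where "a = (y, x)" "b = (y', x')" "(y, x) \<in> points Y \<times> points ?U"
        "(y', x') \<in> points Y \<times> points ?U"
      by auto
    then show "((case a of (y, x) \<Rightarrow> balance_class H Y ?U y x) = (case b of (y, x) \<Rightarrow> balance_class H Y ?U y x)) =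
       (t a = t b)"
      by (cases x; cases x')
        (simp_all add: balance_class_eq[OF 1] balance_class_eq[OF 2] balance_class_eq[OF 3] U t_def Plus_def image_iff)
  next
    fix a h assume "a \<in> points Y \<times> points ?U" "h \<in> carrier K"
    then show "\<exists>b\<in>points Y \<times> points ?U.
        lact (biset_product H Y ?U) h (case a of (y, x) \<Rightarrow> balance_class H Y ?U y x) =
        (case b of (y, x) \<Rightarrow> balance_class H Y ?U y x) \<and>
        lact (disjoint_union (biset_product H Y X) (biset_product H Y X')) h (t a) = t b"
      by (intro bexI[of _ "(lact Y h (fst a), snd a)"]; cases a; cases "snd a")
        (auto simp: lact_biset_product[OF 1] lact_biset_product[OF 2] lact_biset_product[OF 3] U t_def
         bisetD(2)[OF Y] disjoint_union_def[of "biset_product H Y X"])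
  next
    fix a g assume "a \<in> points Y \<times> points ?U" "g \<in> carrier G"
    then show "\<exists>b\<in>points Y \<times> points ?U.
        ract (biset_product H Y ?U) (case a of (y, x) \<Rightarrow> balance_class H Y ?U y x) g =
        (case b of (y, x) \<Rightarrow> balance_class H Y ?U y x) \<and>
        ract (disjoint_union (biset_product H Y X) (biset_product H Y X')) (t a) g = t b"
      by (intro bexI[of _ "(fst a, ract ?U (snd a) g)"]; cases a; cases "snd a")
        (auto simp: ract_biset_product[OF 1] ract_biset_product[OF 2] ract_biset_product[OF 3] U t_def
         bisetD(3)[OF X(1)] bisetD(3)[OF X(2)] disjoint_union_def[of "biset_product H Y X"])
  qed
qed

lemma comp_class_biadditive:
  assumes grp: "group G" "group H" "group K"
  shows "biadditive (biset_monoid H K) (biset_monoid G H) (biset_monoid G K) (comp_class G H K)"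
  unfolding biadditive_def
proof (intro conjI ballI)
  fix c d assume "c \<in> carrier (biset_monoid H K)" "d \<in> carrier (biset_monoid G H)"
  then show "comp_class G H K c d \<in> carrier (biset_monoid G K)"
    by (elim biset_monoidE)
      (auto simp: comp_class_iso_class[OF _ _ grp] intro!: iso_class_closed biset_product_biset grp)
next
  fix c c' d assume "c \<in> carrier (biset_monoid H K)" "c' \<in> carrier (biset_monoid H K)"
    "d \<in> carrier (biset_monoid G H)"
  then show "comp_class G H K (c \<otimes>\<^bsub>biset_monoid H K\<^esub> c') d =
      comp_class G H K c d \<otimes>\<^bsub>biset_monoid G K\<^esub> comp_class G H K c' d"
    by (elim biset_monoidE)
      (simp add: comp_class_iso_class[OF _ _ grp] iso_class_mult disjoint_union_biset
        biset_product_biset[OF _ _ grp] iso_class_eq_iff biset_product_union_left[OF _ _ _ grp])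
next
  fix c d d' assume "c \<in> carrier (biset_monoid H K)" "d \<in> carrier (biset_monoid G H)"
    "d' \<in> carrier (biset_monoid G H)"
  then show "comp_class G H K c (d \<otimes>\<^bsub>biset_monoid G H\<^esub> d') =
      comp_class G H K c d \<otimes>\<^bsub>biset_monoid G K\<^esub> comp_class G H K c d'"
    by (elim biset_monoidE)
      (simp add: comp_class_iso_class[OF _ _ grp] iso_class_mult disjoint_union_biset
        biset_product_biset[OF _ _ grp] iso_class_eq_iff biset_product_union_right[OF _ _ _ grp])
qed

text \<open>Both sides are covered by triples \<open>(z, y, x)\<close>. Two triples \<open>(z, y, x)\<close> and \<open>(z', y', x')\<close> give the
same point on either side exactly if \<open>z = z' k\<close>, \<open>k y = y' h\<close> and \<open>x' = h x\<close> for some \<open>k\<close> and \<open>h\<close>.\<close>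

lemma biset_product_assoc:
  assumes X: "is_biset G H X" and Y: "is_biset H K Y" and Z: "is_biset K L Z"
    and grp: "group G" "group H" "group K" "group L"
  shows "biset_iso G L (biset_product H (biset_product K Z Y) X) (biset_product K Z (biset_product H Y X))"
proof -
  let ?ZY = "biset_product K Z Y" and ?YX = "biset_product H Y X"
  note yx = X Y grp(1-3) and zy = Y Z grp(2-4)
  note ZY = biset_product_biset[OF zy] and YX = biset_product_biset[OF yx]
  note l = X ZY grp(1,2,4) and r = YX Z grp(1,3,4)
  have pYX: "balance_class H Y X y x \<in> points ?YX" if "y \<in> points Y" "x \<in> points X" for y x
    using that by (auto simp: points_biset_product[OF yx])
  have pZY: "balance_class K Z Y z y \<in> points ?ZY" if "z \<in> points Z" "y \<in> points Y" for z y
    using that by (auto simp: points_biset_product[OF zy])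
  let ?A = "points Z \<times> points Y \<times> points X"
  define s where "s = (\<lambda>(z, y, x). balance_class H ?ZY X (balance_class K Z Y z y) x)"
  define t where "t = (\<lambda>(z, y, x). balance_class K Z ?YX z (balance_class H Y X y x))"
  note acts = lact_biset_product[OF yx] ract_biset_product[OF yx] lact_biset_product[OF zy]
    ract_biset_product[OF zy] lact_biset_product[OF l] ract_biset_product[OF l]
    lact_biset_product[OF r] ract_biset_product[OF r]
  show ?thesis
  proof (rule biset_isoI[of s ?A _ t])
    have "s ` ?A = (\<lambda>(c, x). balance_class H ?ZY X c x) ` (points ?ZY \<times> points X)"
      unfolding points_biset_product[OF zy] s_def by force
    then show "s ` ?A = points (biset_product H ?ZY X)"
      by (simp add: points_biset_product[OF l])
    have "t ` ?A = (\<lambda>(z, c). balance_class K Z ?YX z c) ` (points Z \<times> points ?YX)"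
      unfolding points_biset_product[OF yx] t_def by force
    then show "t ` ?A = points (biset_product K Z ?YX)"
      by (simp add: points_biset_product[OF r])
  next
    fix a b assume "a \<in> ?A" "b \<in> ?A"
    then obtain z y x z' y' x' where ab: "a = (z, y, x)" "b = (z', y', x')"
      and p: "z \<in> points Z" "y \<in> points Y" "x \<in> points X" "z' \<in> points Z" "y' \<in> points Y" "x' \<in> points X"
      by auto
    have "s a = s b \<longleftrightarrow> (\<exists>h\<in>carrier H. \<exists>k\<in>carrier K.
        z = ract Z z' k \<and> ract Y y' h = lact Y k y \<and> x' = lact X h x)"
      using p by (auto simp: ab s_def balance_class_eq[OF l] balance_class_eq[OF zy] pZY acts
          bisetD(3)[OF Y])
    moreover have "t a = t b \<longleftrightarrow> (\<exists>k\<in>carrier K. \<exists>h\<in>carrier H.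
        z = ract Z z' k \<and> lact Y k y = ract Y y' h \<and> x' = lact X h x)"
      using p by (auto simp: ab t_def balance_class_eq[OF r] pYX acts
          eq_commute[of "balance_class H Y X y' x'"] balance_class_eq[OF yx] bisetD(2)[OF Y])
    ultimately show "s a = s b \<longleftrightarrow> t a = t b"
      by (auto simp: eq_commute)
  next
    fix a h assume "a \<in> ?A" "h \<in> carrier L"
    then show "\<exists>b\<in>?A. lact (biset_product H ?ZY X) h (s a) = s b \<and> lact (biset_product K Z ?YX) h (t a) = t b"
      by (cases a, intro bexI[of _ "(lact Z h (fst a), snd a)"])
        (auto simp: s_def t_def acts pYX pZY bisetD(2)[OF Z])
  next
    fix a g assume "a \<in> ?A" "g \<in> carrier G"
    then show "\<exists>b\<in>?A. ract (biset_product H ?ZY X) (s a) g = s b \<and> ract (biset_product K Z ?YX) (t a) g = t b"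
      by (cases a, intro bexI[of _ "(fst a, fst (snd a), ract X (snd (snd a)) g)"])
        (auto simp: s_def t_def acts pYX pZY bisetD(3)[OF X])
  qed
qed

section \<open>Composition of localized classes of bisets\<close>

lemma biadditive_diff_left:
  assumes "biadditive L M N c" "comm_group L" "comm_group N"
    and "x \<in> carrier L" "y \<in> carrier L" "b \<in> carrier M"
  shows "c (x \<otimes>\<^bsub>L\<^esub> inv\<^bsub>L\<^esub> y) b = c x b \<otimes>\<^bsub>N\<^esub> inv\<^bsub>N\<^esub> c y b"
proof -
  interpret L: comm_group L by fact
  interpret N: comm_group N by fact
  have "c x b = c (x \<otimes>\<^bsub>L\<^esub> inv\<^bsub>L\<^esub> y) b \<otimes>\<^bsub>N\<^esub> c y b"
    using biadditive_left[OF assms(1), of "x \<otimes>\<^bsub>L\<^esub> inv\<^bsub>L\<^esub> y" y b] assms(4-6) by (simp add: L.m_assoc)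
  then show ?thesis
    using biadditive_closed[OF assms(1)] assms(4-6) by (simp add: N.m_assoc)
qed

lemma biadditive_diff_right:
  assumes "biadditive L M N c" "comm_group M" "comm_group N"
    and "b \<in> carrier L" "x \<in> carrier M" "y \<in> carrier M"
  shows "c b (x \<otimes>\<^bsub>M\<^esub> inv\<^bsub>M\<^esub> y) = c b x \<otimes>\<^bsub>N\<^esub> inv\<^bsub>N\<^esub> c b y"
proof -
  interpret M: comm_group M by fact
  interpret N: comm_group N by fact
  have "c b x = c b (x \<otimes>\<^bsub>M\<^esub> inv\<^bsub>M\<^esub> y) \<otimes>\<^bsub>N\<^esub> c b y"
    using biadditive_right[OF assms(1), of b "x \<otimes>\<^bsub>M\<^esub> inv\<^bsub>M\<^esub> y" y] assms(4-6) by (simp add: M.m_assoc)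
  then show ?thesis
    using biadditive_closed[OF assms(1)] assms(4-6) by (simp add: N.m_assoc)
qed

lemma biadditive_one:
  assumes "biadditive L M N c" "comm_group L" "comm_group M" "comm_group N"
  shows "b \<in> carrier M \<Longrightarrow> c \<one>\<^bsub>L\<^esub> b = \<one>\<^bsub>N\<^esub>" "a \<in> carrier L \<Longrightarrow> c a \<one>\<^bsub>M\<^esub> = \<one>\<^bsub>N\<^esub>"
proof -
  interpret L: comm_group L by fact
  interpret M: comm_group M by fact
  interpret N: comm_group N by fact
  show "b \<in> carrier M \<Longrightarrow> c \<one>\<^bsub>L\<^esub> b = \<one>\<^bsub>N\<^esub>"
    using biadditive_diff_left[OF assms(1,2,4), of "\<one>\<^bsub>L\<^esub>" "\<one>\<^bsub>L\<^esub>" b] biadditive_closed[OF assms(1)] by simp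
  show "a \<in> carrier L \<Longrightarrow> c a \<one>\<^bsub>M\<^esub> = \<one>\<^bsub>N\<^esub>"
    using biadditive_diff_right[OF assms(1,3,4), of a "\<one>\<^bsub>M\<^esub>" "\<one>\<^bsub>M\<^esub>"] biadditive_closed[OF assms(1)] by simp
qed

lemma burnside_comm_group: "comm_group (burnside_group G H)"
  unfolding burnside_group_def by (intro comm_monoid.groth_comm_group biset_comm_monoid)

lemma burnside_class_closed: "is_biset G H X \<Longrightarrow> burnside_class G H X \<in> carrier (burnside_group G H)"
  using iso_class_closed[of G H X] comm_monoid.axioms(1)[OF biset_comm_monoid[of G H]]
  by (auto simp: burnside_class_def burnside_group_def carrier_groth_group monoid.one_closed)

lemma burnside_class_union:
  assumes "is_biset G H X" "is_biset G H Y"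
  shows "burnside_class G H (disjoint_union X Y) =
    burnside_class G H X \<otimes>\<^bsub>burnside_group G H\<^esub> burnside_class G H Y"
proof -
  interpret comm_monoid "biset_monoid G H" by (rule biset_comm_monoid)
  show ?thesis
    using assms by (simp add: burnside_class_def burnside_group_def groth_mult iso_class_mult iso_class_closed)
qed

lemma burnside_class_iso:
  "is_biset G H X \<Longrightarrow> is_biset G H Y \<Longrightarrow> biset_iso G H X Y \<Longrightarrow> burnside_class G H X = burnside_class G H Y"
  using iso_class_eq_iff[of G H X Y] by (simp add: burnside_class_def)

lemma burnside_groupE:
  assumes "a \<in> carrier (burnside_group G H)"
  obtains X Y :: "('g, 'h, nat) biset"
  where "is_biset G H X" "is_biset G H Y"
    "burnside_class G H X = a \<otimes>\<^bsub>burnside_group G H\<^esub> burnside_class G H Y"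
proof -
  interpret comm_monoid "biset_monoid G H" by (rule biset_comm_monoid)
  from assms obtain c d where cd: "c \<in> carrier (biset_monoid G H)" "d \<in> carrier (biset_monoid G H)"
    "a = groth_class (biset_monoid G H) (c, d)"
    unfolding burnside_group_def by (rule groth_groupE)
  then obtain X Y :: "('g, 'h, nat) biset" where X: "is_biset G H X" "c = iso_class G H X"
      and Y: "is_biset G H Y" "d = iso_class G H Y"
    by (auto elim!: biset_monoidE)
  have "groth_class (biset_monoid G H) (c \<otimes>\<^bsub>biset_monoid G H\<^esub> d, d) =
      groth_class (biset_monoid G H) (c, \<one>\<^bsub>biset_monoid G H\<^esub>)"
    using cd by (intro groth_class_eqI[of _ _ _ _ "\<one>\<^bsub>biset_monoid G H\<^esub>"]) auto
  then have "burnside_class G H X = a \<otimes>\<^bsub>burnside_group G H\<^esub> burnside_class G H Y"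
    using cd X Y by (simp add: burnside_class_def burnside_group_def groth_mult)
  then show thesis using that X Y by blast
qed

lemma one_biset_monoid: "\<one>\<^bsub>biset_monoid G H\<^esub> = iso_class G H empty_biset"
  by (simp add: biset_monoid_def)

lemma iso_class_empty:
  assumes "is_biset G H X" "points X = {}"
  shows "iso_class G H X = \<one>\<^bsub>biset_monoid G H\<^esub>"
proof -
  have "biset_iso G H X empty_biset"
    using assms(2) by (simp add: biset_iso_def empty_biset_def bij_betw_def)
  then show ?thesis
    using assms(1) by (simp add: one_biset_monoid iso_class_eq_iff empty_biset)
qed

lemma comp_burnside_biadditive:
  assumes "group G" "group H" "group K"
  shows "biadditive (burnside_group H K) (burnside_group G H) (burnside_group G K) (comp_burnside G H K)"
proof -
  have eq: "comp_burnside G H K = groth_extend (biset_monoid G K) (comp_class G H K)"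
    by (intro ext) (simp add: comp_burnside_def groth_extend_def)
  show ?thesis
    unfolding burnside_group_def eq
    by (intro groth_extend_biadditive biset_comm_monoid comp_class_biadditive assms)
qed

lemma comp_burnside_class:
  assumes X: "is_biset G H X" and Y: "is_biset H K Y" and grp: "group G" "group H" "group K"
  shows "comp_burnside G H K (burnside_class H K Y) (burnside_class G H X) =
    burnside_class G K (biset_product H Y X)"
proof -
  interpret GH: comm_monoid "biset_monoid G H" by (rule biset_comm_monoid)
  interpret HK: comm_monoid "biset_monoid H K" by (rule biset_comm_monoid)
  interpret GK: comm_monoid "biset_monoid G K" by (rule biset_comm_monoid)
  have eq: "comp_burnside G H K = groth_extend (biset_monoid G K) (comp_class G H K)"
    by (intro ext) (simp add: comp_burnside_def groth_extend_def)
  note bi = comp_class_biadditive[OF grp]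
  have x: "iso_class G H X \<in> carrier (biset_monoid G H)" and y: "iso_class H K Y \<in> carrier (biset_monoid H K)"
    using X Y by (simp_all add: iso_class_closed)
  note cl = biadditive_closed[OF bi]
  have empty: "points (biset_product H V empty_biset) = {}" "points (biset_product H empty_biset W) = {}" for V W
    by (simp_all add: biset_product_def empty_biset_def quotient_def)
  have one: "comp_class G H K c \<one>\<^bsub>biset_monoid G H\<^esub> = \<one>\<^bsub>biset_monoid G K\<^esub>"
    if "c \<in> carrier (biset_monoid H K)" for c
    using that
    by (elim biset_monoidE) (simp add: empty_biset comp_class_iso_class[OF empty_biset _ grp]
        biset_product_biset[OF empty_biset _ grp] one_biset_monoid[of G H] one_biset_monoid[of H K] iso_class_empty empty)
  have one': "comp_class G H K \<one>\<^bsub>biset_monoid H K\<^esub> c = \<one>\<^bsub>biset_monoid G K\<^esub>"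
    if "c \<in> carrier (biset_monoid G H)" for c
    using that
    by (elim biset_monoidE) (simp add: empty_biset comp_class_iso_class[OF _ empty_biset grp]
        biset_product_biset[OF _ empty_biset grp] one_biset_monoid[of G H] one_biset_monoid[of H K] iso_class_empty empty)
  have "comp_burnside G H K (burnside_class H K Y) (burnside_class G H X) =
      groth_class (biset_monoid G K)
       (comp_class G H K (iso_class H K Y) (iso_class G H X) \<otimes>\<^bsub>biset_monoid G K\<^esub>
          comp_class G H K \<one>\<^bsub>biset_monoid H K\<^esub> \<one>\<^bsub>biset_monoid G H\<^esub>,
        comp_class G H K (iso_class H K Y) \<one>\<^bsub>biset_monoid G H\<^esub> \<otimes>\<^bsub>biset_monoid G K\<^esub>
          comp_class G H K \<one>\<^bsub>biset_monoid H K\<^esub> (iso_class G H X))"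
    unfolding eq burnside_class_def using x y
    by (intro groth_extend_classes biset_comm_monoid bi) auto
  also have "\<dots> = burnside_class G K (biset_product H Y X)"
    using x y by (simp add: one one' cl comp_class_iso_class[OF X Y grp] burnside_class_def
        iso_class_closed biset_product_biset[OF X Y grp])
  finally show ?thesis .
qed


text \<open>The element \<open>r X\<close> of the localized module. These elements generate it, and all computations
below are reduced to them.\<close>

definition scaled_biset ::
    "nat \<Rightarrow> ('g, 'm) monoid_scheme \<Rightarrow> ('h, 'n) monoid_scheme \<Rightarrow> rat \<Rightarrow> ('g, 'h, 'x) biset \<Rightarrow>
      ('g, 'h) burnside_loc"
  where "scaled_biset p G H r X = burnside_loc_class p G H (frag_of (burnside_class G H X, r))"

context
  fixes p :: nat
  assumes p: "prime p"
begin

lemma Z_loc_of_int: "of_int a \<in> Z_loc p"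
  unfolding Z_loc_def using p
  by (intro CollectI exI[of _ a] exI[of _ 1]) (simp add: prime_nat_iff)

lemma Z_loc_denominators: "\<not> int p dvd b \<Longrightarrow> \<not> int p dvd b' \<Longrightarrow> \<not> int p dvd b * b'"
  using p by (simp add: prime_dvd_mult_iff)

lemma Z_loc_nonzero: "\<not> int p dvd b \<Longrightarrow> of_int b \<noteq> (0::rat)"
  by auto

lemma Z_loc_add:
  assumes "r \<in> Z_loc p" "s \<in> Z_loc p" shows "r + s \<in> Z_loc p"
proof -
  from assms obtain a b c d where "r = of_int a / of_int b" "s = of_int c / of_int d"
    "\<not> int p dvd b" "\<not> int p dvd d" by (auto simp: Z_loc_def)
  then have "r + s = of_int (a * d + c * b) / of_int (b * d)"
    using Z_loc_nonzero by (simp add: add_frac_eq)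
  then show ?thesis
    using Z_loc_denominators \<open>\<not> int p dvd b\<close> \<open>\<not> int p dvd d\<close> unfolding Z_loc_def by blast
qed

lemma Z_loc_mult:
  assumes "r \<in> Z_loc p" "s \<in> Z_loc p" shows "r * s \<in> Z_loc p"
proof -
  from assms obtain a b c d where "r = of_int a / of_int b" "s = of_int c / of_int d"
    "\<not> int p dvd b" "\<not> int p dvd d" by (auto simp: Z_loc_def)
  then have "r * s = of_int (a * c) / of_int (b * d)"
    by simp
  then show ?thesis
    using Z_loc_denominators \<open>\<not> int p dvd b\<close> \<open>\<not> int p dvd d\<close> unfolding Z_loc_def by blast
qed

lemma Z_loc_minus: "r \<in> Z_loc p \<Longrightarrow> - r \<in> Z_loc p"
  using Z_loc_mult[OF Z_loc_of_int[of "- 1"]] by simp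

lemma Z_loc_comm_group: "comm_group (Z_loc_group p)"
proof (rule comm_groupI)
  fix r assume "r \<in> carrier (Z_loc_group p)"
  then show "\<exists>s\<in>carrier (Z_loc_group p). s \<otimes>\<^bsub>Z_loc_group p\<^esub> r = \<one>\<^bsub>Z_loc_group p\<^esub>"
    by (intro bexI[of _ "- r"]) (auto simp: Z_loc_group_def Z_loc_minus)
qed (use Z_loc_of_int[of 0] in \<open>auto simp: Z_loc_group_def Z_loc_add\<close>)

lemma carrier_Z_loc_group: "carrier (Z_loc_group p) = Z_loc p"
  by (simp add: Z_loc_group_def)

lemma Z_loc_biadditive: "biadditive (Z_loc_group p) (Z_loc_group p) (Z_loc_group p) (*)"
  by (auto simp: biadditive_def Z_loc_group_def Z_loc_mult algebra_simps)

lemma burnside_loc_comm_group: "comm_group (burnside_loc p G H)"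
  unfolding burnside_loc_def by (intro tensor_comm_group burnside_comm_group Z_loc_comm_group)

lemma scaled_biset_closed:
  "is_biset G H X \<Longrightarrow> r \<in> Z_loc p \<Longrightarrow> scaled_biset p G H r X \<in> carrier (burnside_loc p G H)"
  unfolding scaled_biset_def burnside_loc_def
  by (intro pure_tensor_closed burnside_class_closed) (simp_all add: Z_loc_group_def)

lemma scaled_biset_iso:
  "is_biset G H X \<Longrightarrow> is_biset G H Y \<Longrightarrow> biset_iso G H X Y \<Longrightarrow> scaled_biset p G H r X = scaled_biset p G H r Y"
  using burnside_class_iso[of G H X Y] by (simp add: scaled_biset_def)

lemma scaled_biset_union:
  assumes "is_biset G H X" "is_biset G H Y" "r \<in> Z_loc p"
  shows "scaled_biset p G H r (disjoint_union X Y) =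
    scaled_biset p G H r X \<otimes>\<^bsub>burnside_loc p G H\<^esub> scaled_biset p G H r Y"
  unfolding scaled_biset_def burnside_loc_def burnside_class_union[OF assms(1,2)]
  by (intro pure_tensor_left burnside_class_closed burnside_comm_group Z_loc_comm_group assms(1,2))
    (simp add: Z_loc_group_def assms(3))

lemma scaled_biset_add:
  assumes "is_biset G H X" "r \<in> Z_loc p" "s \<in> Z_loc p"
  shows "scaled_biset p G H (r + s) X =
    scaled_biset p G H r X \<otimes>\<^bsub>burnside_loc p G H\<^esub> scaled_biset p G H s X"
  using pure_tensor_right[OF burnside_comm_group[of G H] Z_loc_comm_group burnside_class_closed[OF assms(1)],
      of r s] assms(2,3)
  by (simp add: scaled_biset_def burnside_loc_def Z_loc_group_def)

text \<open>A pure tensor with a virtual biset is a difference of two elements \<open>r X\<close>, so the actual bisets,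
scaled by \<open>r\<close>, suffice as generators.\<close>

lemma burnside_loc_induct [consumes 1, case_names one scaled_biset diff]:
  assumes x: "x \<in> carrier (burnside_loc p G H)"
    and one: "P \<one>\<^bsub>burnside_loc p G H\<^esub>"
    and gen: "\<And>(X :: ('g, 'h, nat) biset) r. is_biset G H X \<Longrightarrow> r \<in> Z_loc p \<Longrightarrow> P (scaled_biset p G H r X)"
    and diff: "\<And>x y. x \<in> carrier (burnside_loc p G H) \<Longrightarrow> y \<in> carrier (burnside_loc p G H) \<Longrightarrow>
      P x \<Longrightarrow> P y \<Longrightarrow> P (x \<otimes>\<^bsub>burnside_loc p G H\<^esub> inv\<^bsub>burnside_loc p G H\<^esub> y)"
  shows "P x"
  using burnside_comm_group[of G H] Z_loc_comm_group x[unfolded burnside_loc_def]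
proof (induction rule: tensor_group_induct)
  case one
  then show ?case using assms(2) by (simp add: burnside_loc_def)
next
  case (diff x y)
  then show ?case using assms(4) by (simp add: burnside_loc_def)
next
  case (pure a r)
  interpret comm_group "burnside_loc p G H" by (rule burnside_loc_comm_group)
  obtain X Y :: "('g, 'h, nat) biset" where X: "is_biset G H X" and Y: "is_biset G H Y"
    and a: "burnside_class G H X = a \<otimes>\<^bsub>burnside_group G H\<^esub> burnside_class G H Y"
    using pure(1) by (rule burnside_groupE)
  let ?t = "pure_tensor (burnside_group G H) (Z_loc_group p) a r"
  have r: "r \<in> Z_loc p"
    using pure(2) by (simp add: Z_loc_group_def)
  have t: "?t \<in> carrier (burnside_loc p G H)"
    unfolding burnside_loc_def by (intro pure_tensor_closed pure)
  have "scaled_biset p G H r X = ?t \<otimes>\<^bsub>burnside_loc p G H\<^esub> scaled_biset p G H r Y"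
    unfolding scaled_biset_def a burnside_loc_def
    by (intro pure_tensor_left burnside_comm_group Z_loc_comm_group burnside_class_closed pure Y)
  then have "?t = scaled_biset p G H r X \<otimes>\<^bsub>burnside_loc p G H\<^esub> inv\<^bsub>burnside_loc p G H\<^esub> scaled_biset p G H r Y"
    using t scaled_biset_closed[OF Y r] by (simp add: m_assoc)
  then show ?case
    using diff[OF scaled_biset_closed[OF X r] scaled_biset_closed[OF Y r] gen[OF X r] gen[OF Y r]] by simp
qed

lemma biset_comp_eq: "biset_comp p G H K = tensor_extend (burnside_group G K) (Z_loc_group p) (comp_burnside G H K) (*)"
  by (intro ext) (simp add: biset_comp_def tensor_extend_def)

lemma biset_comp_biadditive:
  assumes "group G" "group H" "group K"
  shows "biadditive (burnside_loc p H K) (burnside_loc p G H) (burnside_loc p G K) (biset_comp p G H K)"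
  unfolding biset_comp_eq burnside_loc_def
  by (intro tensor_extend burnside_comm_group Z_loc_comm_group Z_loc_biadditive comp_burnside_biadditive assms)

context
  fixes G :: "('g, 'm) monoid_scheme" and H :: "('h, 'n) monoid_scheme" and K :: "('k, 'l) monoid_scheme"
  assumes grp: "group G" "group H" "group K"
begin

lemma biset_comp_closed:
  "y \<in> carrier (burnside_loc p H K) \<Longrightarrow> x \<in> carrier (burnside_loc p G H) \<Longrightarrow>
    biset_comp p G H K y x \<in> carrier (burnside_loc p G K)"
  by (rule biadditive_closed[OF biset_comp_biadditive[OF grp]])

lemma biset_comp_mult_left:
  "y \<in> carrier (burnside_loc p H K) \<Longrightarrow> y' \<in> carrier (burnside_loc p H K) \<Longrightarrow> x \<in> carrier (burnside_loc p G H) \<Longrightarrow>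
    biset_comp p G H K (y \<otimes>\<^bsub>burnside_loc p H K\<^esub> y') x =
      biset_comp p G H K y x \<otimes>\<^bsub>burnside_loc p G K\<^esub> biset_comp p G H K y' x"
  by (rule biadditive_left[OF biset_comp_biadditive[OF grp]])

lemma biset_comp_mult_right:
  "y \<in> carrier (burnside_loc p H K) \<Longrightarrow> x \<in> carrier (burnside_loc p G H) \<Longrightarrow> x' \<in> carrier (burnside_loc p G H) \<Longrightarrow>
    biset_comp p G H K y (x \<otimes>\<^bsub>burnside_loc p G H\<^esub> x') =
      biset_comp p G H K y x \<otimes>\<^bsub>burnside_loc p G K\<^esub> biset_comp p G H K y x'"
  by (rule biadditive_right[OF biset_comp_biadditive[OF grp]])

lemma biset_comp_diff_left:
  "y \<in> carrier (burnside_loc p H K) \<Longrightarrow> y' \<in> carrier (burnside_loc p H K) \<Longrightarrow> x \<in> carrier (burnside_loc p G H) \<Longrightarrow>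
    biset_comp p G H K (y \<otimes>\<^bsub>burnside_loc p H K\<^esub> inv\<^bsub>burnside_loc p H K\<^esub> y') x =
      biset_comp p G H K y x \<otimes>\<^bsub>burnside_loc p G K\<^esub> inv\<^bsub>burnside_loc p G K\<^esub> biset_comp p G H K y' x"
  by (rule biadditive_diff_left[OF biset_comp_biadditive[OF grp]]) (rule burnside_loc_comm_group)+

lemma biset_comp_diff_right:
  "y \<in> carrier (burnside_loc p H K) \<Longrightarrow> x \<in> carrier (burnside_loc p G H) \<Longrightarrow> x' \<in> carrier (burnside_loc p G H) \<Longrightarrow>
    biset_comp p G H K y (x \<otimes>\<^bsub>burnside_loc p G H\<^esub> inv\<^bsub>burnside_loc p G H\<^esub> x') =
      biset_comp p G H K y x \<otimes>\<^bsub>burnside_loc p G K\<^esub> inv\<^bsub>burnside_loc p G K\<^esub> biset_comp p G H K y x'"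
  by (rule biadditive_diff_right[OF biset_comp_biadditive[OF grp]]) (rule burnside_loc_comm_group)+

lemma biset_comp_one:
  "x \<in> carrier (burnside_loc p G H) \<Longrightarrow> biset_comp p G H K \<one>\<^bsub>burnside_loc p H K\<^esub> x = \<one>\<^bsub>burnside_loc p G K\<^esub>"
  "y \<in> carrier (burnside_loc p H K) \<Longrightarrow> biset_comp p G H K y \<one>\<^bsub>burnside_loc p G H\<^esub> = \<one>\<^bsub>burnside_loc p G K\<^esub>"
  by (simp_all add: biadditive_one[OF biset_comp_biadditive[OF grp]] burnside_loc_comm_group)

end

lemma biset_comp_scaled:
  assumes "is_biset G H X" "is_biset H K Y" "group G" "group H" "group K" "r \<in> Z_loc p" "s \<in> Z_loc p"
  shows "biset_comp p G H K (scaled_biset p H K r Y) (scaled_biset p G H s X) =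
    scaled_biset p G K (r * s) (biset_product H Y X)"
  unfolding biset_comp_eq scaled_biset_def
  by (subst tensor_extend(2)[where A = "burnside_group H K" and B = "burnside_group G H"
        and X = "Z_loc_group p" and Y = "Z_loc_group p"])
    (use assms in \<open>simp_all add: burnside_comm_group Z_loc_comm_group Z_loc_biadditive
      comp_burnside_biadditive burnside_class_closed comp_burnside_class carrier_Z_loc_group\<close>)

text \<open>All maps involved are additive in each argument, so the identity follows from the one for
bisets.\<close>

lemma biset_comp_assoc:
  assumes grp: "group G" "group H" "group K" "group L"
    and x: "x \<in> carrier (burnside_loc p G H)" and y: "y \<in> carrier (burnside_loc p H K)"
    and z: "z \<in> carrier (burnside_loc p K L)"
  shows "biset_comp p G H L (biset_comp p H K L z y) x = biset_comp p G K L z (biset_comp p G H K y x)"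
proof -
  note cl = biset_comp_closed and o = biset_comp_one and dl = biset_comp_diff_left and dr = biset_comp_diff_right
  from z show ?thesis
  proof (induction rule: burnside_loc_induct)
    case one then show ?case using x y by (simp add: o cl grp)
  next
    case (diff z z') then show ?case using x y by (simp add: dl cl grp)
  next
    case (scaled_biset Z r)
    note Z = this
    note cZ = scaled_biset_closed[OF Z]
    from y show ?case
    proof (induction rule: burnside_loc_induct)
      case one then show ?case using x cZ by (simp add: o cl grp)
    next
      case (diff z z') then show ?case using x cZ by (simp add: dl dr cl grp)
    next
      case (scaled_biset Y s)
      note Y = this
      note cY = scaled_biset_closed[OF Y]
      from x show ?case
      proof (induction rule: burnside_loc_induct)
        case one then show ?case using cY cZ by (simp add: o cl grp)
      next
        case (diff z z') then show ?case using cY cZ by (simp add: dr cl grp)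
      next
        case (scaled_biset X t)
        note X = this
        show ?case using X Y Z grp
          by (simp add: biset_comp_scaled biset_product_biset Z_loc_mult mult.assoc)
            (intro scaled_biset_iso biset_product_biset biset_product_assoc; assumption)
      qed
    qed
  qed
qed

end

section \<open>Transitive bisets\<close>

text \<open>The point \<open>[h, g]\<close> of \<open>H \<times>\<^sub>U G\<close>, in which \<open>(h \<phi>(u), g)\<close> and \<open>(h, u g)\<close> are identified. The inverse
accounts for the convention that the right action of \<open>g\<close> on cosets is multiplication by \<open>g\<^sup>-\<^sup>1\<close> from the left.\<close>

definition coset_point ::
    "('g, 'm) monoid_scheme \<Rightarrow> ('h, 'n) monoid_scheme \<Rightarrow> 'g set \<Rightarrow> ('g \<Rightarrow> 'h) \<Rightarrow> 'h \<Rightarrow> 'g \<Rightarrow> ('h \<times> 'g) set"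
  where "coset_point G H U \<phi> h g = (h, inv\<^bsub>G\<^esub> g) <#\<^bsub>H \<times>\<times> G\<^esub> twisted_diagonal U \<phi>"

context
  fixes G :: "('g, 'm) monoid_scheme" and H :: "('h, 'n) monoid_scheme"
    and U :: "'g set" and \<phi> :: "'g \<Rightarrow> 'h"
  assumes G: "group G" and H: "group H" and fin: "finite (carrier G)" "finite (carrier H)"
    and U: "subgroup U G" and \<phi>: "\<phi> \<in> hom (G\<lparr>carrier := U\<rparr>) H"
begin

interpretation G: group G by (rule G)
interpretation H: group H by (rule H)
interpretation U: subgroup U G by (rule U)
interpretation HG: group "H \<times>\<times> G" by (rule DirProd_group[OF H G])
interpretation \<phi>: group_hom "G\<lparr>carrier := U\<rparr>" H \<phi>
  using \<phi> U.subgroup_is_group[OF G] H by (auto simp: group_hom_def group_hom_axioms_def)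

lemma subgroup_hom: "u \<in> U \<Longrightarrow> \<phi> u \<in> carrier H" "u \<in> U \<Longrightarrow> v \<in> U \<Longrightarrow> \<phi> (u \<otimes>\<^bsub>G\<^esub> v) = \<phi> u \<otimes>\<^bsub>H\<^esub> \<phi> v"
    "\<phi> \<one>\<^bsub>G\<^esub> = \<one>\<^bsub>H\<^esub>" "u \<in> U \<Longrightarrow> \<phi> (inv\<^bsub>G\<^esub> u) = inv\<^bsub>H\<^esub> \<phi> u"
  using \<phi>.hom_closed[of u] \<phi>.hom_mult[of u v] \<phi>.hom_one \<phi>.hom_inv[of u] G.m_inv_consistent[OF U, of u]
  by simp_all

lemma twisted_diagonal_subgroup: "subgroup (twisted_diagonal U \<phi>) (H \<times>\<times> G)"
proof (rule HG.subgroupI)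
  show "twisted_diagonal U \<phi> \<subseteq> carrier (H \<times>\<times> G)"
    using U.subset subgroup_hom by (auto simp: twisted_diagonal_def)
  show "twisted_diagonal U \<phi> \<noteq> {}"
    unfolding twisted_diagonal_def using U.one_closed by blast
  show "inv\<^bsub>H \<times>\<times> G\<^esub> a \<in> twisted_diagonal U \<phi>" if "a \<in> twisted_diagonal U \<phi>" for a
  proof -
    from that obtain u where u: "u \<in> U" "a = (\<phi> u, u)" by (auto simp: twisted_diagonal_def)
    then have "inv\<^bsub>H \<times>\<times> G\<^esub> a = (\<phi> (inv\<^bsub>G\<^esub> u), inv\<^bsub>G\<^esub> u)"
      using inv_DirProd[OF H G, of "\<phi> u" u] subgroup_hom by simp
    then show ?thesis
      using u by (auto simp: twisted_diagonal_def)
  qed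
  show "a \<otimes>\<^bsub>H \<times>\<times> G\<^esub> b \<in> twisted_diagonal U \<phi>"
    if "a \<in> twisted_diagonal U \<phi>" "b \<in> twisted_diagonal U \<phi>" for a b
  proof -
    from that obtain u v where u: "u \<in> U" "v \<in> U" "a = (\<phi> u, u)" "b = (\<phi> v, v)"
      by (auto simp: twisted_diagonal_def)
    then have "a \<otimes>\<^bsub>H \<times>\<times> G\<^esub> b = (\<phi> (u \<otimes>\<^bsub>G\<^esub> v), u \<otimes>\<^bsub>G\<^esub> v)"
      using subgroup_hom by simp
    then show ?thesis
      using u by (auto simp: twisted_diagonal_def)
  qed
qed

lemma coset_point_iff:
  assumes "h \<in> carrier H" "g \<in> carrier G" "h' \<in> carrier H" "g' \<in> carrier G"
  shows "coset_point G H U \<phi> h g = coset_point G H U \<phi> h' g' \<longleftrightarrow>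
    (\<exists>u\<in>U. h' = h \<otimes>\<^bsub>H\<^esub> \<phi> u \<and> g = u \<otimes>\<^bsub>G\<^esub> g')"
proof -
  have inv: "inv\<^bsub>G\<^esub> g' = inv\<^bsub>G\<^esub> g \<otimes>\<^bsub>G\<^esub> u \<longleftrightarrow> g = u \<otimes>\<^bsub>G\<^esub> g'" if "u \<in> U" for u
  proof -
    have u: "u \<in> carrier G" using that by simp
    have "inv\<^bsub>G\<^esub> g' = inv\<^bsub>G\<^esub> g \<otimes>\<^bsub>G\<^esub> u \<longleftrightarrow> g \<otimes>\<^bsub>G\<^esub> inv\<^bsub>G\<^esub> g' = u"
      using assms u by (metis G.inv_closed G.inv_solve_left)
    also have "\<dots> \<longleftrightarrow> g = u \<otimes>\<^bsub>G\<^esub> g'"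
      using assms u by (metis G.inv_solve_right' G.inv_closed G.inv_inv)
    finally show ?thesis .
  qed
  have car: "(h, inv\<^bsub>G\<^esub> g) \<in> carrier (H \<times>\<times> G)" "(h', inv\<^bsub>G\<^esub> g') \<in> carrier (H \<times>\<times> G)"
    using assms by simp_all
  have "coset_point G H U \<phi> h g = coset_point G H U \<phi> h' g' \<longleftrightarrow>
      (h', inv\<^bsub>G\<^esub> g') \<in> (h, inv\<^bsub>G\<^esub> g) <#\<^bsub>H \<times>\<times> G\<^esub> twisted_diagonal U \<phi>"
    unfolding coset_point_def
    using HG.l_repr_independence[OF _ car(1) twisted_diagonal_subgroup]
      HG.lcos_self[OF car(2) twisted_diagonal_subgroup] by blast
  also have "\<dots> \<longleftrightarrow> (\<exists>u\<in>U. h' = h \<otimes>\<^bsub>H\<^esub> \<phi> u \<and> inv\<^bsub>G\<^esub> g' = inv\<^bsub>G\<^esub> g \<otimes>\<^bsub>G\<^esub> u)"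
    by (auto simp: l_coset_def twisted_diagonal_def)
  finally show ?thesis
    using inv by blast
qed

lemma points_coset_biset:
  "points (coset_biset G H (twisted_diagonal U \<phi>)) =
    (\<lambda>(h, g). coset_point G H U \<phi> h g) ` (carrier H \<times> carrier G)"
proof -
  have "carrier H \<times> carrier G = (\<lambda>(h, g). (h, inv\<^bsub>G\<^esub> g)) ` (carrier H \<times> carrier G)"
  proof -
    have "x \<in> (\<lambda>(h, g). (h, inv\<^bsub>G\<^esub> g)) ` (carrier H \<times> carrier G)" if "x \<in> carrier H \<times> carrier G" for x
      using that by (intro image_eqI[of _ _ "(fst x, inv\<^bsub>G\<^esub> (snd x))"]) auto
    then show ?thesis by auto
  qed
  then have "points (coset_biset G H (twisted_diagonal U \<phi>)) =
      (\<lambda>x. x <#\<^bsub>H \<times>\<times> G\<^esub> twisted_diagonal U \<phi>) ` (\<lambda>(h, g). (h, inv\<^bsub>G\<^esub> g)) ` (carrier H \<times> carrier G)"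
    by (auto simp: coset_biset_def LCOSETS_def)
  then show ?thesis
    by (simp add: image_image case_prod_unfold coset_point_def)
qed

lemma lact_coset_biset:
  assumes "h \<in> carrier H" "h' \<in> carrier H" "g \<in> carrier G"
  shows "lact (coset_biset G H (twisted_diagonal U \<phi>)) h (coset_point G H U \<phi> h' g) =
    coset_point G H U \<phi> (h \<otimes>\<^bsub>H\<^esub> h') g"
  using assms HG.lcos_m_assoc[OF subgroup.subset[OF twisted_diagonal_subgroup], of "(h, \<one>\<^bsub>G\<^esub>)" "(h', inv\<^bsub>G\<^esub> g)"]
  by (simp add: coset_biset_def coset_point_def)

lemma ract_coset_biset:
  assumes "g \<in> carrier G" "h' \<in> carrier H" "g' \<in> carrier G"
  shows "ract (coset_biset G H (twisted_diagonal U \<phi>)) (coset_point G H U \<phi> h' g') g =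
    coset_point G H U \<phi> h' (g' \<otimes>\<^bsub>G\<^esub> g)"
  using assms HG.lcos_m_assoc[OF subgroup.subset[OF twisted_diagonal_subgroup], of "(\<one>\<^bsub>H\<^esub>, inv\<^bsub>G\<^esub> g)" "(h', inv\<^bsub>G\<^esub> g')"]
  by (simp add: coset_biset_def coset_point_def G.inv_mult_group)

lemma coset_point_in: "h \<in> carrier H \<Longrightarrow> g \<in> carrier G \<Longrightarrow>
    coset_point G H U \<phi> h g \<in> points (coset_biset G H (twisted_diagonal U \<phi>))"
  by (auto simp: points_coset_biset)

lemma coset_biset_biset: "is_biset G H (coset_biset G H (twisted_diagonal U \<phi>))"
  unfolding is_biset_def
proof (intro conjI ballI)
  show "finite (points (coset_biset G H (twisted_diagonal U \<phi>)))"
    using fin by (simp add: points_coset_biset)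
qed (auto simp: coset_point_in points_coset_biset[unfolded image_def] lact_coset_biset ract_coset_biset
    H.m_assoc G.m_assoc, (metis H.m_closed G.m_closed)+)

lemma coset_point_shift:
  assumes "h \<in> carrier H" "g \<in> carrier G" "u \<in> U"
  shows "coset_point G H U \<phi> (h \<otimes>\<^bsub>H\<^esub> \<phi> u) g = coset_point G H U \<phi> h (u \<otimes>\<^bsub>G\<^esub> g)"
  using assms subgroup_hom by (subst eq_commute, subst coset_point_iff) auto

lemma card_coset_biset:
  "card (points (coset_biset G H (twisted_diagonal U \<phi>))) * card U = card (carrier H) * card (carrier G)"
proof -
  have "card (twisted_diagonal U \<phi>) = card ((\<lambda>u. (\<phi> u, u)) ` U)"
    by (rule arg_cong[of _ _ card]) (auto simp: twisted_diagonal_def)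
  also have "\<dots> = card U"
    by (rule card_image) (auto simp: inj_on_def)
  finally show ?thesis
    using HG.l_lagrange[OF _ twisted_diagonal_subgroup] fin
    by (simp add: coset_biset_def order_def DirProd_def card_cartesian_product)
qed

end

text \<open>If the outer biset is induced along a homomorphism defined on all of \<open>H\<close>, the middle group
disappears from the composite: every point of the product can be written as \<open>[[k, 1], [1, g]]\<close>.
The Mackey formula in general would give a sum over double cosets.\<close>

lemma coset_biset_product:
  fixes G :: "('g, 'm) monoid_scheme" and H :: "('h, 'n) monoid_scheme" and K :: "('k, 'l) monoid_scheme"
  assumes grp: "group G" "group H" "group K"
    and fin: "finite (carrier G)" "finite (carrier H)" "finite (carrier K)"
    and V: "subgroup V G" and \<chi>: "\<chi> \<in> hom (G\<lparr>carrier := V\<rparr>) H" and \<phi>: "\<phi> \<in> hom H K"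
  shows "biset_iso G K
    (biset_product H (coset_biset H K (twisted_diagonal (carrier H) \<phi>)) (coset_biset G H (twisted_diagonal V \<chi>)))
    (coset_biset G K (twisted_diagonal V (\<phi> \<circ> \<chi>)))"
proof -
  interpret G: group G by fact
  interpret H: group H by fact
  interpret K: group K by fact
  interpret V: subgroup V G by fact
  have sub: "subgroup (carrier H) H" by (rule H.subgroup_self)
  have \<phi>': "\<phi> \<in> hom (H\<lparr>carrier := carrier H\<rparr>) K" using \<phi> by simp
  have \<phi>\<chi>: "\<phi> \<circ> \<chi> \<in> hom (G\<lparr>carrier := V\<rparr>) K"
    using \<chi> \<phi> by (auto simp: hom_def Pi_def)
  note outer = grp(2,3) fin(2,3) sub \<phi>' and inner = grp(1,2) fin(1,2) V \<chi>
    and whole = grp(1,3) fin(1,3) V \<phi>\<chi>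
  let ?Y = "coset_biset H K (twisted_diagonal (carrier H) \<phi>)" and ?X = "coset_biset G H (twisted_diagonal V \<chi>)"
  let ?W = "coset_biset G K (twisted_diagonal V (\<phi> \<circ> \<chi>))"
  note X = coset_biset_biset[OF inner] and Y = coset_biset_biset[OF outer]
  note prd = X Y grp
  define y where "y k = coset_point H K (carrier H) \<phi> k \<one>\<^bsub>H\<^esub>" for k
  define x where "x g = coset_point G H V \<chi> \<one>\<^bsub>H\<^esub> g" for g
  have y: "y k \<in> points ?Y" if "k \<in> carrier K" for k
    using that by (simp add: y_def coset_point_in[OF outer])
  have x: "x g \<in> points ?X" if "g \<in> carrier G" for g
    using that by (simp add: x_def coset_point_in[OF inner])
  note \<chi>_facts = subgroup_hom[OF inner] and \<phi>_facts = subgroup_hom[OF outer]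
  have y_ract: "ract ?Y (y k) h = y (k \<otimes>\<^bsub>K\<^esub> \<phi> h)" if "k \<in> carrier K" "h \<in> carrier H" for k h
    using that coset_point_shift[OF outer, of k "\<one>\<^bsub>H\<^esub>" h] by (simp add: y_def ract_coset_biset[OF outer])
  have y_lact: "lact ?Y k (y k') = y (k \<otimes>\<^bsub>K\<^esub> k')" if "k \<in> carrier K" "k' \<in> carrier K" for k k'
    using that by (simp add: y_def lact_coset_biset[OF outer])
  have x_ract: "ract ?X (x g) g' = x (g \<otimes>\<^bsub>G\<^esub> g')" if "g \<in> carrier G" "g' \<in> carrier G" for g g'
    using that by (simp add: x_def ract_coset_biset[OF inner])
  let ?A = "carrier K \<times> carrier G"
  define s where "s = (\<lambda>(k, g). balance_class H ?Y ?X (y k) (x g))"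
  define t where "t = (\<lambda>(k, g). coset_point G K V (\<phi> \<circ> \<chi>) k g)"
  show ?thesis
  proof (rule biset_isoI[of s ?A _ t])
    show "t ` ?A = points ?W"
      by (simp add: t_def points_coset_biset[OF whole])
    have "z \<in> s ` ?A" if "z \<in> points (biset_product H ?Y ?X)" for z
    proof -
      from that obtain k h h' g where c: "k \<in> carrier K" "h \<in> carrier H" "h' \<in> carrier H" "g \<in> carrier G"
        and z: "z = balance_class H ?Y ?X (coset_point H K (carrier H) \<phi> k h) (coset_point G H V \<chi> h' g)"
        by (auto simp: points_biset_product[OF prd] points_coset_biset[OF outer] points_coset_biset[OF inner])
      have "coset_point H K (carrier H) \<phi> k h = ract ?Y (y k) h"
        using c by (simp add: y_def ract_coset_biset[OF outer])
      moreover have "coset_point G H V \<chi> h' g = lact ?X h' (x g)"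
        using c by (simp add: x_def lact_coset_biset[OF inner])
      ultimately have "z = balance_class H ?Y ?X (ract ?Y (ract ?Y (y k) h) h') (x g)"
        using c z y x bisetD(3)[OF Y] by (simp add: balance_class_shift[OF prd])
      also have "\<dots> = s (k \<otimes>\<^bsub>K\<^esub> \<phi> h \<otimes>\<^bsub>K\<^esub> \<phi> h', g)"
        using c \<phi>_facts by (simp add: y_ract s_def)
      finally show ?thesis
        using c \<phi>_facts by blast
    qed
    moreover have "s a \<in> points (biset_product H ?Y ?X)" if "a \<in> ?A" for a
      using that y x by (auto simp: s_def points_biset_product[OF prd])
    ultimately show "s ` ?A = points (biset_product H ?Y ?X)"
      by blast
  next
    fix a b assume "a \<in> ?A" "b \<in> ?A"
    then obtain k g k' g' where ab: "a = (k, g)" "b = (k', g')"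
      and c: "k \<in> carrier K" "g \<in> carrier G" "k' \<in> carrier K" "g' \<in> carrier G"
      by auto
    have yeq: "y k = y k' \<longleftrightarrow> k = k'" if "k \<in> carrier K" "k' \<in> carrier K" for k k'
      using that \<phi>_facts by (auto simp: y_def coset_point_iff[OF outer])
    have "s a = s b \<longleftrightarrow> (\<exists>h\<in>carrier H. k = k' \<otimes>\<^bsub>K\<^esub> \<phi> h \<and> x g' = lact ?X h (x g))"
      using c x y \<phi>_facts by (simp add: ab s_def balance_class_eq[OF prd] y_ract yeq)
    also have "\<dots> \<longleftrightarrow> (\<exists>v\<in>V. k = k' \<otimes>\<^bsub>K\<^esub> \<phi> (\<chi> v) \<and> g' = v \<otimes>\<^bsub>G\<^esub> g)"
      using c \<chi>_facts by (auto simp: x_def lact_coset_biset[OF inner] coset_point_iff[OF inner])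
    also have "\<dots> \<longleftrightarrow> t b = t a"
      using c by (simp add: ab t_def coset_point_iff[OF whole])
    finally show "s a = s b \<longleftrightarrow> t a = t b"
      by auto
  next
    fix a k assume a: "a \<in> ?A" and k: "k \<in> carrier K"
    then show "\<exists>b\<in>?A. lact (biset_product H ?Y ?X) k (s a) = s b \<and> lact ?W k (t a) = t b"
      by (cases a, intro bexI[of _ "(k \<otimes>\<^bsub>K\<^esub> fst a, snd a)"])
        (auto simp: s_def t_def lact_biset_product[OF prd] x y lact_coset_biset[OF whole] y_lact)
  next
    fix a g assume a: "a \<in> ?A" and g: "g \<in> carrier G"
    then show "\<exists>b\<in>?A. ract (biset_product H ?Y ?X) (s a) g = s b \<and> ract ?W (t a) g = t b"
      by (cases a, intro bexI[of _ "(fst a, snd a \<otimes>\<^bsub>G\<^esub> g)"])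
        (auto simp: s_def t_def ract_biset_product[OF prd] x y ract_coset_biset[OF whole] x_ract)
  qed
qed

lemma coset_biset_unit_left:
  assumes X: "is_biset G H X" and grp: "group G" "group H" and fin: "finite (carrier H)"
  shows "biset_iso G H (biset_product H (coset_biset H H (twisted_diagonal (carrier H) id)) X) X"
proof -
  interpret H: group H by fact
  have outer: "group H" "group H" "finite (carrier H)" "finite (carrier H)" "subgroup (carrier H) H"
      "id \<in> hom (H\<lparr>carrier := carrier H\<rparr>) H"
    using grp fin H.subgroup_self by (auto simp: hom_def)
  let ?Y = "coset_biset H H (twisted_diagonal (carrier H) id)"
  note Y = coset_biset_biset[OF outer]
  note prd = X Y grp(1,2,2)
  define y where "y = coset_point H H (carrier H) id \<one>\<^bsub>H\<^esub> \<one>\<^bsub>H\<^esub>"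
  have y: "y \<in> points ?Y"
    by (simp add: y_def coset_point_in[OF outer])
  have y_ract: "ract ?Y y h = coset_point H H (carrier H) id \<one>\<^bsub>H\<^esub> h" if "h \<in> carrier H" for h
    using that by (simp add: y_def ract_coset_biset[OF outer])
  have y_lact: "lact ?Y h y = ract ?Y y h" if "h \<in> carrier H" for h
    using that coset_point_shift[OF outer, of "\<one>\<^bsub>H\<^esub>" "\<one>\<^bsub>H\<^esub>" h]
    by (simp add: y_def ract_coset_biset[OF outer] lact_coset_biset[OF outer])
  define s where "s x = balance_class H ?Y X y x" for x
  show ?thesis
  proof (rule biset_isoI[of s "points X" _ "\<lambda>x. x"])
    have "z \<in> s ` points X" if "z \<in> points (biset_product H ?Y X)" for z
    proof -
      from that obtain k h x where c: "k \<in> carrier H" "h \<in> carrier H" "x \<in> points X"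
        and z: "z = balance_class H ?Y X (coset_point H H (carrier H) id k h) x"
        by (auto simp: points_biset_product[OF prd] points_coset_biset[OF outer])
      have "coset_point H H (carrier H) id k h = ract ?Y y (k \<otimes>\<^bsub>H\<^esub> h)"
        using c coset_point_shift[OF outer, of "\<one>\<^bsub>H\<^esub>" h k] by (simp add: y_ract)
      then have "z = s (lact X (k \<otimes>\<^bsub>H\<^esub> h) x)"
        using c z y by (simp add: balance_class_shift[OF prd] s_def)
      then show ?thesis
        using c bisetD(2)[OF X] by blast
    qed
    moreover have "s x \<in> points (biset_product H ?Y X)" if "x \<in> points X" for x
      using that y by (auto simp: s_def points_biset_product[OF prd])
    ultimately show "s ` points X = points (biset_product H ?Y X)"
      by blast
  next
    fix a b assume ab: "a \<in> points X" "b \<in> points X"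
    have "y = ract ?Y y h \<longleftrightarrow> h = \<one>\<^bsub>H\<^esub>" if "h \<in> carrier H" for h
      using that y_ract[OF that] by (auto simp: y_def coset_point_iff[OF outer])
    then show "s a = s b \<longleftrightarrow> a = b"
      using ab y bisetD(4)[OF X] by (auto simp: s_def balance_class_eq[OF prd] cong: bex_cong)
  next
    fix a k assume a: "a \<in> points X" and k: "k \<in> carrier H"
    then show "\<exists>b\<in>points X. lact (biset_product H ?Y X) k (s a) = s b \<and> lact X k a = b"
      using y bisetD(2)[OF X]
      by (intro bexI[of _ "lact X k a"]) (simp_all add: s_def lact_biset_product[OF prd] y_lact balance_class_shift[OF prd])
  next
    fix a g assume a: "a \<in> points X" and g: "g \<in> carrier G"
    then show "\<exists>b\<in>points X. ract (biset_product H ?Y X) (s a) g = s b \<and> ract X a g = b"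
      using y bisetD(3)[OF X]
      by (intro bexI[of _ "ract X a g"]) (simp_all add: s_def ract_biset_product[OF prd])
  qed simp
qed

lemma coset_biset_unit_right:
  assumes Y: "is_biset G H Y" and grp: "group G" "group H" and fin: "finite (carrier G)"
  shows "biset_iso G H (biset_product G Y (coset_biset G G (twisted_diagonal (carrier G) id))) Y"
proof -
  interpret G: group G by fact
  have inner: "group G" "group G" "finite (carrier G)" "finite (carrier G)" "subgroup (carrier G) G"
      "id \<in> hom (G\<lparr>carrier := carrier G\<rparr>) G"
    using grp fin G.subgroup_self by (auto simp: hom_def)
  let ?X = "coset_biset G G (twisted_diagonal (carrier G) id)"
  note X = coset_biset_biset[OF inner]
  note prd = X Y grp(1,1,2)
  define x where "x = coset_point G G (carrier G) id \<one>\<^bsub>G\<^esub> \<one>\<^bsub>G\<^esub>"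
  have x: "x \<in> points ?X"
    by (simp add: x_def coset_point_in[OF inner])
  have x_lact: "lact ?X g x = coset_point G G (carrier G) id \<one>\<^bsub>G\<^esub> g" if "g \<in> carrier G" for g
    using that coset_point_shift[OF inner, of "\<one>\<^bsub>G\<^esub>" "\<one>\<^bsub>G\<^esub>" g] by (simp add: x_def lact_coset_biset[OF inner])
  have x_ract: "ract ?X x g = lact ?X g x" if "g \<in> carrier G" for g
    using that by (simp add: x_lact) (simp add: x_def ract_coset_biset[OF inner])
  define s where "s y = balance_class G Y ?X y x" for y
  show ?thesis
  proof (rule biset_isoI[of s "points Y" _ "\<lambda>y. y"])
    have "z \<in> s ` points Y" if "z \<in> points (biset_product G Y ?X)" for z
    proof -
      from that obtain k h y where c: "k \<in> carrier G" "h \<in> carrier G" "y \<in> points Y"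
        and z: "z = balance_class G Y ?X y (coset_point G G (carrier G) id k h)"
        by (auto simp: points_biset_product[OF prd] points_coset_biset[OF inner])
      have "coset_point G G (carrier G) id k h = lact ?X (k \<otimes>\<^bsub>G\<^esub> h) x"
        using c coset_point_shift[OF inner, of "\<one>\<^bsub>G\<^esub>" h k] by (simp add: x_lact)
      then have "z = s (ract Y y (k \<otimes>\<^bsub>G\<^esub> h))"
        using c z x by (simp add: balance_class_shift[OF prd] s_def)
      then show ?thesis
        using c bisetD(3)[OF Y] by blast
    qed
    moreover have "s y \<in> points (biset_product G Y ?X)" if "y \<in> points Y" for y
      using that x by (auto simp: s_def points_biset_product[OF prd])
    ultimately show "s ` points Y = points (biset_product G Y ?X)"
      by blast
  next
    fix a b assume ab: "a \<in> points Y" "b \<in> points Y"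
    have "x = lact ?X h x \<longleftrightarrow> h = \<one>\<^bsub>G\<^esub>" if "h \<in> carrier G" for h
      using that x_lact[OF that] by (auto simp: x_def coset_point_iff[OF inner])
    then show "s a = s b \<longleftrightarrow> a = b"
      using ab x bisetD(5)[OF Y] by (auto simp: s_def balance_class_eq[OF prd] cong: bex_cong)
  next
    fix a k assume a: "a \<in> points Y" and k: "k \<in> carrier H"
    then show "\<exists>b\<in>points Y. lact (biset_product G Y ?X) k (s a) = s b \<and> lact Y k a = b"
      using x bisetD(2)[OF Y]
      by (intro bexI[of _ "lact Y k a"]) (simp_all add: s_def lact_biset_product[OF prd])
  next
    fix a g assume a: "a \<in> points Y" and g: "g \<in> carrier G"
    then show "\<exists>b\<in>points Y. ract (biset_product G Y ?X) (s a) g = s b \<and> ract Y a g = b"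
      using x bisetD(3)[OF Y]
      by (intro bexI[of _ "ract Y a g"]) (simp_all add: s_def ract_biset_product[OF prd] x_ract balance_class_shift[OF prd])
  qed simp
qed

section \<open>The augmentation\<close>

text \<open>The cardinality is read off from an arbitrary representative; all of them are isomorphic.\<close>

lemma class_card_iso_class:
  assumes X: "is_biset G H X"
  shows "class_card (iso_class G H X) = card (points X)"
proof -
  obtain Z :: "('a, 'c, nat) biset" where "is_biset G H Z" "biset_iso G H X Z"
    using exists_nat_biset[OF X] .
  then have "Z \<in> iso_class G H X"
    by (simp add: iso_class_def)
  then have "(SOME Z. Z \<in> iso_class G H X) \<in> iso_class G H X"
    by (rule someI)
  then have "biset_iso G H X (SOME Z. Z \<in> iso_class G H X)"
    by (simp add: iso_class_def)
  then show ?thesis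
    by (simp add: class_card_def biset_iso_card)
qed

lemma class_card_mult:
  assumes "c \<in> carrier (biset_monoid G H)" "d \<in> carrier (biset_monoid G H)"
  shows "class_card (c \<otimes>\<^bsub>biset_monoid G H\<^esub> d) = class_card c + class_card d"
  using assms
  by (elim biset_monoidE)
    (simp add: iso_class_mult class_card_iso_class disjoint_union_biset,
      simp add: disjoint_union_def card_Plus bisetD(1))

lemma burnside_aug_class:
  assumes c: "c \<in> carrier (biset_monoid S S)" and d: "d \<in> carrier (biset_monoid S S)"
  shows "burnside_aug S (groth_class (biset_monoid S S) (c, d)) =
    (of_nat (class_card c) - of_nat (class_card d)) / of_nat (order S)"
proof -
  interpret comm_monoid "biset_monoid S S" by (rule biset_comm_monoid)
  obtain c' d' where cd: "(SOME z. z \<in> groth_class (biset_monoid S S) (c, d)) = (c', d')"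
    by fastforce
  then have "(c', d') \<in> groth_class (biset_monoid S S) (c, d)"
    using someI[of "\<lambda>z. z \<in> groth_class (biset_monoid S S) (c, d)", OF groth_class_self[OF c d]] by simp
  then obtain e where e: "c' \<in> carrier (biset_monoid S S)" "d' \<in> carrier (biset_monoid S S)"
      "e \<in> carrier (biset_monoid S S)"
      "c \<otimes>\<^bsub>biset_monoid S S\<^esub> d' \<otimes>\<^bsub>biset_monoid S S\<^esub> e = c' \<otimes>\<^bsub>biset_monoid S S\<^esub> d \<otimes>\<^bsub>biset_monoid S S\<^esub> e"
    by (auto simp: groth_rel_def)
  have "class_card c + class_card d' = class_card c' + class_card d"
    using arg_cong[OF e(4), of class_card] e(1-3) c d by (simp add: class_card_mult)
  then have "(of_nat (class_card c') - of_nat (class_card d') :: rat) =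
      of_nat (class_card c) - of_nat (class_card d)"
    by (simp add: algebra_simps flip: of_nat_add)
  then show ?thesis
    unfolding burnside_aug_def cd by simp
qed

lemma burnside_aug_mult:
  assumes "a \<in> carrier (burnside_group S S)" "b \<in> carrier (burnside_group S S)"
  shows "burnside_aug S (a \<otimes>\<^bsub>burnside_group S S\<^esub> b) = burnside_aug S a + burnside_aug S b"
proof -
  interpret comm_monoid "biset_monoid S S" by (rule biset_comm_monoid)
  show ?thesis
    using assms unfolding burnside_group_def
    by (elim groth_groupE)
      (simp add: groth_mult burnside_aug_class class_card_mult add_divide_distrib diff_divide_distrib)
qed

lemma burnside_aug_burnside_class:
  assumes "is_biset S S X"
  shows "burnside_aug S (burnside_class S S X) = of_nat (card (points X)) / of_nat (order S)"
proof -
  interpret comm_monoid "biset_monoid S S" by (rule biset_comm_monoid)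
  show ?thesis
    unfolding burnside_class_def
    using class_card_iso_class[OF empty_biset, of S S]
    by (simp add: burnside_aug_class iso_class_closed assms class_card_iso_class)
      (simp add: one_biset_monoid empty_biset_def)
qed

text \<open>The augmentation on representatives in the free abelian group. It is additive there and vanishes
on the bilinearity relations, which makes the augmentation itself independent of the
representative.\<close>

definition frag_aug :: "('a, 'm) monoid_scheme \<Rightarrow> ((('a, 'a) burnside \<times> rat) \<Rightarrow>\<^sub>0 int) \<Rightarrow> rat"
  where "frag_aug S f = (\<Sum>(a, r)\<in>Poly_Mapping.keys f.
    of_int (Poly_Mapping.lookup f (a, r)) * (r * burnside_aug S a))"

lemma frag_aug_superset:
  assumes "finite A" "Poly_Mapping.keys f \<subseteq> A"
  shows "frag_aug S f = (\<Sum>(a, r)\<in>A. of_int (Poly_Mapping.lookup f (a, r)) * (r * burnside_aug S a))"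
  unfolding frag_aug_def
  by (rule sum.mono_neutral_left) (use assms in \<open>auto simp: in_keys_iff\<close>)

lemma frag_aug_add: "frag_aug S (f + g) = frag_aug S f + frag_aug S g"
proof -
  let ?A = "Poly_Mapping.keys f \<union> Poly_Mapping.keys g"
  have fin: "finite ?A" and sub: "Poly_Mapping.keys f \<subseteq> ?A" "Poly_Mapping.keys g \<subseteq> ?A"
      "Poly_Mapping.keys (f + g) \<subseteq> ?A"
    by (auto dest: subsetD[OF Poly_Mapping.keys_add])
  show ?thesis
    unfolding sub[THEN frag_aug_superset[OF fin]]
    by (simp add: lookup_add case_prod_unfold algebra_simps sum.distrib)
qed

lemma frag_aug_frag_of: "frag_aug S (frag_of (a, r)) = r * burnside_aug S a"
  by (simp add: frag_aug_def keys_frag_of)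

lemma frag_aug_diff: "frag_aug S (f - g) = frag_aug S f - frag_aug S g"
  using frag_aug_add[of S "f - g" g] by simp

context
  fixes p :: nat and S :: "('a, 'm) monoid_scheme"
  assumes p: "prime p"
begin

lemma frag_aug_kernel:
  assumes "f \<in> tensor_kernel (burnside_group S S) (Z_loc_group p)"
  shows "frag_aug S f = 0"
proof -
  let ?F = "free_Abelian_group (carrier (burnside_group S S) \<times> carrier (Z_loc_group p))"
  \<comment> \<open>additivity of \<open>burnside_aug\<close> and distributivity\<close>
  have rel: "frag_aug S f = 0" if "f \<in> tensor_relations (burnside_group S S) (Z_loc_group p)" for f
    using that unfolding tensor_relations_def
    by (auto simp: frag_aug_diff frag_aug_frag_of burnside_aug_mult ring_distribs Z_loc_group_def)
  have zero: "frag_aug S 0 = 0"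
    by (simp add: frag_aug_def)
  show ?thesis
    using assms unfolding tensor_kernel_def
  proof (induction rule: generate.induct)
    case (inv h)
    have "inv\<^bsub>?F\<^esub> h = 0 - h"
      using subsetD[OF tensor_relations_closed[OF burnside_comm_group[of S S] Z_loc_comm_group[OF p]], of h] inv
      by simp
    then show ?case
      using rel[OF inv] by (simp add: frag_aug_diff zero del: diff_0)
  qed (simp_all add: zero rel frag_aug_add)
qed

lemma augmentation_class:
  assumes "Poly_Mapping.keys f \<subseteq> carrier (burnside_group S S) \<times> carrier (Z_loc_group p)"
  shows "augmentation S (burnside_loc_class p S S f) = frag_aug S f"
proof -
  note grp = burnside_comm_group[of S S] Z_loc_comm_group[OF p]
  let ?g = "SOME g. g \<in> burnside_loc_class p S S f"
  have "?g \<in> burnside_loc_class p S S f"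
    by (rule someI) (rule tensor_class_self[OF grp assms])
  then have "?g - f \<in> tensor_kernel (burnside_group S S) (Z_loc_group p)"
    by (rule tensor_class_members(2)[OF grp assms])
  then have "frag_aug S ?g = frag_aug S f"
    using frag_aug_kernel[of "?g - f"] by (simp add: frag_aug_diff)
  then show ?thesis
    by (simp add: augmentation_def frag_aug_def Let_def)
qed

lemma augmentation_mult:
  assumes "x \<in> carrier (burnside_loc p S S)" "y \<in> carrier (burnside_loc p S S)"
  shows "augmentation S (x \<otimes>\<^bsub>burnside_loc p S S\<^esub> y) = augmentation S x + augmentation S y"
proof -
  note grp = burnside_comm_group[of S S] Z_loc_comm_group[OF p]
  from assms obtain f g where fg: "x = burnside_loc_class p S S f" "y = burnside_loc_class p S S g"
    and keys: "Poly_Mapping.keys f \<subseteq> carrier (burnside_group S S) \<times> carrier (Z_loc_group p)"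
      "Poly_Mapping.keys g \<subseteq> carrier (burnside_group S S) \<times> carrier (Z_loc_group p)"
    by (auto simp: burnside_loc_def carrier_tensor_group)
  have "Poly_Mapping.keys (f + g) \<subseteq> carrier (burnside_group S S) \<times> carrier (Z_loc_group p)"
    using keys Poly_Mapping.keys_add[of f g] by blast
  moreover have "x \<otimes>\<^bsub>burnside_loc p S S\<^esub> y = burnside_loc_class p S S (f + g)"
    unfolding fg burnside_loc_def by (rule tensor_class_add[OF grp keys, symmetric])
  ultimately show ?thesis
    using keys by (simp add: fg augmentation_class frag_aug_add)
qed

lemma augmentation_scaled_biset:
  assumes "is_biset S S X" "r \<in> Z_loc p"
  shows "augmentation S (scaled_biset p S S r X) = r * of_nat (card (points X)) / of_nat (order S)"
  unfolding scaled_biset_def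
  by (subst augmentation_class)
    (simp_all add: keys_frag_of burnside_class_closed assms carrier_Z_loc_group p frag_aug_frag_of
      burnside_aug_burnside_class)

lemma augmentation_one: "augmentation S \<one>\<^bsub>burnside_loc p S S\<^esub> = 0"
proof -
  interpret comm_group "burnside_loc p S S" by (rule burnside_loc_comm_group[OF p])
  show ?thesis
    using augmentation_mult[of "\<one>\<^bsub>burnside_loc p S S\<^esub>" "\<one>\<^bsub>burnside_loc p S S\<^esub>"] by simp
qed

lemma augmentation_inv:
  assumes "x \<in> carrier (burnside_loc p S S)"
  shows "augmentation S (inv\<^bsub>burnside_loc p S S\<^esub> x) = - augmentation S x"
proof -
  interpret comm_group "burnside_loc p S S" by (rule burnside_loc_comm_group[OF p])
  show ?thesis
    using augmentation_mult[of "inv\<^bsub>burnside_loc p S S\<^esub> x" x] assms by (simp add: augmentation_one)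
qed

end

section \<open>Bisets of left sets\<close>

text \<open>Actions are plain binary functions here: a homomorphism into the permutations of the set would
have to be made extensional on every product and every orbit.\<close>

definition left_set :: "('a, 'm) monoid_scheme \<Rightarrow> 'z set \<Rightarrow> ('a \<Rightarrow> 'z \<Rightarrow> 'z) \<Rightarrow> bool"
  where "left_set S Z a \<longleftrightarrow> finite Z \<and> (\<forall>z\<in>Z. a \<one>\<^bsub>S\<^esub> z = z \<and> (\<forall>s\<in>carrier S. a s z \<in> Z \<and>
    (\<forall>t\<in>carrier S. a (s \<otimes>\<^bsub>S\<^esub> t) z = a s (a t z))))"

definition stabilizer_of :: "('a, 'm) monoid_scheme \<Rightarrow> ('a \<Rightarrow> 'z \<Rightarrow> 'z) \<Rightarrow> 'z \<Rightarrow> 'a set"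
  where "stabilizer_of S a z = {s \<in> carrier S. a s z = z}"

text \<open>The biset \<open>Z \<times> S\<close> with diagonal left action. The assignment \<open>Z \<mapsto> Z \<times> S\<close> embeds the Burnside ring
of \<open>S\<close> into the double Burnside ring, turning products into composites.\<close>

definition set_biset :: "('a, 'm) monoid_scheme \<Rightarrow> 'z set \<Rightarrow> ('a \<Rightarrow> 'z \<Rightarrow> 'z) \<Rightarrow> ('a, 'a, 'z \<times> 'a) biset"
  where "set_biset S Z a = \<lparr>points = Z \<times> carrier S, lact = (\<lambda>s (z, t). (a s z, s \<otimes>\<^bsub>S\<^esub> t)),
    ract = (\<lambda>(z, t) s. (z, t \<otimes>\<^bsub>S\<^esub> s))\<rparr>"

lemma left_setD:
  assumes "left_set S Z a"
  shows "finite Z" "z \<in> Z \<Longrightarrow> a \<one>\<^bsub>S\<^esub> z = z" "z \<in> Z \<Longrightarrow> s \<in> carrier S \<Longrightarrow> a s z \<in> Z"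
    "z \<in> Z \<Longrightarrow> s \<in> carrier S \<Longrightarrow> t \<in> carrier S \<Longrightarrow> a (s \<otimes>\<^bsub>S\<^esub> t) z = a s (a t z)"
  using assms by (auto simp: left_set_def)

lemma left_set_inv:
  assumes "group S" "left_set S Z a" "z \<in> Z" "s \<in> carrier S"
  shows "a (inv\<^bsub>S\<^esub> s) (a s z) = z"
  using left_setD(4)[OF assms(2,3), of "inv\<^bsub>S\<^esub> s" s] left_setD(2)[OF assms(2,3)] assms(1,4)
  by (simp add: group.l_inv)

lemma set_biset_biset:
  assumes "group S" "finite (carrier S)" "left_set S Z a"
  shows "is_biset S S (set_biset S Z a)"
proof -
  interpret group S by fact
  show ?thesis
    using assms(2) left_setD[OF assms(3)] by (auto simp: is_biset_def set_biset_def m_assoc)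
qed

lemma left_set_prod:
  assumes "left_set S Z a" "left_set S Z' a'"
  shows "left_set S (Z \<times> Z') (\<lambda>s. map_prod (a s) (a' s))"
  using assms by (auto simp: left_set_def)

lemma stabilizer_of_subgroup:
  assumes "group S" "left_set S Z a" "z \<in> Z"
  shows "subgroup (stabilizer_of S a z) S"
proof -
  interpret group S by fact
  show ?thesis
  proof (rule subgroupI)
    show "inv\<^bsub>S\<^esub> s \<in> stabilizer_of S a z" if "s \<in> stabilizer_of S a z" for s
      using that left_set_inv[OF assms, of s] by (auto simp: stabilizer_of_def)
  qed (use left_setD[OF assms(2)] assms(3) in \<open>auto simp: stabilizer_of_def\<close>)
qed

context
  fixes S :: "('a, 'm) monoid_scheme"
  assumes S: "group S" and fin: "finite (carrier S)"
begin

interpretation S: group S by (rule S)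

lemma inclusion_hom: "subgroup P S \<Longrightarrow> id \<in> hom (S\<lparr>carrier := P\<rparr>) S"
  by (auto simp: hom_def dest: subgroup.mem_carrier)

text \<open>The transitive biset \<open>[R, id]\<close> is the image of the left set \<open>S/R\<close>. The point \<open>[h, g]\<close> corresponds to
\<open>(h z, h g)\<close>; the second coordinate recovers \<open>g\<close> from \<open>h\<close>, and moving \<open>u\<close> across the bracket fixes
both coordinates.\<close>

lemma orbit_biset:
  assumes Z: "left_set S Z a" and z: "z \<in> Z"
  shows "biset_iso S S (coset_biset S S (twisted_diagonal (stabilizer_of S a z) id))
    (set_biset S ((\<lambda>s. a s z) ` carrier S) a)"
proof -
  note R = stabilizer_of_subgroup[OF S Z z]
  let ?R = "stabilizer_of S a z" and ?A = "carrier S \<times> carrier S"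
  note cf = S S fin fin R inclusion_hom[OF R]
  show ?thesis
  proof (rule biset_isoI[of "\<lambda>(h, g). coset_point S S ?R id h g" ?A _ "\<lambda>(h, g). (a h z, h \<otimes>\<^bsub>S\<^esub> g)"])
    show "(\<lambda>(h, g). coset_point S S ?R id h g) ` ?A = points (coset_biset S S (twisted_diagonal ?R id))"
      by (simp add: points_coset_biset[OF cf])
    have "(a h z, g) \<in> (\<lambda>(h, g). (a h z, h \<otimes>\<^bsub>S\<^esub> g)) ` ?A" if "h \<in> carrier S" "g \<in> carrier S" for h g
      using that by (intro image_eqI[of _ _ "(h, inv\<^bsub>S\<^esub> h \<otimes>\<^bsub>S\<^esub> g)"]) (auto simp flip: S.m_assoc)
    then show "(\<lambda>(h, g). (a h z, h \<otimes>\<^bsub>S\<^esub> g)) ` ?A = points (set_biset S ((\<lambda>s. a s z) ` carrier S) a)"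
      by (auto simp: set_biset_def)
  next
    fix x y assume "x \<in> ?A" "y \<in> ?A"
    then obtain h g h' g' where xy: "x = (h, g)" "y = (h', g')"
      and c: "h \<in> carrier S" "g \<in> carrier S" "h' \<in> carrier S" "g' \<in> carrier S"
      by auto
    have "(\<exists>u\<in>?R. h' = h \<otimes>\<^bsub>S\<^esub> u \<and> g = u \<otimes>\<^bsub>S\<^esub> g') \<longleftrightarrow> a h z = a h' z \<and> h \<otimes>\<^bsub>S\<^esub> g = h' \<otimes>\<^bsub>S\<^esub> g'"
    proof
      assume "\<exists>u\<in>?R. h' = h \<otimes>\<^bsub>S\<^esub> u \<and> g = u \<otimes>\<^bsub>S\<^esub> g'"
      then show "a h z = a h' z \<and> h \<otimes>\<^bsub>S\<^esub> g = h' \<otimes>\<^bsub>S\<^esub> g'"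
        using c left_setD(4)[OF Z z] by (auto simp: stabilizer_of_def S.m_assoc)
    next
      assume *: "a h z = a h' z \<and> h \<otimes>\<^bsub>S\<^esub> g = h' \<otimes>\<^bsub>S\<^esub> g'"
      \<comment> \<open>\<open>h' = h u\<close> forces this choice of \<open>u\<close>\<close>
      let ?u = "inv\<^bsub>S\<^esub> h \<otimes>\<^bsub>S\<^esub> h'"
      have "a ?u z = z"
        using c * left_setD(4)[OF Z z, of "inv\<^bsub>S\<^esub> h" h'] left_set_inv[OF S Z z c(1)] by simp
      moreover have "h' = h \<otimes>\<^bsub>S\<^esub> ?u"
        using c by (simp flip: S.m_assoc)
      moreover have "g = ?u \<otimes>\<^bsub>S\<^esub> g'"
        using c * by (metis S.inv_closed S.inv_solve_left S.m_assoc S.m_closed)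
      ultimately show "\<exists>u\<in>?R. h' = h \<otimes>\<^bsub>S\<^esub> u \<and> g = u \<otimes>\<^bsub>S\<^esub> g'"
        using c by (intro bexI[of _ ?u]) (auto simp: stabilizer_of_def)
    qed
    then show "((case x of (h, g) \<Rightarrow> coset_point S S ?R id h g) = (case y of (h, g) \<Rightarrow> coset_point S S ?R id h g)) =
        ((case x of (h, g) \<Rightarrow> (a h z, h \<otimes>\<^bsub>S\<^esub> g)) = (case y of (h, g) \<Rightarrow> (a h z, h \<otimes>\<^bsub>S\<^esub> g)))"
      using c by (simp add: xy coset_point_iff[OF cf])
  next
    fix x h assume "x \<in> ?A" "h \<in> carrier S"
    then show "\<exists>b\<in>?A. lact (coset_biset S S (twisted_diagonal ?R id)) h (case x of (h, g) \<Rightarrow> coset_point S S ?R id h g) =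
        (case b of (h, g) \<Rightarrow> coset_point S S ?R id h g) \<and>
        lact (set_biset S ((\<lambda>s. a s z) ` carrier S) a) h (case x of (h, g) \<Rightarrow> (a h z, h \<otimes>\<^bsub>S\<^esub> g)) =
        (case b of (h, g) \<Rightarrow> (a h z, h \<otimes>\<^bsub>S\<^esub> g))"
      using left_setD(4)[OF Z z] by (intro bexI[of _ "(h \<otimes>\<^bsub>S\<^esub> fst x, snd x)"])
        (auto simp: lact_coset_biset[OF cf] set_biset_def S.m_assoc)
  next
    fix x h assume "x \<in> ?A" "h \<in> carrier S"
    then show "\<exists>b\<in>?A. ract (coset_biset S S (twisted_diagonal ?R id)) (case x of (h, g) \<Rightarrow> coset_point S S ?R id h g) h =
        (case b of (h, g) \<Rightarrow> coset_point S S ?R id h g) \<and>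
        ract (set_biset S ((\<lambda>s. a s z) ` carrier S) a) (case x of (h, g) \<Rightarrow> (a h z, h \<otimes>\<^bsub>S\<^esub> g)) h =
        (case b of (h, g) \<Rightarrow> (a h z, h \<otimes>\<^bsub>S\<^esub> g))"
      by (intro bexI[of _ "(fst x, snd x \<otimes>\<^bsub>S\<^esub> h)"])
        (auto simp: ract_coset_biset[OF cf] set_biset_def S.m_assoc)
  qed
qed

text \<open>Balancing moves the \<open>S\<close>-coordinate of the left factor into the right factor, so each point has
exactly one representative of the form \<open>[(z, 1), (z', t)]\<close>.\<close>

lemma set_biset_product:
  assumes Z: "left_set S Z a" and Z': "left_set S Z' a'"
  shows "biset_iso S S (biset_product S (set_biset S Z a) (set_biset S Z' a'))
    (set_biset S (Z \<times> Z') (\<lambda>s. map_prod (a s) (a' s)))"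
proof -
  let ?Y = "set_biset S Z a" and ?X = "set_biset S Z' a'"
  note Y = set_biset_biset[OF S fin Z] and X = set_biset_biset[OF S fin Z']
  note prd = X Y S S S
  have pt: "points ?Y = Z \<times> carrier S" "points ?X = Z' \<times> carrier S"
    by (simp_all add: set_biset_def)
  have act: "lact ?Y s (z, t) = (a s z, s \<otimes>\<^bsub>S\<^esub> t)" "ract ?Y (z, t) s = (z, t \<otimes>\<^bsub>S\<^esub> s)"
    "lact ?X s (z', t) = (a' s z', s \<otimes>\<^bsub>S\<^esub> t)" "ract ?X (z', t) s = (z', t \<otimes>\<^bsub>S\<^esub> s)" for s t z z'
    by (simp_all add: set_biset_def)
  let ?A = "(Z \<times> Z') \<times> carrier S"
  define q where "q = (\<lambda>((z, z'), t). balance_class S ?Y ?X (z, \<one>\<^bsub>S\<^esub>) (z', t))"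
  \<comment> \<open>normal form of an arbitrary point\<close>
  have gen: "balance_class S ?Y ?X (z, s) (z', t) = q ((z, a' s z'), s \<otimes>\<^bsub>S\<^esub> t)"
    if "z \<in> Z" "z' \<in> Z'" "s \<in> carrier S" "t \<in> carrier S" for z z' s t
    using that balance_class_shift[OF prd, of "(z, \<one>\<^bsub>S\<^esub>)" "(z', t)" s] by (simp add: pt act q_def)
  show ?thesis
  proof (rule biset_isoI[of q ?A _ "\<lambda>x. x"])
    have "x \<in> q ` ?A" if x: "x \<in> points (biset_product S ?Y ?X)" for x
    proof -
      from x obtain z s z' t where "z \<in> Z" "z' \<in> Z'" "s \<in> carrier S" "t \<in> carrier S"
        "x = balance_class S ?Y ?X (z, s) (z', t)"
        by (auto simp: points_biset_product[OF prd] pt)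
      then show ?thesis
        using left_setD(3)[OF Z'] by (simp add: gen)
    qed
    moreover have "q x \<in> points (biset_product S ?Y ?X)" if "x \<in> ?A" for x
      using that by (auto simp: points_biset_product[OF prd] pt q_def)
    ultimately show "q ` ?A = points (biset_product S ?Y ?X)"
      by blast
    show "(\<lambda>x. x) ` ?A = points (set_biset S (Z \<times> Z') (\<lambda>s. map_prod (a s) (a' s)))"
      by (simp add: set_biset_def)
  next
    fix x y assume "x \<in> ?A" "y \<in> ?A"
    then obtain z z' t w w' u where xy: "x = ((z, z'), t)" "y = ((w, w'), u)"
      and c: "z \<in> Z" "z' \<in> Z'" "t \<in> carrier S" "w \<in> Z" "w' \<in> Z'" "u \<in> carrier S"
      by auto
    then show "q x = q y \<longleftrightarrow> x = y"
      using left_setD(2)[OF Z'] by (auto simp: q_def balance_class_eq[OF prd] pt act)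
  next
    fix x s assume x: "x \<in> ?A" and s: "s \<in> carrier S"
    then obtain z z' t where xy: "x = ((z, z'), t)" and c: "z \<in> Z" "z' \<in> Z'" "t \<in> carrier S"
      by auto
    have "lact (biset_product S ?Y ?X) s (q x) = balance_class S ?Y ?X (a s z, s) (z', t)"
      using c s by (simp add: xy q_def lact_biset_product[OF prd] pt act)
    also have "\<dots> = q ((a s z, a' s z'), s \<otimes>\<^bsub>S\<^esub> t)"
      using c s left_setD(3)[OF Z] by (simp add: gen)
    finally show "\<exists>b\<in>?A. lact (biset_product S ?Y ?X) s (q x) = q b \<and>
        lact (set_biset S (Z \<times> Z') (\<lambda>s. map_prod (a s) (a' s))) s x = b"
      using c s left_setD(3)[OF Z] left_setD(3)[OF Z']
      by (intro bexI[of _ "((a s z, a' s z'), s \<otimes>\<^bsub>S\<^esub> t)"]) (auto simp: xy set_biset_def)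
  next
    fix x s assume x: "x \<in> ?A" and s: "s \<in> carrier S"
    then show "\<exists>b\<in>?A. ract (biset_product S ?Y ?X) (q x) s = q b \<and>
        ract (set_biset S (Z \<times> Z') (\<lambda>s. map_prod (a s) (a' s))) x s = b"
      by (intro bexI[of _ "(fst x, snd x \<otimes>\<^bsub>S\<^esub> s)"])
        (auto simp: q_def ract_biset_product[OF prd] pt act set_biset_def[of S "Z \<times> Z'"])
  qed
qed

lemma set_biset_swap:
  assumes Z: "left_set S Z a" and Z': "left_set S Z' a'"
  shows "biset_iso S S (set_biset S (Z \<times> Z') (\<lambda>s. map_prod (a s) (a' s)))
    (set_biset S (Z' \<times> Z) (\<lambda>s. map_prod (a' s) (a s)))"
proof -
  have "bij_betw (map_prod prod.swap id) ((Z \<times> Z') \<times> carrier S) ((Z' \<times> Z) \<times> carrier S)"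
    by (rule bij_betw_map_prod) (auto simp: bij_betw_def inj_on_def)
  then show ?thesis
    unfolding biset_iso_def by (intro exI[of _ "map_prod prod.swap id"]) (auto simp: set_biset_def)
qed

lemma set_biset_union:
  assumes "Y \<subseteq> Z"
  shows "biset_iso S S (disjoint_union (set_biset S Y a) (set_biset S (Z - Y) a)) (set_biset S Z a)"
proof -
  have "bij_betw (case_sum id id) (Y \<times> carrier S <+> (Z - Y) \<times> carrier S) (Z \<times> carrier S)"
    using assms by (auto simp: bij_betw_def inj_on_def Plus_def image_Un image_image)
  then show ?thesis
    unfolding biset_iso_def
    by (intro exI[of _ "case_sum id id"]) (auto simp: set_biset_def disjoint_union_def)
qed

lemma lcosets_left_set:
  assumes Q: "subgroup Q S"
  shows "left_set S (lcosets\<^bsub>S\<^esub> Q) (\<lambda>s C. s <#\<^bsub>S\<^esub> C)"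
    and "stabilizer_of S (\<lambda>s C. s <#\<^bsub>S\<^esub> C) Q = Q"
    and "(\<lambda>s. s <#\<^bsub>S\<^esub> Q) ` carrier S = lcosets\<^bsub>S\<^esub> Q"
    and "Q \<in> lcosets\<^bsub>S\<^esub> Q"
proof -
  have sub: "Q \<subseteq> carrier S" using Q by (rule subgroup.subset)
  show img: "(\<lambda>s. s <#\<^bsub>S\<^esub> Q) ` carrier S = lcosets\<^bsub>S\<^esub> Q"
    by (auto simp: LCOSETS_def)
  show "left_set S (lcosets\<^bsub>S\<^esub> Q) (\<lambda>s C. s <#\<^bsub>S\<^esub> C)"
    unfolding left_set_def img[symmetric]
    using fin sub by (auto simp: S.lcos_m_assoc S.m_assoc)
  show "Q \<in> lcosets\<^bsub>S\<^esub> Q"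
    unfolding img[symmetric] using sub by (intro image_eqI[of _ _ "\<one>\<^bsub>S\<^esub>"]) (auto simp: S.lcos_mult_one)
  show "stabilizer_of S (\<lambda>s C. s <#\<^bsub>S\<^esub> C) Q = Q"
  proof -
    have "s <#\<^bsub>S\<^esub> Q = Q \<longleftrightarrow> s \<in> Q" if "s \<in> carrier S" for s
      using that Q S.lcos_self[OF that Q] S.l_repr_independence[of s "\<one>\<^bsub>S\<^esub>" Q] S.lcos_mult_one[OF sub] by auto
    then show ?thesis
      using sub by (auto simp: stabilizer_of_def)
  qed
qed

lemma coset_biset_set_biset:
  assumes Q: "subgroup Q S"
  shows "biset_iso S S (coset_biset S S (twisted_diagonal Q id)) (set_biset S (lcosets\<^bsub>S\<^esub> Q) (\<lambda>s C. s <#\<^bsub>S\<^esub> C))"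
  using orbit_biset[OF lcosets_left_set(1,4)[OF Q]] by (simp add: lcosets_left_set(2,3)[OF Q])

lemma left_set_orbit:
  assumes Z: "left_set S Z a" and z: "z \<in> Z"
  shows "(\<lambda>s. a s z) ` carrier S \<subseteq> Z" "left_set S ((\<lambda>s. a s z) ` carrier S) a"
    "left_set S (Z - (\<lambda>s. a s z) ` carrier S) a"
proof -
  show sub: "(\<lambda>s. a s z) ` carrier S \<subseteq> Z"
    using left_setD(3)[OF Z z] by auto
  have orb: "a s x \<in> (\<lambda>s. a s z) ` carrier S \<longleftrightarrow> x \<in> (\<lambda>s. a s z) ` carrier S"
    if "x \<in> Z" "s \<in> carrier S" for x s
  proof
    assume "x \<in> (\<lambda>s. a s z) ` carrier S"
    then show "a s x \<in> (\<lambda>s. a s z) ` carrier S"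
      using that left_setD(4)[OF Z z] by (auto simp flip: left_setD(4)[OF Z z])
  next
    assume "a s x \<in> (\<lambda>s. a s z) ` carrier S"
    then obtain t where t: "t \<in> carrier S" "a s x = a t z" by auto
    have "x = a (inv\<^bsub>S\<^esub> s \<otimes>\<^bsub>S\<^esub> t) z"
      using left_set_inv[OF S Z that] left_setD(4)[OF Z z, of "inv\<^bsub>S\<^esub> s" t] t that by simp
    then show "x \<in> (\<lambda>s. a s z) ` carrier S"
      using t that by blast
  qed
  show "left_set S ((\<lambda>s. a s z) ` carrier S) a"
    using sub left_setD[OF Z] orb unfolding left_set_def by (auto simp: fin subset_iff)
  show "left_set S (Z - (\<lambda>s. a s z) ` carrier S) a"
    using left_setD[OF Z] orb unfolding left_set_def by (auto simp: fin)
qed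

end

section \<open>Inverting combinations of the transitive bisets of subgroups\<close>

text \<open>Elements congruent to a unit modulo the maximal ideal are units: \<open>r + p d\<close> is \<open>r\<close> times
\<open>1 + p (d / r)\<close>, whose numerator and denominator are prime to \<open>p\<close>.\<close>

lemma Z_loc_unit_perturb:
  assumes p: "prime p" and r: "s \<in> Z_loc p" "r * s = 1" "d \<in> Z_loc p"
  obtains t where "t \<in> Z_loc p" "(r + of_nat p * d) * t = 1"
proof -
  from Z_loc_mult[OF p r(3,1)] obtain a b where ab: "d * s = of_int a / of_int b" "\<not> int p dvd b"
    by (auto simp: Z_loc_def)
  have nd: "\<not> int p dvd b + int p * a"
    using ab(2) by (simp add: dvd_add_left_iff)
  then have u: "of_int b / of_int (b + int p * a) \<in> Z_loc p"
    unfolding Z_loc_def by blast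
  have nz: "of_int b \<noteq> (0::rat)" "of_int (b + int p * a) \<noteq> (0::rat)"
    using Z_loc_nonzero[OF p] ab(2) nd by blast+
  have "(r + of_nat p * d) * s = 1 + of_nat p * (d * s)"
    using r(2) by (simp add: algebra_simps)
  also have "\<dots> = of_int (b + int p * a) / of_int b"
    using nz(1) by (simp add: ab(1) field_simps)
  finally have "(r + of_nat p * d) * (s * (of_int b / of_int (b + int p * a))) = 1"
    using nz by (simp flip: mult.assoc)
  then show thesis
    using that Z_loc_mult[OF p r(1) u] by blast
qed

lemma scaled_basic_eq:
  "scaled_basic p G H r U \<phi> = scaled_biset p G H r (coset_biset G H (twisted_diagonal U \<phi>))"
  by (simp add: scaled_basic_def scaled_biset_def)

text \<open>The element \<open>r [P, id]\<close>. It is a constant of its own so that the identity map in it is not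
rewritten.\<close>

definition inclusion_basic ::
    "nat \<Rightarrow> ('a, 'm) monoid_scheme \<Rightarrow> rat \<Rightarrow> 'a set \<Rightarrow> ('a, 'a) burnside_loc"
  where "inclusion_basic p S r P = scaled_basic p S S r P id"

lemma inclusion_basic_eq:
  "inclusion_basic p S r P = scaled_biset p S S r (coset_biset S S (twisted_diagonal P id))"
  by (simp add: inclusion_basic_def scaled_basic_eq del: id_apply)

lemma (in comm_group) mult_inv_cancel_left:
  assumes "a \<in> carrier G" "y \<in> carrier G" "z \<in> carrier G"
  shows "a \<otimes> y \<otimes> inv (a \<otimes> z) = y \<otimes> inv z"
proof -
  have "a \<otimes> y \<otimes> inv (a \<otimes> z) = (a \<otimes> inv a) \<otimes> (y \<otimes> inv z)"
    using assms by (simp only: inv_mult_group m_ac m_closed inv_closed)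
  then show ?thesis
    using assms by simp
qed

context
  fixes p :: nat and S :: "('a, 'm) monoid_scheme"
  assumes p: "prime p" and pS: "p_group p S"
begin

lemma p_group_group: "group S" and p_group_finite: "finite (carrier S)"
  using pS by (auto simp: p_group_def)

interpretation S: group S by (rule p_group_group)
abbreviation (input) \<A> where "\<A> \<equiv> burnside_loc p S S"

interpretation A: comm_group \<A> by (rule burnside_loc_comm_group[OF p])

abbreviation (input) \<iota> where "\<iota> \<equiv> inclusion_basic p S"

abbreviation (input) self_comp (infixl "\<bullet>" 70) where "self_comp \<equiv> biset_comp p S S S"

lemma subgroup_coset_biset: "subgroup P S \<Longrightarrow> is_biset S S (coset_biset S S (twisted_diagonal P id))"
  by (rule coset_biset_biset[OF p_group_group p_group_group p_group_finite p_group_finite _ inclusion_hom[OF p_group_group p_group_finite]])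

lemma inclusion_basic_closed: "subgroup P S \<Longrightarrow> r \<in> Z_loc p \<Longrightarrow> \<iota> r P \<in> carrier \<A>"
  unfolding inclusion_basic_eq by (intro scaled_biset_closed p subgroup_coset_biset)

lemma inclusion_basic_add: "subgroup P S \<Longrightarrow> r \<in> Z_loc p \<Longrightarrow> s \<in> Z_loc p \<Longrightarrow>
    \<iota> (r + s) P = \<iota> r P \<otimes>\<^bsub>\<A>\<^esub> \<iota> s P"
  unfolding inclusion_basic_eq by (intro scaled_biset_add p subgroup_coset_biset)

lemma inclusion_basic_zero: "subgroup P S \<Longrightarrow> \<iota> 0 P = \<one>\<^bsub>\<A>\<^esub>"
  using inclusion_basic_add[of P 0 0] inclusion_basic_closed[of P 0] Z_loc_of_int[OF p, of 0] by simp

lemma inclusion_basic_minus: "subgroup P S \<Longrightarrow> r \<in> Z_loc p \<Longrightarrow> \<iota> (- r) P = inv\<^bsub>\<A>\<^esub> \<iota> r P"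
  using inclusion_basic_add[of P "- r" r] Z_loc_minus[OF p, of r] inclusion_basic_closed[of P r] inclusion_basic_closed[of P "- r"] inclusion_basic_zero[of P]
  by (intro A.inv_equality[symmetric]) auto

lemma self_comp_closed: "x \<in> carrier \<A> \<Longrightarrow> y \<in> carrier \<A> \<Longrightarrow>
    x \<bullet> y \<in> carrier \<A>"
  by (rule biset_comp_closed[OF p p_group_group p_group_group p_group_group])

lemma self_comp_one: "x \<in> carrier \<A> \<Longrightarrow> \<one>\<^bsub>\<A>\<^esub> \<bullet> x = \<one>\<^bsub>\<A>\<^esub>"
  "x \<in> carrier \<A> \<Longrightarrow> x \<bullet> \<one>\<^bsub>\<A>\<^esub> = \<one>\<^bsub>\<A>\<^esub>"
  by (simp_all add: biset_comp_one[OF p p_group_group p_group_group p_group_group])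

lemmas self_comp_mult_left = biset_comp_mult_left[OF p p_group_group p_group_group p_group_group]
lemmas self_comp_mult_right = biset_comp_mult_right[OF p p_group_group p_group_group p_group_group]

lemma self_comp_inv_left: "x \<in> carrier \<A> \<Longrightarrow> y \<in> carrier \<A> \<Longrightarrow>
    inv\<^bsub>\<A>\<^esub> x \<bullet> y = inv\<^bsub>\<A>\<^esub> (x \<bullet> y)"
  using self_comp_mult_left[of "inv\<^bsub>\<A>\<^esub> x" x y] self_comp_one(1)[of y]
  by (intro A.inv_equality[symmetric]) (auto simp: self_comp_closed)

lemma self_comp_inv_right: "x \<in> carrier \<A> \<Longrightarrow> y \<in> carrier \<A> \<Longrightarrow>
    x \<bullet> inv\<^bsub>\<A>\<^esub> y = inv\<^bsub>\<A>\<^esub> (x \<bullet> y)"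
  using self_comp_mult_right[of x "inv\<^bsub>\<A>\<^esub> y" y] self_comp_one(2)[of x]
  by (intro A.inv_equality[symmetric]) (auto simp: self_comp_closed)

lemma card_subgroup: "subgroup P S \<Longrightarrow> \<exists>n. card P = p ^ n"
  using pS S.lagrange[of P] divides_primepow_nat[OF p, of "card P"]
  by (auto simp: p_group_def) (metis dvd_triv_right)

lemma card_proper_subgroup:
  assumes P: "subgroup P S" and R: "subgroup R S" and "R \<subset> P"
  obtains m where "card P = card R * (p * m)"
proof -
  from card_subgroup[OF P] card_subgroup[OF R] obtain i j where ij: "card P = p ^ i" "card R = p ^ j"
    by blast
  have "card R < card P"
    using assms(3) finite_subset[OF subgroup.subset[OF P] p_group_finite] by (intro psubset_card_mono)
  then have "j < i"
    using ij prime_gt_1_nat[OF p] by simp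
  then have "card P = card R * (p * p ^ (i - Suc j))"
    unfolding ij by (simp flip: power_Suc power_add)
  then show thesis by (rule that)
qed

text \<open>Obtained from the isomorphism with the coset biset by counting points on both sides.\<close>

lemma card_orbit:
  assumes Z: "left_set S Z a" and z: "z \<in> Z"
  shows "card ((\<lambda>s. a s z) ` carrier S) * card (stabilizer_of S a z) = card (carrier S)"
proof -
  note R = stabilizer_of_subgroup[OF p_group_group Z z]
  have "card (points (coset_biset S S (twisted_diagonal (stabilizer_of S a z) id))) =
      card ((\<lambda>s. a s z) ` carrier S) * card (carrier S)"
    using biset_iso_card[OF orbit_biset[OF p_group_group p_group_finite Z z]] by (simp add: set_biset_def card_cartesian_product)
  then show ?thesis
    using card_coset_biset[OF p_group_group p_group_group p_group_finite p_group_finite R inclusion_hom[OF p_group_group p_group_finite R]] S.one_closed p_group_finite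
    by (auto simp: card_gt_0_iff)
qed

text \<open>Splitting off one orbit at a time. An orbit with stabilizer \<open>R\<close> contributes \<open>[R, id]\<close>: it is
counted in \<open>n\<close> if \<open>R = P\<close>, and otherwise lies in \<open>J\<close> while its size is a multiple of
\<open>p |S/P|\<close>, counted in \<open>k\<close>. The subgroup \<open>J\<close> stands for the terms to be neglected; it will consist
of the multiples of a given element.\<close>

lemma orbit_decomposition:
  assumes P: "subgroup P S" and J: "subgroup J (\<A>)"
    and small: "\<And>R r. subgroup R S \<Longrightarrow> R \<subset> P \<Longrightarrow> r \<in> Z_loc p \<Longrightarrow> \<iota> r R \<in> J"
    and "left_set S Z a" and "\<forall>z\<in>Z. \<exists>s\<in>carrier S. stabilizer_of S a (a s z) \<subseteq> P"
  shows "\<exists>n k. card Z * card P = (n + p * k) * card (carrier S) \<and>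
    (\<forall>r\<in>Z_loc p. scaled_biset p S S r (set_biset S Z a) \<otimes>\<^bsub>\<A>\<^esub>
      inv\<^bsub>\<A>\<^esub> \<iota> (r * of_nat n) P \<in> J)"
  using assms(4,5)
proof (induction "card Z" arbitrary: Z rule: less_induct)
  case less
  interpret J: subgroup J \<A> by (rule J)
  note Z = less.prems(1)
  have nat: "of_nat n \<in> Z_loc p" for n
    using Z_loc_of_int[OF p, of "int n"] by simp
  have zero: "0 \<in> Z_loc p"
    using nat[of 0] by simp
  show ?case
  proof (cases "Z = {}")
    case True
    have "scaled_biset p S S r (set_biset S Z a) = \<one>\<^bsub>\<A>\<^esub>" if r: "r \<in> Z_loc p" for r
    proof -
      note X = set_biset_biset[OF p_group_group p_group_finite Z]
      let ?x = "scaled_biset p S S r (set_biset S Z a)"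
      \<comment> \<open>the empty biset is its own double, hence zero in the group\<close>
      have "biset_iso S S (disjoint_union (set_biset S Z a) (set_biset S Z a)) (set_biset S Z a)"
        using set_biset_union[OF p_group_group p_group_finite, of Z Z a] by (simp add: True)
      then have "?x = ?x \<otimes>\<^bsub>\<A>\<^esub> ?x"
        using scaled_biset_iso[OF p disjoint_union_biset[OF X X] X] scaled_biset_union[OF p X X r] by simp
      then show ?thesis
        using scaled_biset_closed[OF p X r] by (simp add: A.l_cancel_one')
    qed
    then show ?thesis
      using inclusion_basic_zero[OF P] by (intro exI[of _ 0]) (simp add: True)
  next
    case False
    then obtain z0 s where "z0 \<in> Z" "s \<in> carrier S" "stabilizer_of S a (a s z0) \<subseteq> P"
      using less.prems(2) by blast
    then obtain z where z: "z \<in> Z" and RP: "stabilizer_of S a z \<subseteq> P"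
      using left_setD(3)[OF Z] by blast
    let ?R = "stabilizer_of S a z" and ?O = "(\<lambda>s. a s z) ` carrier S"
    note R = stabilizer_of_subgroup[OF p_group_group Z z]
    note orb = left_set_orbit[OF p_group_group p_group_finite Z z]
    have "z \<in> ?O"
      using left_setD(2)[OF Z z] by (intro image_eqI[of _ _ "\<one>\<^bsub>S\<^esub>"]) auto
    then have card: "card Z = card ?O + card (Z - ?O)" "card (Z - ?O) < card Z"
      using orb(1) left_setD(1)[OF Z] z
      by (metis card_Diff_subset card_mono finite_subset le_add_diff_inverse, intro psubset_card_mono) auto
    from less.hyps[OF card(2) orb(3)] less.prems(2) obtain n k
      where n: "card (Z - ?O) * card P = (n + p * k) * card (carrier S)"
        and J': "\<And>r. r \<in> Z_loc p \<Longrightarrow> scaled_biset p S S r (set_biset S (Z - ?O) a) \<otimes>\<^bsub>\<A>\<^esub>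
          inv\<^bsub>\<A>\<^esub> \<iota> (r * of_nat n) P \<in> J"
      by blast
    note X = set_biset_biset[OF p_group_group p_group_finite orb(2)] and Y = set_biset_biset[OF p_group_group p_group_finite orb(3)]
    have split: "scaled_biset p S S r (set_biset S Z a) =
        \<iota> r ?R \<otimes>\<^bsub>\<A>\<^esub> scaled_biset p S S r (set_biset S (Z - ?O) a)" if r: "r \<in> Z_loc p" for r
      using scaled_biset_iso[OF p disjoint_union_biset[OF X Y] set_biset_biset[OF p_group_group p_group_finite Z]
          set_biset_union[OF p_group_group p_group_finite orb(1)]] scaled_biset_union[OF p X Y r]
        scaled_biset_iso[OF p subgroup_coset_biset[OF R] X orbit_biset[OF p_group_group p_group_finite Z z]]
      by (simp add: inclusion_basic_eq)
    have clY: "scaled_biset p S S r (set_biset S (Z - ?O) a) \<in> carrier \<A>"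
      if "r \<in> Z_loc p" for r
      by (rule scaled_biset_closed[OF p Y that])
    show ?thesis
    proof (cases "?R = P")
      case True
      have "card Z * card P = (Suc n + p * k) * card (carrier S)"
        using card(1) n card_orbit[OF Z z] by (simp add: True algebra_simps)
      moreover have "scaled_biset p S S r (set_biset S Z a) \<otimes>\<^bsub>\<A>\<^esub>
          inv\<^bsub>\<A>\<^esub> \<iota> (r * of_nat (Suc n)) P \<in> J" if r: "r \<in> Z_loc p" for r
      proof -
        have rn: "r * of_nat n \<in> Z_loc p"
          using Z_loc_mult[OF p r nat] .
        have "\<iota> (r * of_nat (Suc n)) P = \<iota> r P \<otimes>\<^bsub>\<A>\<^esub> \<iota> (r * of_nat n) P"
          using inclusion_basic_add[OF P r rn] by (simp add: algebra_simps)
        then have "scaled_biset p S S r (set_biset S Z a) \<otimes>\<^bsub>\<A>\<^esub>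
          inv\<^bsub>\<A>\<^esub> \<iota> (r * of_nat (Suc n)) P =
          scaled_biset p S S r (set_biset S (Z - ?O) a) \<otimes>\<^bsub>\<A>\<^esub>
          inv\<^bsub>\<A>\<^esub> \<iota> (r * of_nat n) P"
          using clY[OF r] inclusion_basic_closed[OF P r] inclusion_basic_closed[OF P rn]
          by (simp add: split[OF r] True A.mult_inv_cancel_left)
        then show ?thesis
          using J'[OF r] by simp
      qed
      ultimately show ?thesis by blast
    next
      case False
      with RP have lt: "?R \<subset> P" by blast
      obtain m where m: "card P = card ?R * (p * m)"
        using card_proper_subgroup[OF P R lt] .
      have "card ?O * card P = p * m * card (carrier S)"
        unfolding m card_orbit[OF Z z, symmetric] by simp
      then have "card Z * card P = (n + p * (k + m)) * card (carrier S)"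
        using card(1) n by (simp add: algebra_simps)
      moreover have "scaled_biset p S S r (set_biset S Z a) \<otimes>\<^bsub>\<A>\<^esub>
          inv\<^bsub>\<A>\<^esub> \<iota> (r * of_nat n) P \<in> J" if r: "r \<in> Z_loc p" for r
        using J.m_closed[OF small[OF R lt r] J'[OF r]] clY[OF r] inclusion_basic_closed[OF R r]
          inclusion_basic_closed[OF P Z_loc_mult[OF p r nat[of n]]]
        by (simp add: split[OF r] A.m_assoc)
      ultimately show ?thesis by blast
    qed
  qed
qed

text \<open>Under the correspondence with left sets the composite becomes the product of \<open>S/P\<close> and \<open>S/Q\<close>.\<close>

lemma inclusion_basic_comp:
  assumes P: "subgroup P S" and Q: "subgroup Q S" and r: "r \<in> Z_loc p" "s \<in> Z_loc p"
  shows "\<iota> r P \<bullet> \<iota> s Q = scaled_biset p S S (r * s) (set_biset S ((lcosets\<^bsub>S\<^esub> P) \<times> (lcosets\<^bsub>S\<^esub> Q))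
    (\<lambda>s. map_prod (\<lambda>C. s <#\<^bsub>S\<^esub> C) (\<lambda>C. s <#\<^bsub>S\<^esub> C)))"
proof -
  note lP = lcosets_left_set(1)[OF p_group_group p_group_finite P] and lQ = lcosets_left_set(1)[OF p_group_group p_group_finite Q]
  note bP = set_biset_biset[OF p_group_group p_group_finite lP] and bQ = set_biset_biset[OF p_group_group p_group_finite lQ]
  have "\<iota> r P \<bullet> \<iota> s Q = scaled_biset p S S r (set_biset S (lcosets\<^bsub>S\<^esub> P) (\<lambda>s C. s <#\<^bsub>S\<^esub> C)) \<bullet>
      scaled_biset p S S s (set_biset S (lcosets\<^bsub>S\<^esub> Q) (\<lambda>s C. s <#\<^bsub>S\<^esub> C))"
    unfolding inclusion_basic_eq
    using scaled_biset_iso[OF p subgroup_coset_biset[OF P] bP coset_biset_set_biset[OF p_group_group p_group_finite P]]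
      scaled_biset_iso[OF p subgroup_coset_biset[OF Q] bQ coset_biset_set_biset[OF p_group_group p_group_finite Q]] by simp
  also have "\<dots> = scaled_biset p S S (r * s) (biset_product S
      (set_biset S (lcosets\<^bsub>S\<^esub> P) (\<lambda>s C. s <#\<^bsub>S\<^esub> C)) (set_biset S (lcosets\<^bsub>S\<^esub> Q) (\<lambda>s C. s <#\<^bsub>S\<^esub> C)))"
    by (rule biset_comp_scaled[OF p bQ bP p_group_group p_group_group p_group_group r])
  also have "\<dots> = scaled_biset p S S (r * s) (set_biset S ((lcosets\<^bsub>S\<^esub> P) \<times> (lcosets\<^bsub>S\<^esub> Q))
    (\<lambda>s. map_prod (\<lambda>C. s <#\<^bsub>S\<^esub> C) (\<lambda>C. s <#\<^bsub>S\<^esub> C)))"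
    by (rule scaled_biset_iso[OF p biset_product_biset[OF bQ bP p_group_group p_group_group p_group_group]
          set_biset_biset[OF p_group_group p_group_finite left_set_prod[OF lP lQ]] set_biset_product[OF p_group_group p_group_finite lP lQ]])
  finally show ?thesis .
qed

lemma inclusion_basic_commute:
  assumes P: "subgroup P S" and Q: "subgroup Q S" and r: "r \<in> Z_loc p" "s \<in> Z_loc p"
  shows "\<iota> r P \<bullet> \<iota> s Q = \<iota> s Q \<bullet> \<iota> r P"
proof -
  note lP = lcosets_left_set(1)[OF p_group_group p_group_finite P] and lQ = lcosets_left_set(1)[OF p_group_group p_group_finite Q]
  show ?thesis
    unfolding inclusion_basic_comp[OF P Q r] inclusion_basic_comp[OF Q P r(2,1)]
    using scaled_biset_iso[OF p set_biset_biset[OF p_group_group p_group_finite left_set_prod[OF lP lQ]]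
        set_biset_biset[OF p_group_group p_group_finite left_set_prod[OF lQ lP]] set_biset_swap[OF p_group_group p_group_finite lP lQ]]
    by (simp add: mult.commute)
qed

lemma augmentation_scaled_basic:
  assumes P: "subgroup P S" and r: "r \<in> Z_loc p"
    and \<phi>: "\<phi> \<in> hom (S\<lparr>carrier := P\<rparr>) S"
  shows "augmentation S (scaled_basic p S S r P \<phi>) = r * of_nat (card (lcosets\<^bsub>S\<^esub> P))"
proof -
  note cf = p_group_group p_group_group p_group_finite p_group_finite P \<phi>
  have "card (points (coset_biset S S (twisted_diagonal P \<phi>))) * card P =
      card (lcosets\<^bsub>S\<^esub> P) * order S * card P"
    using card_coset_biset[OF cf] S.l_lagrange[OF p_group_finite P] by (simp add: order_def)
  moreover have "card P > 0"
    using finite_subset[OF subgroup.subset[OF P] p_group_finite] subgroup.one_closed[OF P] by (auto simp: card_gt_0_iff)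
  ultimately have "card (points (coset_biset S S (twisted_diagonal P \<phi>))) = card (lcosets\<^bsub>S\<^esub> P) * order S"
    by simp
  moreover have "order S > 0"
    using p_group_finite S.one_closed by (auto simp: order_def card_gt_0_iff)
  ultimately show ?thesis
    unfolding scaled_basic_eq augmentation_scaled_biset[OF p coset_biset_biset[OF cf] r] by simp
qed

lemma augmentation_inclusion_basic:
  "subgroup P S \<Longrightarrow> r \<in> Z_loc p \<Longrightarrow> augmentation S (\<iota> r P) = r * of_nat (card (lcosets\<^bsub>S\<^esub> P))"
  unfolding inclusion_basic_def by (rule augmentation_scaled_basic[OF _ _ inclusion_hom[OF p_group_group p_group_finite]])

text \<open>The leading coefficient is \<open>r n\<close>, where \<open>n\<close> is the number of orbits of \<open>S/P \<times> S/Q\<close> isomorphic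
to \<open>S/P\<close>. Since \<open>|S/Q| = n + p k\<close>, it differs from the augmentation \<open>r |S/Q|\<close> by \<open>- p r k\<close>.\<close>

lemma inclusion_basic_comp_leading_term:
  assumes P: "subgroup P S" and Q: "subgroup Q S" and r: "r \<in> Z_loc p"
    and J: "subgroup J (\<A>)"
    and small: "\<And>R r. subgroup R S \<Longrightarrow> R \<subset> P \<Longrightarrow> r \<in> Z_loc p \<Longrightarrow> \<iota> r R \<in> J"
  shows "\<exists>d\<in>Z_loc p. \<iota> 1 P \<bullet> \<iota> r Q \<otimes>\<^bsub>\<A>\<^esub>
    inv\<^bsub>\<A>\<^esub> \<iota> (augmentation S (\<iota> r Q) + of_nat p * d) P \<in> J"
proof -
  note lP = lcosets_left_set[OF p_group_group p_group_finite P] and lQ = lcosets_left_set[OF p_group_group p_group_finite Q]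
  let ?Z = "(lcosets\<^bsub>S\<^esub> P) \<times> (lcosets\<^bsub>S\<^esub> Q)" and ?a = "\<lambda>s. map_prod (\<lambda>C. s <#\<^bsub>S\<^esub> C) (\<lambda>C. s <#\<^bsub>S\<^esub> C)"
  have one: "1 \<in> Z_loc p"
    using Z_loc_of_int[OF p, of 1] by simp
  have "\<exists>s\<in>carrier S. stabilizer_of S ?a (?a s z) \<subseteq> P" if z: "z \<in> ?Z" for z
  proof -
    \<comment> \<open>translate the first coordinate to the coset \<open>P\<close>, whose stabilizer is \<open>P\<close>\<close>
    from z obtain s where s: "s \<in> carrier S" "fst z = s <#\<^bsub>S\<^esub> P"
      unfolding lP(3)[symmetric] by auto
    have "inv\<^bsub>S\<^esub> s <#\<^bsub>S\<^esub> (s <#\<^bsub>S\<^esub> P) = P"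
      using left_set_inv[OF p_group_group lP(1) lP(4) s(1)] .
    then have "stabilizer_of S ?a (?a (inv\<^bsub>S\<^esub> s) z) \<subseteq> stabilizer_of S (\<lambda>s C. s <#\<^bsub>S\<^esub> C) P"
      using s by (cases z) (auto simp: stabilizer_of_def)
    then show ?thesis
      using s(1) lP(2) by (intro bexI[of _ "inv\<^bsub>S\<^esub> s"]) auto
  qed
  then obtain n k where nk: "card ?Z * card P = (n + p * k) * card (carrier S)"
    and n: "\<And>r. r \<in> Z_loc p \<Longrightarrow> scaled_biset p S S r (set_biset S ?Z ?a) \<otimes>\<^bsub>\<A>\<^esub>
      inv\<^bsub>\<A>\<^esub> \<iota> (r * of_nat n) P \<in> J"
    using orbit_decomposition[OF P J small left_set_prod[OF lP(1) lQ(1)]] by blast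
  have "card (lcosets\<^bsub>S\<^esub> Q) * card (carrier S) = (n + p * k) * card (carrier S)"
    unfolding nk[symmetric] using S.l_lagrange[OF p_group_finite P, unfolded order_def, symmetric]
    by (simp add: card_cartesian_product)
  moreover have "card (carrier S) > 0"
    using p_group_finite S.one_closed by (auto simp: card_gt_0_iff)
  ultimately have "card (lcosets\<^bsub>S\<^esub> Q) = n + p * k"
    by simp
  then have "augmentation S (\<iota> r Q) + of_nat p * (- (r * of_nat k)) = r * of_nat n"
    unfolding augmentation_inclusion_basic[OF Q r] by (simp add: algebra_simps)
  moreover have "- (r * of_nat k) \<in> Z_loc p"
    using Z_loc_minus[OF p] Z_loc_mult[OF p r] Z_loc_of_int[OF p, of "int k"] by simp
  ultimately show ?thesis
    using n[OF r] inclusion_basic_comp[OF P Q one r] by (intro bexI[of _ "- (r * of_nat k)"]) simp_all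
qed

abbreviation (input) subgroup_span where
  "subgroup_span \<equiv> generate (\<A>) {\<iota> r Q | r Q. r \<in> Z_loc p \<and> subgroup Q S}"

lemma subgroup_span_subgroup: "subgroup subgroup_span (\<A>)"
  by (rule A.generate_is_subgroup) (auto simp: inclusion_basic_closed)

lemma subgroup_span_carrier: "e \<in> subgroup_span \<Longrightarrow> e \<in> carrier \<A>"
  using subgroup.subset[OF subgroup_span_subgroup] by auto

lemma subgroup_span_generator: "r \<in> Z_loc p \<Longrightarrow> subgroup Q S \<Longrightarrow> \<iota> r Q \<in> subgroup_span"
  by (rule generate.incl) auto

text \<open>The span is a copy of the commutative Burnside ring. Commutativity turns a left inverse into a
two-sided one and so serves left and right stable elements at once.\<close>

lemma subgroup_span_commute:
  assumes e: "e \<in> subgroup_span" and f: "f \<in> subgroup_span"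
  shows "f \<bullet> e = e \<bullet> f"
proof -
  have B: "\<iota> r Q \<bullet> e = e \<bullet> \<iota> r Q" if Q: "r \<in> Z_loc p" "subgroup Q S" for r Q
    using e
  proof (induction rule: generate.induct)
    case (inv h)
    then obtain t T where "h = \<iota> t T" "t \<in> Z_loc p" "subgroup T S" by blast
    then show ?case
      using Q inclusion_basic_commute by (simp add: self_comp_inv_left self_comp_inv_right inclusion_basic_closed)
  next
    case (eng h h')
    then show ?case
      using Q subgroup_span_carrier inclusion_basic_closed by (simp add: self_comp_mult_left self_comp_mult_right)
  qed (use Q inclusion_basic_commute in \<open>auto simp: self_comp_one inclusion_basic_closed\<close>)
  have ec: "e \<in> carrier \<A>"
    by (rule subgroup_span_carrier[OF e])
  show ?thesis
    using f
  proof (induction rule: generate.induct)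
    case (inv h)
    then obtain t T where "h = \<iota> t T" "t \<in> Z_loc p" "subgroup T S" by blast
    then show ?case
      using ec B by (simp add: self_comp_inv_left self_comp_inv_right inclusion_basic_closed)
  next
    case (eng h h')
    then show ?case
      using ec subgroup_span_carrier by (simp add: self_comp_mult_left self_comp_mult_right)
  qed (use ec B in \<open>auto simp: self_comp_one\<close>)
qed

text \<open>The statement for generators, \<open>inclusion_basic_comp_leading_term\<close>, extended to the span by additivity in \<open>e\<close>. The error term \<open>p d\<close> need not be
uniform in \<open>e\<close>; what matters is that it lies in the maximal ideal.\<close>

lemma span_comp_leading_term:
  assumes e: "e \<in> subgroup_span" and P: "subgroup P S"
    and J: "subgroup J (\<A>)"
    and small: "\<And>R r. subgroup R S \<Longrightarrow> R \<subset> P \<Longrightarrow> r \<in> Z_loc p \<Longrightarrow> \<iota> r R \<in> J"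
  shows "augmentation S e \<in> Z_loc p \<and> (\<exists>d\<in>Z_loc p. \<iota> 1 P \<bullet> e \<otimes>\<^bsub>\<A>\<^esub>
    inv\<^bsub>\<A>\<^esub> \<iota> (augmentation S e + of_nat p * d) P \<in> J)"
proof -
  interpret J: subgroup J \<A> by (rule J)
  have nat: "of_nat n \<in> Z_loc p" for n
    using Z_loc_of_int[OF p, of "int n"] by simp
  have zero: "0 \<in> Z_loc p" and one: "1 \<in> Z_loc p"
    using nat[of 0] nat[of 1] by simp_all
  have P1: "\<iota> 1 P \<in> carrier \<A>"
    by (rule inclusion_basic_closed[OF P one])
  have aug: "augmentation S (\<iota> r Q) \<in> Z_loc p" if "r \<in> Z_loc p" "subgroup Q S" for r Q
    using that augmentation_inclusion_basic[OF that(2,1)] Z_loc_mult[OF p _ nat] by simp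
  have comb: "u + of_nat p * d \<in> Z_loc p" if "u \<in> Z_loc p" "d \<in> Z_loc p" for u d
    using Z_loc_add[OF p that(1) Z_loc_mult[OF p nat that(2)]] .
  show ?thesis
    using e
  proof (induction rule: generate.induct)
    case one
    show ?case
      using zero inclusion_basic_zero[OF P] self_comp_one(2)[OF P1]
      by (auto simp: augmentation_one[OF p] intro!: bexI[of _ 0])
  next
    case (incl h)
    then obtain r Q where h: "h = \<iota> r Q" "r \<in> Z_loc p" "subgroup Q S" by blast
    then show ?case
      using aug inclusion_basic_comp_leading_term[OF P h(3,2) J small] by blast
  next
    case (inv h)
    then obtain r Q where h: "h = \<iota> r Q" "r \<in> Z_loc p" "subgroup Q S" by blast
    note hc = inclusion_basic_closed[OF h(3,2)]
    have "inv\<^bsub>\<A>\<^esub> h = \<iota> (- r) Q"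
      using inclusion_basic_minus h by simp
    then show ?case
      using aug[OF Z_loc_minus[OF p h(2)] h(3)]
        inclusion_basic_comp_leading_term[OF P h(3) Z_loc_minus[OF p h(2)] J small] by simp
  next
    case (eng h h')
    then obtain d d' where d: "d \<in> Z_loc p" "d' \<in> Z_loc p"
      and J1: "\<iota> 1 P \<bullet> h \<otimes>\<^bsub>\<A>\<^esub>
        inv\<^bsub>\<A>\<^esub> \<iota> (augmentation S h + of_nat p * d) P \<in> J"
      and J2: "\<iota> 1 P \<bullet> h' \<otimes>\<^bsub>\<A>\<^esub>
        inv\<^bsub>\<A>\<^esub> \<iota> (augmentation S h' + of_nat p * d') P \<in> J"
      and au: "augmentation S h \<in> Z_loc p" "augmentation S h' \<in> Z_loc p"
      by blast
    have hc: "h \<in> carrier \<A>" "h' \<in> carrier \<A>"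
      using eng subgroup_span_carrier by auto
    let ?u = "augmentation S h + of_nat p * d" and ?u' = "augmentation S h' + of_nat p * d'"
    have u: "?u \<in> Z_loc p" "?u' \<in> Z_loc p"
      by (intro comb d au)+
    have sum: "augmentation S (h \<otimes>\<^bsub>\<A>\<^esub> h') + of_nat p * (d + d') = ?u + ?u'"
      by (simp add: augmentation_mult[OF p hc] algebra_simps)
    have "\<iota> 1 P \<bullet> (h \<otimes>\<^bsub>\<A>\<^esub> h') \<otimes>\<^bsub>\<A>\<^esub>
        inv\<^bsub>\<A>\<^esub> \<iota> (?u + ?u') P =
        (\<iota> 1 P \<bullet> h \<otimes>\<^bsub>\<A>\<^esub> inv\<^bsub>\<A>\<^esub> \<iota> ?u P) \<otimes>\<^bsub>\<A>\<^esub>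
        (\<iota> 1 P \<bullet> h' \<otimes>\<^bsub>\<A>\<^esub> inv\<^bsub>\<A>\<^esub> \<iota> ?u' P)"
      using P1 hc inclusion_basic_closed[OF P u(1)] inclusion_basic_closed[OF P u(2)]
      by (simp add: self_comp_mult_right inclusion_basic_add[OF P u] A.inv_mult_group self_comp_closed A.m_ac)
    then have "\<iota> 1 P \<bullet> (h \<otimes>\<^bsub>\<A>\<^esub> h') \<otimes>\<^bsub>\<A>\<^esub>
        inv\<^bsub>\<A>\<^esub> \<iota> (augmentation S (h \<otimes>\<^bsub>\<A>\<^esub> h') + of_nat p * (d + d')) P \<in> J"
      unfolding sum using J.m_closed[OF J1 J2] by simp
    then show ?case
      using Z_loc_add[OF p d] Z_loc_add[OF p au] augmentation_mult[OF p hc] by auto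
  qed
qed

lemma comp_inclusion_unit:
  assumes "group G" "x \<in> carrier (burnside_loc p G S)"
  shows "biset_comp p G S S (\<iota> 1 (carrier S)) x = x"
proof -
  have one: "1 \<in> Z_loc p"
    using Z_loc_of_int[OF p, of 1] by simp
  note cB = inclusion_basic_closed[OF S.subgroup_self one]
  from assms(2) show ?thesis
  proof (induction rule: burnside_loc_induct[OF p, consumes 1, case_names one scaled_biset diff])
    case one
    then show ?case using cB by (simp add: biset_comp_one[OF p assms(1) p_group_group p_group_group])
  next
    case (diff x y)
    then show ?case using cB by (simp add: biset_comp_diff_right[OF p assms(1) p_group_group p_group_group])
  next
    case (scaled_biset X r)
    note bS = subgroup_coset_biset[OF S.subgroup_self]
    show ?case
      unfolding inclusion_basic_eq
        biset_comp_scaled[OF p scaled_biset(1) bS assms(1) p_group_group p_group_group one scaled_biset(2)]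
      using scaled_biset_iso[OF p biset_product_biset[OF scaled_biset(1) bS assms(1) p_group_group p_group_group] scaled_biset(1)
          coset_biset_unit_left[OF scaled_biset(1) assms(1) p_group_group p_group_finite]] by simp
  qed
qed

lemma comp_inclusion_unit_right:
  assumes "group H" "x \<in> carrier (burnside_loc p S H)"
  shows "biset_comp p S S H x (\<iota> 1 (carrier S)) = x"
proof -
  have one: "1 \<in> Z_loc p"
    using Z_loc_of_int[OF p, of 1] by simp
  note cB = inclusion_basic_closed[OF S.subgroup_self one]
  from assms(2) show ?thesis
  proof (induction rule: burnside_loc_induct[OF p, consumes 1, case_names one scaled_biset diff])
    case one
    then show ?case using cB by (simp add: biset_comp_one[OF p p_group_group p_group_group assms(1)])
  next
    case (diff x y)
    then show ?case using cB by (simp add: biset_comp_diff_left[OF p p_group_group p_group_group assms(1)])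
  next
    case (scaled_biset X r)
    note bS = subgroup_coset_biset[OF S.subgroup_self]
    show ?case
      unfolding inclusion_basic_eq
        biset_comp_scaled[OF p bS scaled_biset(1) p_group_group p_group_group assms(1) scaled_biset(2) one]
      using scaled_biset_iso[OF p biset_product_biset[OF bS scaled_biset(1) p_group_group p_group_group assms(1)] scaled_biset(1)
          coset_biset_unit_right[OF scaled_biset(1) p_group_group assms(1) p_group_finite]] by simp
  qed
qed

lemma subgroup_span_scale:
  assumes "r \<in> Z_loc p" "e \<in> subgroup_span"
  shows "\<iota> r (carrier S) \<bullet> e \<in> subgroup_span"
proof -
  have one: "1 \<in> Z_loc p"
    using Z_loc_of_int[OF p, of 1] by simp
  interpret D: subgroup subgroup_span \<A> by (rule subgroup_span_subgroup)
  note cB = inclusion_basic_closed[OF S.subgroup_self assms(1)]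
  have gen: "\<iota> r (carrier S) \<bullet> \<iota> t T = \<iota> (r * t) T" if "t \<in> Z_loc p" "subgroup T S" for t T
    using that coset_biset_unit_left[OF subgroup_coset_biset[OF that(2)] p_group_group p_group_group p_group_finite]
    unfolding inclusion_basic_eq biset_comp_scaled[OF p subgroup_coset_biset[OF that(2)]
        subgroup_coset_biset[OF S.subgroup_self] p_group_group p_group_group p_group_group assms(1) that(1)]
    by (intro scaled_biset_iso[OF p] biset_product_biset subgroup_coset_biset p_group_group S.subgroup_self)
  from assms(2) show ?thesis
  proof (induction rule: generate.induct)
    case one
    show ?case using self_comp_one(2)[OF cB] by (simp add: D.one_closed)
  next
    case (incl h)
    then obtain t T where "h = \<iota> t T" "t \<in> Z_loc p" "subgroup T S" by blast
    then show ?case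
      using gen Z_loc_mult[OF p assms(1)] subgroup_span_generator by simp
  next
    case (inv h)
    then obtain t T where "h = \<iota> t T" "t \<in> Z_loc p" "subgroup T S" by blast
    then show ?case
      using gen Z_loc_mult[OF p assms(1)] subgroup_span_generator
      by (simp add: self_comp_inv_right cB inclusion_basic_closed D.m_inv_closed)
  next
    case (eng h h')
    then show ?case
      using subgroup_span_carrier D.m_closed by (simp add: self_comp_mult_right cB)
  qed
qed

text \<open>The multiples of \<open>e\<close> form a subgroup \<open>J\<close> closed under scaling. If it contains the elements of all
proper subgroups of \<open>P\<close>, the leading term of \<open>[P, id] \<circ> e\<close> lies in it as well, and its
coefficient is a unit.\<close>

lemma subgroup_span_invertible:
  assumes e: "e \<in> subgroup_span" and unit: "s \<in> Z_loc p" "augmentation S e * s = 1"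
  obtains f where "f \<in> subgroup_span" "f \<bullet> e = \<iota> 1 (carrier S)" "e \<bullet> f = \<iota> 1 (carrier S)"
proof -
  have one: "1 \<in> Z_loc p"
    using Z_loc_of_int[OF p, of 1] by simp
  interpret D: subgroup subgroup_span \<A> by (rule subgroup_span_subgroup)
  note ec = subgroup_span_carrier[OF e] and Dc = subgroup_span_carrier
  let ?J = "(\<lambda>g. g \<bullet> e) ` subgroup_span"
  have J: "subgroup ?J (\<A>)"
  proof (rule A.subgroupI)
    show "?J \<subseteq> carrier \<A>"
      using Dc ec by (auto simp: self_comp_closed)
    show "?J \<noteq> {}"
      using D.one_closed by blast
    show "inv\<^bsub>\<A>\<^esub> a \<in> ?J" if "a \<in> ?J" for a
      using that Dc ec D.m_inv_closed by (auto simp flip: self_comp_inv_left)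
    show "a \<otimes>\<^bsub>\<A>\<^esub> b \<in> ?J" if "a \<in> ?J" "b \<in> ?J" for a b
      using that Dc ec D.m_closed by (auto simp flip: self_comp_mult_left)
  qed
  have scale: "\<iota> (t * r) R \<in> ?J" if "\<iota> r R \<in> ?J" "r \<in> Z_loc p" "t \<in> Z_loc p" "subgroup R S" for t r R
  proof -
    from that obtain g where g: "g \<in> subgroup_span" "\<iota> r R = g \<bullet> e" by blast
    have "\<iota> (t * r) R = \<iota> t (carrier S) \<bullet> \<iota> r R"
      using coset_biset_unit_left[OF subgroup_coset_biset[OF that(4)] p_group_group p_group_group p_group_finite]
      unfolding inclusion_basic_eq biset_comp_scaled[OF p subgroup_coset_biset[OF that(4)]
          subgroup_coset_biset[OF S.subgroup_self] p_group_group p_group_group p_group_group that(3,2)]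
      by (intro scaled_biset_iso[OF p, symmetric] biset_product_biset subgroup_coset_biset p_group_group S.subgroup_self that)
    also have "\<dots> = (\<iota> t (carrier S) \<bullet> g) \<bullet> e"
      unfolding g by (rule biset_comp_assoc[OF p p_group_group p_group_group p_group_group p_group_group ec Dc[OF g(1)] inclusion_basic_closed[OF S.subgroup_self that(3)], symmetric])
    finally show ?thesis
      using subgroup_span_scale[OF that(3) g(1)] by blast
  qed
  have "\<forall>r\<in>Z_loc p. \<iota> r P \<in> ?J" if "subgroup P S" for P
    using that
  proof (induction "card P" arbitrary: P rule: less_induct)
    case less
    note P = less.prems
    have small: "\<iota> r R \<in> ?J" if "subgroup R S" "R \<subset> P" "r \<in> Z_loc p" for R r
      using less.hyps[OF _ that(1)] that psubset_card_mono[OF finite_subset[OF subgroup.subset[OF P] p_group_finite] that(2)]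
      by blast
    obtain d where d: "d \<in> Z_loc p" "augmentation S e \<in> Z_loc p"
      and lead: "\<iota> 1 P \<bullet> e \<otimes>\<^bsub>\<A>\<^esub>
        inv\<^bsub>\<A>\<^esub> \<iota> (augmentation S e + of_nat p * d) P \<in> ?J"
      using span_comp_leading_term[OF e P J small] by blast
    let ?u = "augmentation S e + of_nat p * d"
    have u: "?u \<in> Z_loc p"
      using Z_loc_add[OF p d(2) Z_loc_mult[OF p _ d(1)]] Z_loc_of_int[OF p, of "int p"] by simp
    obtain t where t: "t \<in> Z_loc p" "?u * t = 1"
      by (rule Z_loc_unit_perturb[OF p unit d(1)])
    have Pe: "\<iota> 1 P \<bullet> e \<in> ?J"
      using subgroup_span_generator[OF one P] by blast
    have "inv\<^bsub>\<A>\<^esub> (\<iota> 1 P \<bullet> e \<otimes>\<^bsub>\<A>\<^esub>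
        inv\<^bsub>\<A>\<^esub> \<iota> ?u P) \<otimes>\<^bsub>\<A>\<^esub> (\<iota> 1 P \<bullet> e) \<in> ?J"
      by (intro subgroup.m_closed[OF J] subgroup.m_inv_closed[OF J] lead Pe)
    moreover have "inv\<^bsub>\<A>\<^esub> (\<iota> 1 P \<bullet> e \<otimes>\<^bsub>\<A>\<^esub>
        inv\<^bsub>\<A>\<^esub> \<iota> ?u P) \<otimes>\<^bsub>\<A>\<^esub> (\<iota> 1 P \<bullet> e) = \<iota> ?u P"
      using inclusion_basic_closed[OF P u] self_comp_closed[OF inclusion_basic_closed[OF P one] ec]
      by (simp add: A.inv_mult_group A.m_assoc)
    ultimately have "\<iota> ?u P \<in> ?J"
      by simp
    then have "\<iota> (r * t * ?u) P \<in> ?J" if "r \<in> Z_loc p" for r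
      using scale[OF _ u Z_loc_mult[OF p that t(1)] P] by blast
    then show ?case
      using t(2) by (simp add: mult.assoc mult.commute[of t])
  qed
  then obtain f where f: "f \<in> subgroup_span" "\<iota> 1 (carrier S) = f \<bullet> e"
    using S.subgroup_self one by blast
  then show thesis
    by (intro that[OF f(1)]) (simp_all add: subgroup_span_commute[OF e f(1)])
qed

end

section \<open>Stable elements and the characteristic idempotent\<close>

lemma scaled_basic_closed:
  assumes "prime p" "group G" "group H" "finite (carrier G)" "finite (carrier H)"
    "subgroup U G" "\<phi> \<in> hom (G\<lparr>carrier := U\<rparr>) H" "r \<in> Z_loc p"
  shows "scaled_basic p G H r U \<phi> \<in> carrier (burnside_loc p G H)"
  unfolding scaled_basic_eq by (intro scaled_biset_closed coset_biset_biset assms)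

lemma scaled_basic_comp:
  assumes p: "prime p" and grp: "group G" "group H" "group K"
    and fin: "finite (carrier G)" "finite (carrier H)" "finite (carrier K)"
    and V: "subgroup V G" and \<chi>: "\<chi> \<in> hom (G\<lparr>carrier := V\<rparr>) H" and \<phi>: "\<phi> \<in> hom H K"
    and r: "r \<in> Z_loc p" and s: "s \<in> Z_loc p"
  shows "biset_comp p G H K (scaled_basic p H K r (carrier H) \<phi>) (scaled_basic p G H s V \<chi>) =
    scaled_basic p G K (r * s) V (\<phi> \<circ> \<chi>)"
proof -
  have sub: "subgroup (carrier H) H" by (rule group.subgroup_self[OF grp(2)])
  have \<phi>': "\<phi> \<in> hom (H\<lparr>carrier := carrier H\<rparr>) K" using \<phi> by simp
  have \<phi>\<chi>: "\<phi> \<circ> \<chi> \<in> hom (G\<lparr>carrier := V\<rparr>) K"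
    using \<chi> \<phi> by (auto simp: hom_def Pi_def)
  note X = coset_biset_biset[OF grp(1,2) fin(1,2) V \<chi>] and Y = coset_biset_biset[OF grp(2,3) fin(2,3) sub \<phi>']
    and W = coset_biset_biset[OF grp(1,3) fin(1,3) V \<phi>\<chi>]
  show ?thesis
    unfolding scaled_basic_eq biset_comp_scaled[OF p X Y grp r s]
    using scaled_biset_iso[OF p biset_product_biset[OF X Y grp] W coset_biset_product[OF grp fin V \<chi> \<phi>]]
    by simp
qed

context fusion_system
begin

abbreviation (input) \<A> where "\<A> \<equiv> burnside_loc p S S"

abbreviation (input) \<S> where "\<S> P \<equiv> S\<lparr>carrier := P\<rparr>"

lemma S_group: "group S" and S_finite: "finite (carrier S)"
  using p_group by (auto simp: p_group_def)

lemma restricted: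
  assumes P: "subgroup P S"
  shows "group (\<S> P)" "finite (carrier (\<S> P))"
    "subgroup P (\<S> P)"
    "id \<in> hom ((\<S> P)\<lparr>carrier := P\<rparr>) S" "id \<in> hom (\<S> P) (\<S> P)"
proof -
  show g: "group (\<S> P)"
    by (rule subgroup.subgroup_is_group[OF P S_group])
  show "finite (carrier (\<S> P))"
    using finite_subset[OF subgroup.subset[OF P] S_finite] by simp
  show "subgroup P (\<S> P)"
    using group.subgroup_self[OF g] by simp
  show "id \<in> hom ((\<S> P)\<lparr>carrier := P\<rparr>) S" "id \<in> hom (\<S> P) (\<S> P)"
    using subgroup.mem_carrier[OF P] by (auto simp: hom_def)
qed

lemma morphism:
  assumes P: "subgroup P S" and \<phi>: "\<phi> \<in> F P (carrier S)"
  shows "\<phi> \<in> hom (\<S> P) S" "inj_on \<phi> P" "subgroup (\<phi> ` P) S"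
    "inv_into P \<phi> \<in> hom (S\<lparr>carrier := \<phi> ` P\<rparr>) (\<S> P)"
proof -
  interpret group S by (rule S_group)
  have *: "\<phi> \<in> hom (\<S> P) (S\<lparr>carrier := carrier S\<rparr>) \<and> inj_on \<phi> P"
    using injective_hom[OF P subgroup_self \<phi>] by blast
  then show hom: "\<phi> \<in> hom (\<S> P) S" and inj: "inj_on \<phi> P"
    by auto
  have mult: "\<phi> (x \<otimes>\<^bsub>S\<^esub> y) = \<phi> x \<otimes>\<^bsub>S\<^esub> \<phi> y" if "x \<in> P" "y \<in> P" for x y
    using hom_mult[OF hom] that by simp
  interpret \<phi>: group_hom "\<S> P" S \<phi>
    using hom restricted(1)[OF P] is_group by (auto simp: group_hom_def group_hom_axioms_def)
  show "subgroup (\<phi> ` P) S"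
    using \<phi>.img_is_subgroup by simp
  show "inv_into P \<phi> \<in> hom (S\<lparr>carrier := \<phi> ` P\<rparr>) (\<S> P)"
    using inj subgroup.m_closed[OF P] by (auto simp: hom_def simp flip: mult)
qed

context
  assumes p: "prime p"
begin

lemma one_Z_loc: "1 \<in> Z_loc p"
  using Z_loc_of_int[OF p, of 1] by simp

text \<open>Restriction to \<open>P\<close> followed by induction along \<open>\<phi>\<close>. The two equations differ only in the map along
which the left action is restricted, which is the difference that left stability removes.\<close>

lemma scaled_basic_factor_left:
  assumes P: "subgroup P S" and \<phi>: "\<phi> \<in> F P (carrier S)" and r: "r \<in> Z_loc p"
  shows "scaled_basic p S S r P \<phi> =
      biset_comp p S (\<S> P) S (scaled_basic p (\<S> P) S r P \<phi>) (basic p S (\<S> P) P id)"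
    and "inclusion_basic p S r (\<phi> ` P) =
      biset_comp p S (\<S> P) S (scaled_basic p (\<S> P) S r P \<phi>) (basic p S (\<S> P) (\<phi> ` P) (inv_into P \<phi>))"
proof -
  note RP = restricted[OF P] and m = morphism[OF P \<phi>]
  note c = scaled_basic_comp[OF p S_group RP(1) S_group S_finite RP(2) S_finite _ _ m(1) r one_Z_loc]
  show "scaled_basic p S S r P \<phi> =
      biset_comp p S (\<S> P) S (scaled_basic p (\<S> P) S r P \<phi>) (basic p S (\<S> P) P id)"
    using c[OF P RP(5)] by simp
  have "twisted_diagonal (\<phi> ` P) (\<phi> \<circ> inv_into P \<phi>) = twisted_diagonal (\<phi> ` P) id"
    by (auto simp: twisted_diagonal_def f_inv_into_f)
  then show "inclusion_basic p S r (\<phi> ` P) =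
      biset_comp p S (\<S> P) S (scaled_basic p (\<S> P) S r P \<phi>) (basic p S (\<S> P) (\<phi> ` P) (inv_into P \<phi>))"
    using c[OF m(3,4)] by (simp add: inclusion_basic_eq scaled_basic_eq)
qed

text \<open>Here the scalar sits in the inner factor, because right stability concerns the unscaled
\<open>[P, \<phi>]\<close> from \<open>P\<close> to \<open>S\<close>.\<close>

lemma scaled_basic_factor_right:
  assumes P: "subgroup P S" and \<phi>: "\<phi> \<in> hom (\<S> P) S" and r: "r \<in> Z_loc p"
  shows "scaled_basic p S S r P \<phi> =
      biset_comp p S (\<S> P) S (basic p (\<S> P) S P \<phi>) (scaled_basic p S (\<S> P) r P id)"
  using scaled_basic_comp[OF p S_group restricted(1)[OF P] S_group S_finite restricted(2)[OF P] S_finite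
      P restricted(5)[OF P] \<phi> one_Z_loc r] by simp

lemma factors_closed:
  assumes P: "subgroup P S" and \<phi>: "\<phi> \<in> F P (carrier S)" and r: "r \<in> Z_loc p"
  shows "scaled_basic p (\<S> P) S r P \<phi> \<in> carrier (burnside_loc p (\<S> P) S)"
    "scaled_basic p (\<S> P) S r P id \<in> carrier (burnside_loc p (\<S> P) S)"
    "scaled_basic p S (\<S> P) r P id \<in> carrier (burnside_loc p S (\<S> P))"
    "scaled_basic p S (\<S> P) r (\<phi> ` P) (inv_into P \<phi>) \<in> carrier (burnside_loc p S (\<S> P))"
    "scaled_basic p S S r P \<phi> \<in> carrier (burnside_loc p S S)"
  using restricted[OF P] morphism[OF P \<phi>]
  by (intro scaled_basic_closed p S_group S_finite r P; simp)+

lemma scaled_basic_left_stable: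
  assumes G: "group G" and x: "x \<in> carrier (burnside_loc p G S)" and st: "left_stable p G S F x"
    and P: "subgroup P S" and \<phi>: "\<phi> \<in> F P (carrier S)" and r: "r \<in> Z_loc p"
  shows "biset_comp p G S S (scaled_basic p S S r P \<phi>) x = biset_comp p G S S (inclusion_basic p S r (\<phi> ` P)) x"
proof -
  note cl = factors_closed[OF P \<phi> one_Z_loc]
  note as = biset_comp_assoc[OF p G S_group restricted(1)[OF P] S_group x _ factors_closed(1)[OF P \<phi> r]]
  show ?thesis
    unfolding scaled_basic_factor_left[OF P \<phi> r] as[OF cl(3)] as[OF cl(4)]
    using st P \<phi> by (simp add: left_stable_def)
qed

lemma scaled_basic_right_stable:
  assumes H: "group H" and x: "x \<in> carrier (burnside_loc p S H)" and st: "right_stable p S F H x"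
    and P: "subgroup P S" and \<phi>: "\<phi> \<in> F P (carrier S)" and r: "r \<in> Z_loc p"
  shows "biset_comp p S S H x (scaled_basic p S S r P \<phi>) = biset_comp p S S H x (inclusion_basic p S r P)"
proof -
  note cl = factors_closed[OF P \<phi> one_Z_loc]
  note as = biset_comp_assoc[OF p S_group restricted(1)[OF P] S_group H factors_closed(3)[OF P \<phi> r] _ x, symmetric]
  show ?thesis
    unfolding inclusion_basic_def scaled_basic_factor_right[OF P morphism(1)[OF P \<phi>] r]
      scaled_basic_factor_right[OF P inclusion_hom[OF S_group S_finite P] r] as[OF cl(1)] as[OF cl(2)]
    using st P \<phi> by (simp add: right_stable_def)
qed

text \<open>Left stability is an equation between composites from the left, so associativity transports it
from the left factor to the composite.\<close>

lemma left_stable_comp: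
  assumes G: "group G" and H: "group H" and y: "y \<in> carrier (burnside_loc p H S)"
    and x: "x \<in> carrier (burnside_loc p G H)" and st: "left_stable p H S F y"
  shows "left_stable p G S F (biset_comp p G H S y x)"
  unfolding left_stable_def
proof (intro allI impI ballI)
  fix P \<phi> assume P: "subgroup P S" and \<phi>: "\<phi> \<in> F P (carrier S)"
  note cl = factors_closed[OF P \<phi> one_Z_loc]
  note as = biset_comp_assoc[OF p G H S_group restricted(1)[OF P] x y, symmetric]
  show "biset_comp p G S (\<S> P) (basic p S (\<S> P) (\<phi> ` P) (inv_into P \<phi>)) (biset_comp p G H S y x) =
    biset_comp p G S (\<S> P) (basic p S (\<S> P) P id) (biset_comp p G H S y x)"
    unfolding as[OF cl(3)] as[OF cl(4)] using st P \<phi> by (simp add: left_stable_def)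
qed

lemma right_stable_comp:
  assumes H: "group H" and K: "group K" and y: "y \<in> carrier (burnside_loc p H K)"
    and x: "x \<in> carrier (burnside_loc p S H)" and st: "right_stable p S F H x"
  shows "right_stable p S F K (biset_comp p S H K y x)"
  unfolding right_stable_def
proof (intro allI impI ballI)
  fix P \<phi> assume P: "subgroup P S" and \<phi>: "\<phi> \<in> F P (carrier S)"
  note cl = factors_closed[OF P \<phi> one_Z_loc]
  note as = biset_comp_assoc[OF p restricted(1)[OF P] S_group H K _ x y]
  show "biset_comp p (\<S> P) S K (biset_comp p S H K y x) (basic p (\<S> P) S P \<phi>) =
    biset_comp p (\<S> P) S K (biset_comp p S H K y x) (basic p (\<S> P) S P id)"
    unfolding as[OF cl(1)] as[OF cl(2)] using st P \<phi> by (simp add: right_stable_def)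
qed

lemma left_stable_subgroup:
  assumes G: "group G"
  shows "subgroup {x \<in> carrier (burnside_loc p G S). left_stable p G S F x} (burnside_loc p G S)"
proof -
  interpret A: comm_group "burnside_loc p G S" by (rule burnside_loc_comm_group[OF p])
  have diff: "left_stable p G S F (x \<otimes>\<^bsub>burnside_loc p G S\<^esub> inv\<^bsub>burnside_loc p G S\<^esub> y)"
    if "x \<in> carrier (burnside_loc p G S)" "y \<in> carrier (burnside_loc p G S)"
      "left_stable p G S F x" "left_stable p G S F y" for x y
    using that factors_closed(3,4)[OF _ _ one_Z_loc]
    by (simp add: left_stable_def biset_comp_diff_right[OF p G S_group restricted(1)])
  have one: "left_stable p G S F \<one>\<^bsub>burnside_loc p G S\<^esub>"
    using factors_closed(3,4)[OF _ _ one_Z_loc]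
    by (simp add: left_stable_def biset_comp_one(2)[OF p G S_group restricted(1)])
  have inv: "left_stable p G S F (inv\<^bsub>burnside_loc p G S\<^esub> y)"
    if "y \<in> carrier (burnside_loc p G S)" "left_stable p G S F y" for y
    using diff[OF A.one_closed that(1) one that(2)] that(1) by simp
  show ?thesis
    by (rule A.subgroupI)
      (use one inv diff[OF _ A.inv_closed] in \<open>auto 0 3 simp del: A.one_closed intro: A.one_closed\<close>)
qed

lemma right_stable_subgroup:
  assumes H: "group H"
  shows "subgroup {x \<in> carrier (burnside_loc p S H). right_stable p S F H x} (burnside_loc p S H)"
proof -
  interpret A: comm_group "burnside_loc p S H" by (rule burnside_loc_comm_group[OF p])
  have c: "basic p (\<S> P) S P id \<in> carrier (burnside_loc p (\<S> P) S)"
    "basic p (\<S> P) S P \<phi> \<in> carrier (burnside_loc p (\<S> P) S)"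
    if "subgroup P S" "\<phi> \<in> F P (carrier S)" for P \<phi>
    using factors_closed(2,1)[OF that one_Z_loc] .
  have diff: "right_stable p S F H (x \<otimes>\<^bsub>burnside_loc p S H\<^esub> inv\<^bsub>burnside_loc p S H\<^esub> y)"
    if "x \<in> carrier (burnside_loc p S H)" "y \<in> carrier (burnside_loc p S H)"
      "right_stable p S F H x" "right_stable p S F H y" for x y
    using that c by (simp add: right_stable_def biset_comp_diff_left[OF p restricted(1) S_group H])
  have one: "right_stable p S F H \<one>\<^bsub>burnside_loc p S H\<^esub>"
    using c by (simp add: right_stable_def biset_comp_one(1)[OF p restricted(1) S_group H])
  have inv: "right_stable p S F H (inv\<^bsub>burnside_loc p S H\<^esub> y)"
    if "y \<in> carrier (burnside_loc p S H)" "right_stable p S F H y" for y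
    using diff[OF A.one_closed that(1) one that(2)] that(1) by simp
  show ?thesis
    by (rule A.subgroupI)
      (use one inv diff[OF _ A.inv_closed] in \<open>auto 0 3 simp del: A.one_closed intro: A.one_closed\<close>)
qed

text \<open>Common part of the left and the right case: if each generator \<open>r [P, \<phi>]\<close> is related to some
\<open>r [Q, id]\<close> with \<open>|Q| = |P|\<close>, by a relation compatible with differences, then so is every
\<open>F\<close>-generated element. The equality of orders keeps the augmentation unchanged.\<close>

lemma F_generated_replacement:
  assumes \<omega>: "F_generated p S F \<omega>"
    and gen: "\<And>r P \<phi>. r \<in> Z_loc p \<Longrightarrow> subgroup P S \<Longrightarrow> \<phi> \<in> F P (carrier S) \<Longrightarrow>
      \<exists>Q. subgroup Q S \<and> card Q = card P \<and> R (scaled_basic p S S r P \<phi>) (inclusion_basic p S r Q)"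
    and one: "R \<one>\<^bsub>\<A>\<^esub> \<one>\<^bsub>\<A>\<^esub>"
    and diff: "\<And>h h' e e'. h \<in> carrier \<A> \<Longrightarrow> h' \<in> carrier \<A> \<Longrightarrow> e \<in> carrier \<A> \<Longrightarrow> e' \<in> carrier \<A> \<Longrightarrow>
      R h e \<Longrightarrow> R h' e' \<Longrightarrow> R (h \<otimes>\<^bsub>\<A>\<^esub> inv\<^bsub>\<A>\<^esub> h') (e \<otimes>\<^bsub>\<A>\<^esub> inv\<^bsub>\<A>\<^esub> e')"
  shows "\<exists>e\<in>subgroup_span p S. augmentation S e = augmentation S \<omega> \<and> R \<omega> e"
proof -
  interpret S: group S by (rule S_group)
  interpret A: comm_group \<A> by (rule burnside_loc_comm_group[OF p])
  interpret D: subgroup "subgroup_span p S" \<A> by (rule subgroup_span_subgroup[OF p p_group])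
  let ?gens = "{scaled_basic p S S r P \<phi> |r P \<phi>. r \<in> Z_loc p \<and> subgroup P S \<and> \<phi> \<in> F P (carrier S)}"
  have gens: "?gens \<subseteq> carrier \<A>"
    using factors_closed(5) by auto
  have inv_R: "R (inv\<^bsub>\<A>\<^esub> h) (inv\<^bsub>\<A>\<^esub> e)" if "h \<in> carrier \<A>" "e \<in> carrier \<A>" "R h e" for h e
    using diff[OF A.one_closed that(1) A.one_closed that(2) one that(3)] that(1,2) by simp
  have mult_R: "R (h \<otimes>\<^bsub>\<A>\<^esub> h') (e \<otimes>\<^bsub>\<A>\<^esub> e')"
    if "h \<in> carrier \<A>" "h' \<in> carrier \<A>" "e \<in> carrier \<A>" "e' \<in> carrier \<A>" "R h e" "R h' e'" for h h' e e'
    using diff[OF that(1) A.inv_closed[OF that(2)] that(3) A.inv_closed[OF that(4)] that(5) inv_R[OF that(2,4,6)]]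
      that(1-4) by simp
  have base: "\<exists>e\<in>subgroup_span p S. augmentation S e = augmentation S h \<and> R h e" if "h \<in> ?gens" for h
  proof -
    from that obtain r P \<phi> where h: "h = scaled_basic p S S r P \<phi>" and r: "r \<in> Z_loc p" and P: "subgroup P S"
      and \<phi>: "\<phi> \<in> F P (carrier S)" by blast
    obtain Q where Q: "subgroup Q S" "card Q = card P" "R h (inclusion_basic p S r Q)"
      using gen[OF r P \<phi>] h by blast
    have "card P > 0"
      using finite_subset[OF subgroup.subset[OF P] S_finite] subgroup.one_closed[OF P] by (auto simp: card_gt_0_iff)
    then have "card (lcosets\<^bsub>S\<^esub> Q) = card (lcosets\<^bsub>S\<^esub> P)"
      using S.l_lagrange[OF S_finite P] S.l_lagrange[OF S_finite Q(1)] Q(2) by (metis mult_cancel2 less_irrefl)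
    then have "augmentation S (inclusion_basic p S r Q) = augmentation S h"
      unfolding h augmentation_inclusion_basic[OF p p_group Q(1) r]
        augmentation_scaled_basic[OF p p_group P r morphism(1)[OF P \<phi>]] by simp
    then show ?thesis
      using Q subgroup_span_generator[OF p p_group r Q(1)] by blast
  qed
  show ?thesis
    using \<omega> unfolding F_generated_def
  proof (induction rule: generate.induct)
    case one
    then show ?case using \<open>R \<one>\<^bsub>\<A>\<^esub> \<one>\<^bsub>\<A>\<^esub>\<close> by (intro bexI[of _ "\<one>\<^bsub>\<A>\<^esub>"]) auto
  next
    case (incl h)
    then show ?case by (rule base)
  next
    case (inv h)
    from base[OF inv] obtain e where e: "e \<in> subgroup_span p S" "augmentation S e = augmentation S h" "R h e"
      by blast
    have c: "h \<in> carrier \<A>" "e \<in> carrier \<A>"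
      using gens inv e(1) D.subset by auto
    show ?case
      using e(2) c D.m_inv_closed[OF e(1)] inv_R[OF c e(3)]
      by (intro bexI[of _ "inv\<^bsub>\<A>\<^esub> e"]) (auto simp: augmentation_inv[OF p])
  next
    case (eng h h')
    then obtain e e' where e: "e \<in> subgroup_span p S" "augmentation S e = augmentation S h" "R h e"
      and e': "e' \<in> subgroup_span p S" "augmentation S e' = augmentation S h'" "R h' e'"
      by blast
    have c: "h \<in> carrier \<A>" "h' \<in> carrier \<A>" "e \<in> carrier \<A>" "e' \<in> carrier \<A>"
      using A.generate_in_carrier[OF gens] eng(1,2) e(1) e'(1) D.subset by auto
    show ?case
      using e e' c D.m_closed[OF e(1) e'(1)] mult_R[OF c e(3) e'(3)]
      by (intro bexI[of _ "e \<otimes>\<^bsub>\<A>\<^esub> e'"]) (auto simp: augmentation_mult[OF p])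
  qed
qed

text \<open>On left stable elements \<open>[P, \<phi>]\<close> acts from the left as \<open>[\<phi> P, id]\<close>: the map \<open>\<phi>\<close> is absorbed by the
restriction, so that only its image survives.\<close>

lemma F_generated_left_stable:
  assumes G: "group G" and \<omega>: "F_generated p S F \<omega>"
  shows "\<exists>e\<in>subgroup_span p S. augmentation S e = augmentation S \<omega> \<and>
    (\<forall>x\<in>carrier (burnside_loc p G S). left_stable p G S F x \<longrightarrow> biset_comp p G S S \<omega> x = biset_comp p G S S e x)"
proof (rule F_generated_replacement[OF \<omega>])
  fix r P \<phi> assume r: "r \<in> Z_loc p" and P: "subgroup P S" and \<phi>: "\<phi> \<in> F P (carrier S)"
  show "\<exists>Q. subgroup Q S \<and> card Q = card P \<and> (\<forall>x\<in>carrier (burnside_loc p G S). left_stable p G S F x \<longrightarrow>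
      biset_comp p G S S (scaled_basic p S S r P \<phi>) x = biset_comp p G S S (inclusion_basic p S r Q) x)"
    using morphism(3)[OF P \<phi>] card_image[OF morphism(2)[OF P \<phi>]] scaled_basic_left_stable[OF G _ _ P \<phi> r]
    by blast
qed (simp_all add: biset_comp_diff_left[OF p G S_group S_group])

text \<open>Acting from the right, \<open>[P, \<phi>]\<close> first induces along \<open>\<phi>\<close>, which right stability replaces by the
inclusion of \<open>P\<close>; here the domain survives.\<close>

lemma F_generated_right_stable:
  assumes H: "group H" and \<omega>: "F_generated p S F \<omega>"
  shows "\<exists>e\<in>subgroup_span p S. augmentation S e = augmentation S \<omega> \<and>
    (\<forall>x\<in>carrier (burnside_loc p S H). right_stable p S F H x \<longrightarrow> biset_comp p S S H x \<omega> = biset_comp p S S H x e)"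
proof (rule F_generated_replacement[OF \<omega>])
  fix r P \<phi> assume r: "r \<in> Z_loc p" and P: "subgroup P S" and \<phi>: "\<phi> \<in> F P (carrier S)"
  show "\<exists>Q. subgroup Q S \<and> card Q = card P \<and> (\<forall>x\<in>carrier (burnside_loc p S H). right_stable p S F H x \<longrightarrow>
      biset_comp p S S H x (scaled_basic p S S r P \<phi>) = biset_comp p S S H x (inclusion_basic p S r Q))"
    using P scaled_basic_right_stable[OF H _ _ P \<phi> r] by blast
qed (simp_all add: biset_comp_diff_right[OF p S_group S_group H])

text \<open>With the \<open>e\<close> of \<open>F_generated_left_stable\<close>, \<open>y = \<omega> \<circ> x\<close> is left stable, so \<open>e \<circ> y = \<omega> \<circ> y = y\<close> by idempotency, while
\<open>y = e \<circ> x\<close>. Thus \<open>e \<circ> y = e \<circ> x\<close>, and applying the inverse of \<open>e\<close> gives \<open>y = x\<close>.\<close>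

lemma characteristic_idempotent_left_unit:
  assumes \<omega>: "characteristic_idempotent p S F \<omega>" and G: "group G"
    and x: "x \<in> carrier (burnside_loc p G S)" and st: "left_stable p G S F x"
  shows "biset_comp p G S S \<omega> x = x"
proof -
  from \<omega> have wc: "\<omega> \<in> carrier (burnside_loc p S S)" and ww: "biset_comp p S S S \<omega> \<omega> = \<omega>"
    and gen: "F_generated p S F \<omega>" and wl: "left_stable p S S F \<omega>"
    and unit: "\<exists>s\<in>Z_loc p. augmentation S \<omega> * s = 1"
    by (auto simp: characteristic_idempotent_def F_characteristic_def)
  obtain e where e: "e \<in> subgroup_span p S" "augmentation S e = augmentation S \<omega>"
    and we: "\<And>x. x \<in> carrier (burnside_loc p G S) \<Longrightarrow> left_stable p G S F x \<Longrightarrow>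
      biset_comp p G S S \<omega> x = biset_comp p G S S e x"
    using F_generated_left_stable[OF G gen] by blast
  from unit obtain s where s: "s \<in> Z_loc p" "augmentation S e * s = 1"
    using e(2) by auto
  obtain f where f: "f \<in> subgroup_span p S" "biset_comp p S S S f e = inclusion_basic p S 1 (carrier S)"
      "biset_comp p S S S e f = inclusion_basic p S 1 (carrier S)"
    by (rule subgroup_span_invertible[OF p p_group e(1) s])
  have ec: "e \<in> carrier (burnside_loc p S S)" and fc: "f \<in> carrier (burnside_loc p S S)"
    using subgroup_span_carrier[OF p p_group] e(1) f(1) by auto
  let ?y = "biset_comp p G S S \<omega> x"
  have y: "?y \<in> carrier (burnside_loc p G S)" "left_stable p G S F ?y"
    using biset_comp_closed[OF p G S_group S_group wc x] left_stable_comp[OF G S_group wc x wl] .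
  note as = biset_comp_assoc[OF p G S_group S_group S_group]
  note unit = comp_inclusion_unit[OF p p_group G]
  have "biset_comp p G S S e ?y = ?y"
    using we[OF y] as[OF x wc wc] ww by simp
  then have "biset_comp p G S S f (biset_comp p G S S e ?y) = biset_comp p G S S f (biset_comp p G S S e x)"
    using we[OF x st] by simp
  then show ?thesis
    unfolding as[OF y(1) ec fc, symmetric] as[OF x ec fc, symmetric] f(2) unit[OF y(1)] unit[OF x] .
qed

lemma characteristic_idempotent_right_unit:
  assumes \<omega>: "characteristic_idempotent p S F \<omega>" and H: "group H"
    and x: "x \<in> carrier (burnside_loc p S H)" and st: "right_stable p S F H x"
  shows "biset_comp p S S H x \<omega> = x"
proof -
  from \<omega> have wc: "\<omega> \<in> carrier (burnside_loc p S S)" and ww: "biset_comp p S S S \<omega> \<omega> = \<omega>"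
    and gen: "F_generated p S F \<omega>" and wr: "right_stable p S F S \<omega>"
    and unit: "\<exists>s\<in>Z_loc p. augmentation S \<omega> * s = 1"
    by (auto simp: characteristic_idempotent_def F_characteristic_def)
  obtain e where e: "e \<in> subgroup_span p S" "augmentation S e = augmentation S \<omega>"
    and we: "\<And>x. x \<in> carrier (burnside_loc p S H) \<Longrightarrow> right_stable p S F H x \<Longrightarrow>
      biset_comp p S S H x \<omega> = biset_comp p S S H x e"
    using F_generated_right_stable[OF H gen] by blast
  from unit obtain s where s: "s \<in> Z_loc p" "augmentation S e * s = 1"
    using e(2) by auto
  obtain f where f: "f \<in> subgroup_span p S" "biset_comp p S S S f e = inclusion_basic p S 1 (carrier S)"
      "biset_comp p S S S e f = inclusion_basic p S 1 (carrier S)"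
    by (rule subgroup_span_invertible[OF p p_group e(1) s])
  have ec: "e \<in> carrier (burnside_loc p S S)" and fc: "f \<in> carrier (burnside_loc p S S)"
    using subgroup_span_carrier[OF p p_group] e(1) f(1) by auto
  let ?y = "biset_comp p S S H x \<omega>"
  have y: "?y \<in> carrier (burnside_loc p S H)" "right_stable p S F H ?y"
    using biset_comp_closed[OF p S_group S_group H x wc] right_stable_comp[OF S_group H x wc wr] .
  note as = biset_comp_assoc[OF p S_group S_group S_group H]
  note unit = comp_inclusion_unit_right[OF p p_group H]
  have "biset_comp p S S H ?y e = ?y"
    using we[OF y] as[OF wc wc x] ww by simp
  then have "biset_comp p S S H (biset_comp p S S H ?y e) f = biset_comp p S S H (biset_comp p S S H x e) f"
    using we[OF x st] by simp
  then show ?thesis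
    unfolding as[OF fc ec y(1)] as[OF fc ec x] f(3) unit[OF y(1)] unit[OF x] .
qed

end

end

section \<open>The double Burnside ring and its modules\<close>

lemma (in comm_group) subgroup_comm_group:
  assumes "subgroup H G"
  shows "comm_group (G\<lparr>carrier := H\<rparr>)"
  by (rule group.group_comm_groupI[OF subgroup.subgroup_is_group[OF assms is_group]])
    (simp add: m_comm subgroup.mem_carrier[OF assms])

text \<open>Two fusion systems over the same prime. The case of two equal systems describes the double
Burnside ring.\<close>

locale fusion_pair = F1: fusion_system p S\<^sub>1 F\<^sub>1 + F2: fusion_system p S\<^sub>2 F\<^sub>2
  for p :: nat and S\<^sub>1 :: "('a, 'm) monoid_scheme" and F\<^sub>1
    and S\<^sub>2 :: "('b, 'n) monoid_scheme" and F\<^sub>2 +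
  assumes p: "prime p"
begin

lemma stable_subgroup:
  "subgroup (carrier (stable_module p S\<^sub>1 F\<^sub>1 S\<^sub>2 F\<^sub>2)) (burnside_loc p S\<^sub>1 S\<^sub>2)"
proof -
  interpret A: comm_group "burnside_loc p S\<^sub>1 S\<^sub>2" by (rule burnside_loc_comm_group[OF p])
  have "carrier (stable_module p S\<^sub>1 F\<^sub>1 S\<^sub>2 F\<^sub>2) =
      {x \<in> carrier (burnside_loc p S\<^sub>1 S\<^sub>2). right_stable p S\<^sub>1 F\<^sub>1 S\<^sub>2 x} \<inter>
      {x \<in> carrier (burnside_loc p S\<^sub>1 S\<^sub>2). left_stable p S\<^sub>1 S\<^sub>2 F\<^sub>2 x}"
    by (auto simp: stable_module_def)
  then show ?thesis
    using A.subgroups_Inter_pair[OF F1.right_stable_subgroup[OF p F2.S_group]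
        F2.left_stable_subgroup[OF p F1.S_group]] by simp
qed

lemma stable_comm_group: "comm_group (stable_module p S\<^sub>1 F\<^sub>1 S\<^sub>2 F\<^sub>2)"
  using comm_group.subgroup_comm_group[OF burnside_loc_comm_group[OF p] stable_subgroup]
  by (simp add: stable_module_def)

lemma stable_iff: "x \<in> carrier (stable_module p S\<^sub>1 F\<^sub>1 S\<^sub>2 F\<^sub>2) \<longleftrightarrow>
    x \<in> carrier (burnside_loc p S\<^sub>1 S\<^sub>2) \<and> right_stable p S\<^sub>1 F\<^sub>1 S\<^sub>2 x \<and> left_stable p S\<^sub>1 S\<^sub>2 F\<^sub>2 x"
  by (simp add: stable_module_def)

lemma stable_mult: "x \<otimes>\<^bsub>stable_module p S\<^sub>1 F\<^sub>1 S\<^sub>2 F\<^sub>2\<^esub> y = x \<otimes>\<^bsub>burnside_loc p S\<^sub>1 S\<^sub>2\<^esub> y"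
  by (simp add: stable_module_def)

end

lemma fusion_pair_self: "prime p \<Longrightarrow> fusion_system p S F \<Longrightarrow> fusion_pair p S F S F"
  by (simp add: fusion_pair_def fusion_pair_axioms_def)

lemma double_burnside_ring_simps:
  "carrier (double_burnside_ring p S F \<omega>) = carrier (stable_module p S F S F)"
  "x \<otimes>\<^bsub>double_burnside_ring p S F \<omega>\<^esub> y = biset_comp p S S S x y"
  "x \<oplus>\<^bsub>double_burnside_ring p S F \<omega>\<^esub> y = x \<otimes>\<^bsub>burnside_loc p S S\<^esub> y"
  "\<one>\<^bsub>double_burnside_ring p S F \<omega>\<^esub> = \<omega>"
  by (simp_all add: double_burnside_ring_def stable_module_def)

lemma double_burnside_ring_ring:
  assumes p: "prime p" and F: "fusion_system p S F" and \<omega>: "characteristic_idempotent p S F \<omega>"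
  shows "ring (double_burnside_ring p S F \<omega>)"
proof -
  interpret F: fusion_system p S F by fact
  interpret FF: fusion_pair p S F S F by (rule fusion_pair_self[OF p F])
  interpret M: comm_group "stable_module p S F S F" by (rule FF.stable_comm_group)
  note S = F.S_group
  note st = FF.stable_iff
  have "comm_group (add_monoid (double_burnside_ring p S F \<omega>))"
  proof -
    have "add_monoid (double_burnside_ring p S F \<omega>) = \<lparr>carrier = carrier (stable_module p S F S F),
        monoid.mult = monoid.mult (stable_module p S F S F), one = one (stable_module p S F S F)\<rparr>"
      by (simp add: double_burnside_ring_def)
    also have "\<dots> = stable_module p S F S F"
      by simp
    finally show ?thesis
      using FF.stable_comm_group by simp
  qed
  then have add: "abelian_group (double_burnside_ring p S F \<omega>)"
    by (rule comm_group_abelian_groupI)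
  have wst: "\<omega> \<in> carrier (stable_module p S F S F)"
    using \<omega> by (simp add: st characteristic_idempotent_def F_characteristic_def)
  have mult: "monoid (double_burnside_ring p S F \<omega>)"
  proof (rule monoidI, unfold double_burnside_ring_simps)
    fix x y assume "x \<in> carrier (stable_module p S F S F)" "y \<in> carrier (stable_module p S F S F)"
    then show "biset_comp p S S S x y \<in> carrier (stable_module p S F S F)"
      using biset_comp_closed[OF p S S S] F.left_stable_comp[OF p S S] F.right_stable_comp[OF p S S]
      by (simp add: st)
  next
    fix x y z assume "x \<in> carrier (stable_module p S F S F)" "y \<in> carrier (stable_module p S F S F)"
      "z \<in> carrier (stable_module p S F S F)"
    then show "biset_comp p S S S (biset_comp p S S S x y) z = biset_comp p S S S x (biset_comp p S S S y z)"
      by (intro biset_comp_assoc[OF p S S S S]) (simp_all add: st)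
  next
    fix x assume x: "x \<in> carrier (stable_module p S F S F)"
    then show "biset_comp p S S S \<omega> x = x" "biset_comp p S S S x \<omega> = x"
      using F.characteristic_idempotent_left_unit[OF p \<omega> S] F.characteristic_idempotent_right_unit[OF p \<omega> S]
      by (simp_all add: st)
  qed (rule wst)
  show ?thesis
    by (rule ringI[OF add mult])
      (simp_all add: double_burnside_ring_simps st biset_comp_mult_left[OF p S S S] biset_comp_mult_right[OF p S S S])
qed

theorem proposition5p17:
  fixes p :: nat
    and S\<^sub>1 :: "('a, 'm) monoid_scheme"
    and F\<^sub>1 :: "'a set \<Rightarrow> 'a set \<Rightarrow> ('a \<Rightarrow> 'a) set"
    and S\<^sub>2 :: "('b, 'n) monoid_scheme"
    and F\<^sub>2 :: "'b set \<Rightarrow> 'b set \<Rightarrow> ('b \<Rightarrow> 'b) set"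
    and \<omega>\<^sub>1 :: "('a, 'a) burnside_loc"
    and \<omega>\<^sub>2 :: "('b, 'b) burnside_loc"
    and \<pi> :: "('a, 'b) burnside_loc \<Rightarrow> ('a, 'b) burnside_loc"
  assumes "prime p"
    and "saturated_fusion_system p S\<^sub>1 F\<^sub>1"
    and "saturated_fusion_system p S\<^sub>2 F\<^sub>2"
    and "characteristic_idempotent p S\<^sub>1 F\<^sub>1 \<omega>\<^sub>1"
    and "characteristic_idempotent p S\<^sub>2 F\<^sub>2 \<omega>\<^sub>2"
    and "\<And>Y. Y \<in> carrier (burnside_loc p S\<^sub>1 S\<^sub>2) \<Longrightarrow>
      \<pi> Y = biset_comp p S\<^sub>1 S\<^sub>2 S\<^sub>2 \<omega>\<^sub>2 (biset_comp p S\<^sub>1 S\<^sub>1 S\<^sub>2 Y \<omega>\<^sub>1)"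
  shows "left_module_hom (double_burnside_ring p S\<^sub>2 F\<^sub>2 \<omega>\<^sub>2)
      (burnside_loc p S\<^sub>1 S\<^sub>2) (biset_comp p S\<^sub>1 S\<^sub>2 S\<^sub>2)
      (stable_module p S\<^sub>1 F\<^sub>1 S\<^sub>2 F\<^sub>2) (biset_comp p S\<^sub>1 S\<^sub>2 S\<^sub>2) \<pi>
    \<and> right_module_hom (double_burnside_ring p S\<^sub>1 F\<^sub>1 \<omega>\<^sub>1)
      (burnside_loc p S\<^sub>1 S\<^sub>2) (biset_comp p S\<^sub>1 S\<^sub>1 S\<^sub>2)
      (stable_module p S\<^sub>1 F\<^sub>1 S\<^sub>2 F\<^sub>2) (biset_comp p S\<^sub>1 S\<^sub>1 S\<^sub>2) \<pi>"
proof -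
  note p = \<open>prime p\<close> and \<pi> = assms(6)
  interpret F1: fusion_system p S\<^sub>1 F\<^sub>1
    using assms(2) by (rule saturated_fusion_system.axioms(1))
  interpret F2: fusion_system p S\<^sub>2 F\<^sub>2
    using assms(3) by (rule saturated_fusion_system.axioms(1))
  interpret F12: fusion_pair p S\<^sub>1 F\<^sub>1 S\<^sub>2 F\<^sub>2
    by unfold_locales (rule p)
  note S1 = F1.S_group and S2 = F2.S_group
  note R1 = double_burnside_ring_ring[OF p F1.fusion_system_axioms assms(4)]
    and R2 = double_burnside_ring_ring[OF p F2.fusion_system_axioms assms(5)]
  note st1 = fusion_pair.stable_iff[OF fusion_pair_self[OF p F1.fusion_system_axioms]]
    and st2 = fusion_pair.stable_iff[OF fusion_pair_self[OF p F2.fusion_system_axioms]]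
    and st = F12.stable_iff
  from assms(4,5) have w1: "\<omega>\<^sub>1 \<in> carrier (burnside_loc p S\<^sub>1 S\<^sub>1)" "right_stable p S\<^sub>1 F\<^sub>1 S\<^sub>1 \<omega>\<^sub>1"
      "left_stable p S\<^sub>1 S\<^sub>1 F\<^sub>1 \<omega>\<^sub>1"
    and w2: "\<omega>\<^sub>2 \<in> carrier (burnside_loc p S\<^sub>2 S\<^sub>2)" "left_stable p S\<^sub>2 S\<^sub>2 F\<^sub>2 \<omega>\<^sub>2"
      "right_stable p S\<^sub>2 F\<^sub>2 S\<^sub>2 \<omega>\<^sub>2"
    by (auto simp: characteristic_idempotent_def F_characteristic_def)
  note cl1 = biset_comp_closed[OF p S1 S1 S2] and cl2 = biset_comp_closed[OF p S1 S2 S2]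
  note assoc1 = biset_comp_assoc[OF p S1 S1 S1 S2] and assoc2 = biset_comp_assoc[OF p S1 S2 S2 S2]
    and assoc = biset_comp_assoc[OF p S1 S1 S2 S2]
  note mult1 = biset_comp_mult_left[OF p S1 S1 S2] biset_comp_mult_right[OF p S1 S1 S2]
    and mult2 = biset_comp_mult_left[OF p S1 S2 S2] biset_comp_mult_right[OF p S1 S2 S2]
  have stable2: "biset_comp p S\<^sub>1 S\<^sub>2 S\<^sub>2 r x \<in> carrier (stable_module p S\<^sub>1 F\<^sub>1 S\<^sub>2 F\<^sub>2)"
    if "r \<in> carrier (stable_module p S\<^sub>2 F\<^sub>2 S\<^sub>2 F\<^sub>2)" "x \<in> carrier (stable_module p S\<^sub>1 F\<^sub>1 S\<^sub>2 F\<^sub>2)" for r x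
    using that F2.left_stable_comp[OF p S1 S2] F1.right_stable_comp[OF p S2 S2]
    by (simp add: st st2 cl2)
  have stable1: "biset_comp p S\<^sub>1 S\<^sub>1 S\<^sub>2 x r \<in> carrier (stable_module p S\<^sub>1 F\<^sub>1 S\<^sub>2 F\<^sub>2)"
    if "r \<in> carrier (stable_module p S\<^sub>1 F\<^sub>1 S\<^sub>1 F\<^sub>1)" "x \<in> carrier (stable_module p S\<^sub>1 F\<^sub>1 S\<^sub>2 F\<^sub>2)" for r x
    using that F2.left_stable_comp[OF p S1 S1] F1.right_stable_comp[OF p S1 S2]
    by (simp add: st st1 cl1)
  note simps = double_burnside_ring_simps F12.stable_mult
  interpret A: comm_group "burnside_loc p S\<^sub>1 S\<^sub>2"
    by (rule burnside_loc_comm_group[OF p])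
  have M2: "left_module (double_burnside_ring p S\<^sub>2 F\<^sub>2 \<omega>\<^sub>2) (burnside_loc p S\<^sub>1 S\<^sub>2) (biset_comp p S\<^sub>1 S\<^sub>2 S\<^sub>2)"
    unfolding left_module_def simps using R2 A.comm_group_axioms by (simp add: st2 cl2 mult2 assoc2)
  have N2: "left_module (double_burnside_ring p S\<^sub>2 F\<^sub>2 \<omega>\<^sub>2) (stable_module p S\<^sub>1 F\<^sub>1 S\<^sub>2 F\<^sub>2) (biset_comp p S\<^sub>1 S\<^sub>2 S\<^sub>2)"
    unfolding left_module_def simps
    by (intro conjI ballI R2 F12.stable_comm_group stable2) (simp_all add: st st2 mult2 assoc2)
  have M1: "right_module (double_burnside_ring p S\<^sub>1 F\<^sub>1 \<omega>\<^sub>1) (burnside_loc p S\<^sub>1 S\<^sub>2) (biset_comp p S\<^sub>1 S\<^sub>1 S\<^sub>2)"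
    unfolding right_module_def simps using R1 A.comm_group_axioms by (simp add: st1 cl1 mult1 assoc1)
  have N1: "right_module (double_burnside_ring p S\<^sub>1 F\<^sub>1 \<omega>\<^sub>1) (stable_module p S\<^sub>1 F\<^sub>1 S\<^sub>2 F\<^sub>2) (biset_comp p S\<^sub>1 S\<^sub>1 S\<^sub>2)"
    unfolding right_module_def simps
    by (intro conjI ballI R1 F12.stable_comm_group stable1) (simp_all add: st st1 mult1 assoc1)
  have hom: "\<pi> \<in> hom (burnside_loc p S\<^sub>1 S\<^sub>2) (stable_module p S\<^sub>1 F\<^sub>1 S\<^sub>2 F\<^sub>2)"
  proof (rule homI)
    fix x assume x: "x \<in> carrier (burnside_loc p S\<^sub>1 S\<^sub>2)"
    then show "\<pi> x \<in> carrier (stable_module p S\<^sub>1 F\<^sub>1 S\<^sub>2 F\<^sub>2)"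
      using F2.left_stable_comp[OF p S1 S2 w2(1) _ w2(2)] F1.right_stable_comp[OF p S1 S2 _ w1(1,2)]
        F1.right_stable_comp[OF p S2 S2 w2(1)] w1 w2
      by (simp add: \<pi> st cl1 cl2)
  next
    fix x y assume "x \<in> carrier (burnside_loc p S\<^sub>1 S\<^sub>2)" "y \<in> carrier (burnside_loc p S\<^sub>1 S\<^sub>2)"
    then show "\<pi> (x \<otimes>\<^bsub>burnside_loc p S\<^sub>1 S\<^sub>2\<^esub> y) = \<pi> x \<otimes>\<^bsub>stable_module p S\<^sub>1 F\<^sub>1 S\<^sub>2 F\<^sub>2\<^esub> \<pi> y"
      using w1 w2 A.m_closed by (simp add: \<pi> simps cl1 mult1 mult2)
  qed
  have left: "\<pi> (biset_comp p S\<^sub>1 S\<^sub>2 S\<^sub>2 r x) = biset_comp p S\<^sub>1 S\<^sub>2 S\<^sub>2 r (\<pi> x)"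
    if r: "r \<in> carrier (stable_module p S\<^sub>2 F\<^sub>2 S\<^sub>2 F\<^sub>2)" and x: "x \<in> carrier (burnside_loc p S\<^sub>1 S\<^sub>2)" for r x
  proof -
    from r have rc: "r \<in> carrier (burnside_loc p S\<^sub>2 S\<^sub>2)" and rs: "left_stable p S\<^sub>2 S\<^sub>2 F\<^sub>2 r" "right_stable p S\<^sub>2 F\<^sub>2 S\<^sub>2 r"
      by (simp_all add: st2)
    note xw = cl1[OF x w1(1)]
    have "\<pi> (biset_comp p S\<^sub>1 S\<^sub>2 S\<^sub>2 r x) =
        biset_comp p S\<^sub>1 S\<^sub>2 S\<^sub>2 (biset_comp p S\<^sub>2 S\<^sub>2 S\<^sub>2 \<omega>\<^sub>2 r) (biset_comp p S\<^sub>1 S\<^sub>1 S\<^sub>2 x \<omega>\<^sub>1)"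
      unfolding \<pi>[OF cl2[OF rc x]] assoc[OF w1(1) x rc] assoc2[OF xw rc w2(1)] ..
    also have "\<dots> = biset_comp p S\<^sub>1 S\<^sub>2 S\<^sub>2 (biset_comp p S\<^sub>2 S\<^sub>2 S\<^sub>2 r \<omega>\<^sub>2) (biset_comp p S\<^sub>1 S\<^sub>1 S\<^sub>2 x \<omega>\<^sub>1)"
      unfolding F2.characteristic_idempotent_left_unit[OF p assms(5) S2 rc rs(1)]
        F2.characteristic_idempotent_right_unit[OF p assms(5) S2 rc rs(2)] ..
    also have "\<dots> = biset_comp p S\<^sub>1 S\<^sub>2 S\<^sub>2 r (\<pi> x)"
      unfolding \<pi>[OF x] assoc2[OF xw w2(1) rc] ..
    finally show ?thesis .
  qed
  have right: "\<pi> (biset_comp p S\<^sub>1 S\<^sub>1 S\<^sub>2 x r) = biset_comp p S\<^sub>1 S\<^sub>1 S\<^sub>2 (\<pi> x) r"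
    if r: "r \<in> carrier (stable_module p S\<^sub>1 F\<^sub>1 S\<^sub>1 F\<^sub>1)" and x: "x \<in> carrier (burnside_loc p S\<^sub>1 S\<^sub>2)" for r x
  proof -
    from r have rc: "r \<in> carrier (burnside_loc p S\<^sub>1 S\<^sub>1)" and rs: "left_stable p S\<^sub>1 S\<^sub>1 F\<^sub>1 r" "right_stable p S\<^sub>1 F\<^sub>1 S\<^sub>1 r"
      by (simp_all add: st1)
    have "\<pi> (biset_comp p S\<^sub>1 S\<^sub>1 S\<^sub>2 x r) =
        biset_comp p S\<^sub>1 S\<^sub>2 S\<^sub>2 \<omega>\<^sub>2 (biset_comp p S\<^sub>1 S\<^sub>1 S\<^sub>2 x (biset_comp p S\<^sub>1 S\<^sub>1 S\<^sub>1 r \<omega>\<^sub>1))"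
      unfolding \<pi>[OF cl1[OF x rc]] assoc1[OF w1(1) rc x] ..
    also have "\<dots> = biset_comp p S\<^sub>1 S\<^sub>2 S\<^sub>2 \<omega>\<^sub>2 (biset_comp p S\<^sub>1 S\<^sub>1 S\<^sub>2 x (biset_comp p S\<^sub>1 S\<^sub>1 S\<^sub>1 \<omega>\<^sub>1 r))"
      unfolding F1.characteristic_idempotent_left_unit[OF p assms(4) S1 rc rs(1)]
        F1.characteristic_idempotent_right_unit[OF p assms(4) S1 rc rs(2)] ..
    also have "\<dots> = biset_comp p S\<^sub>1 S\<^sub>1 S\<^sub>2 (\<pi> x) r"
      unfolding \<pi>[OF x] assoc1[OF rc w1(1) x, symmetric] assoc[OF rc cl1[OF x w1(1)] w2(1)] ..
    finally show ?thesis .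
  qed
  show ?thesis
    unfolding left_module_hom_def right_module_hom_def
    using M1 M2 N1 N2 hom left right by (simp add: double_burnside_ring_simps)
qed

end
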